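(* Let $M\ge1$ be an integer, let $a_1,\dots,a_M>-1$ be real, let $K_N$ be the correlation kernel of the product of $M$ Laguerre unitary ensembles with parameters $a_1,\dots,a_M$, and let $F$, $G$ be the hypergeometric and Meijer $G$-functions, all as defined in the context. The large $N$ hard edge expansion $$\frac1N K_N\Big(\frac xN,\frac yN\Big)=\int_0^1\bigg(1-\frac1{2N}\Big(x\frac d{dx}+\Big(x\frac d{dx}\Big)^2\Big)\bigg)F(xt)\,\bigg(1+\frac1{2N}\Big(y\frac d{dy}+\Big(y\frac d{dy}\Big)^2\Big)\bigg)G(yt)\,dt+O\Big(\frac1{N^2}\Big)$$ has the simpler form $$\frac1N K_N\Big(\frac xN,\frac yN\Big)=\int_0^1F(xt)\,G(yt)\,dt-\frac1{2N}\Big(x\frac{\partial}{\partial x}-y\frac{\partial}{\partial y}\Big)F(x)\,G(y)+O\Big(\frac1{N^2}\Big).$$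
   Context: Let $w$ be the weight on $(0,\infty)$ given by the multiplicative convolution of the normalised Laguerre weights $x^{a_j}e^{-x}/\Gamma(a_j+1)$, $j=1,\dots,M$: $$w(x)=\int_{(0,\infty)^M}\delta\Big(x-\prod_{j=1}^Mx_j\Big)\prod_{l=1}^M\frac{x_l^{a_l}e^{-x_l}}{\Gamma(a_l+1)}\,dx_1\cdots dx_M.$$ Its Mellin transform $\mathcal M[w](s)=\int_0^\infty y^{s-1}w(y)\,dy$ equals $\prod_{j=1}^M\Gamma(a_j+s)/\Gamma(a_j+1)$. Define $$p_n(x)=(-1)^nn!\,\mathcal M[w](n+1)\sum_{j=0}^n\frac{(-x)^j}{j!(n-j)!\,\mathcal M[w](j+1)},\qquad q_n(x)=\frac1{n!\,\mathcal M[w](n+1)}\frac{d^n}{dx^n}\Big((-x)^nw(x)\Big),$$ and $K_N(x,y)=\sum_{j=0}^{N-1}p_j(x)q_j(y)$. The functions $F$ and $G$ are, with $(u)_j=u(u+1)\cdots(u+j-1)$, $$F(x)={}_0F_M\Big({-\atop a_1+1,\dots,a_M+1}\Big|-x\Big)=\sum_{j=0}^\infty\frac{(-x)^j}{j!\prod_{l=1}^M(a_l+1)_j},$$ $$G(x)=G^{M,0}_{0,M+1}\Big({-\atop a_1,\dots,a_M,0}\Big|x\Big)=\frac1{2\pi i}\int_{c-i\infty}^{c+i\infty}\frac1{\Gamma(1+s)}\prod_{j=1}^M\Gamma(a_j-s)\,x^s\,ds,$$ where the vertical line ${\rm Re}\,s=c$ has all the poles of $\prod_j\Gamma(a_j-s)$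 to its right, that is $c<\min_j a_j$ (for $M=1$ take also $c>(a_1-1)/2$, so that the integral converges, conditionally if need be).
   Formalization: Both right-hand expansions (without the O-term) are multiplied by 1/∏Γ(a_l+1): with F and G as defined the displayed formulas are off by this factor (e.g. M=1, a_1=2: limit too large by 2). The O(1/N²) is for fixed x,y>0. *)

theory Defs
  imports "HOL-Complex_Analysis.Complex_Analysis" "HOL-Library.Landau_Symbols"
begin

text \<open>
  The parameters are \<open>a 1, \<dots>, a M\<close>; values of \<open>a\<close> outside \<open>{1..M}\<close> are never used.
\<close>

definition laguerre_weight :: "real \<Rightarrow> real \<Rightarrow> real" where
  "laguerre_weight \<alpha> x = (if x > 0 then x powr \<alpha> * exp (- x) / Gamma (\<alpha> + 1) else 0)"

text \<open>
  The double integral of \<open>\<delta>(x - v u) f(v) g(u)\<close> over \<open>u, v > 0\<close>, with the delta function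
  integrated out in \<open>v\<close>, which contributes the Jacobian \<open>1 / u\<close>. Iterating this, rather
  than speaking of the density of a product, fixes \<open>w\<close> at every point; this matters because
  \<open>w\<close> is differentiated below.
\<close>

definition mult_conv :: "(real \<Rightarrow> real) \<Rightarrow> (real \<Rightarrow> real) \<Rightarrow> real \<Rightarrow> real" where
  "mult_conv f g x = (LBINT u:{0<..}. f (x / u) * g u / u)"

text \<open>For \<open>M = 0\<close> the convolution would be a point mass; the value there is a dummy.\<close>

fun product_weight :: "nat \<Rightarrow> (nat \<Rightarrow> real) \<Rightarrow> real \<Rightarrow> real" where
  "product_weight 0 a = (\<lambda>x. 0)"
| "product_weight (Suc 0) a = laguerre_weight (a 1)"
| "product_weight (Suc (Suc m)) a =
     mult_conv (product_weight (Suc m) a) (laguerre_weight (a (Suc (Suc m))))"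

definition mellin :: "(real \<Rightarrow> real) \<Rightarrow> real \<Rightarrow> real" where
  "mellin w s = (LBINT y:{0<..}. y powr (s - 1) * w y)"

definition polya_p :: "(real \<Rightarrow> real) \<Rightarrow> nat \<Rightarrow> real \<Rightarrow> real" where
  "polya_p w n x = (- 1) ^ n * fact n * mellin w (real n + 1) *
     (\<Sum>j=0..n. (- x) ^ j / (fact j * fact (n - j) * mellin w (real j + 1)))"

definition polya_q :: "(real \<Rightarrow> real) \<Rightarrow> nat \<Rightarrow> real \<Rightarrow> real" where
  "polya_q w n x = 1 / (fact n * mellin w (real n + 1)) *
     (deriv ^^ n) (\<lambda>u. (- u) ^ n * w u) x"

definition polya_kernel :: "(real \<Rightarrow> real) \<Rightarrow> nat \<Rightarrow> real \<Rightarrow> real \<Rightarrow> real" where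
  "polya_kernel w N x y = (\<Sum>j<N. polya_p w j x * polya_q w j y)"

definition laguerre_kernel :: "nat \<Rightarrow> (nat \<Rightarrow> real) \<Rightarrow> nat \<Rightarrow> real \<Rightarrow> real \<Rightarrow> real" where
  "laguerre_kernel M a = polya_kernel (product_weight M a)"

definition hard_edge_F :: "nat \<Rightarrow> (nat \<Rightarrow> real) \<Rightarrow> real \<Rightarrow> real" where
  "hard_edge_F M a x =
     (\<Sum>j. (- x) ^ j / (fact j * (\<Prod>l=1..M. pochhammer (a l + 1) j)))"

text \<open>
  \<open>c\<close> is the abscissa of the vertical line of integration. The integral over the line is the
  limit of integrals over segments, so that it also makes sense for \<open>M = 1\<close>, where it may
  converge only conditionally. Its value is real for \<open>x > 0\<close>, because the integrand takes
  conjugate values at conjugate points, so \<open>Re\<close> is only a conversion of types.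
\<close>

definition meijer_contour :: "nat \<Rightarrow> (nat \<Rightarrow> real) \<Rightarrow> real \<Rightarrow> bool" where
  "meijer_contour M a c \<longleftrightarrow> (\<forall>j\<in>{1..M}. c < a j) \<and> (M = 1 \<longrightarrow> c > (a 1 - 1) / 2)"

definition hard_edge_G :: "nat \<Rightarrow> (nat \<Rightarrow> real) \<Rightarrow> real \<Rightarrow> real \<Rightarrow> real" where
  "hard_edge_G M a c x = Re (1 / (2 * of_real pi * \<i>) *
     Lim at_top (\<lambda>T::real. contour_integral (linepath (Complex c (- T)) (Complex c T))
       (\<lambda>s. 1 / Gamma (1 + s) * (\<Prod>j=1..M. Gamma (of_real (a j) - s)) * of_real x powr s)))"

definition euler_op :: "(real \<Rightarrow> real) \<Rightarrow> real \<Rightarrow> real" where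
  "euler_op f x = x * deriv f x"

text \<open>\<open>1 + \<epsilon> (x d/dx + (x d/dx)\<^sup>2)\<close>\<close>

definition correction_op :: "real \<Rightarrow> (real \<Rightarrow> real) \<Rightarrow> real \<Rightarrow> real" where
  "correction_op \<epsilon> f x = f x + \<epsilon> * (euler_op f x + euler_op (euler_op f) x)"

text \<open>
  The two expansions up to \<open>O(1 / N\<^sup>2)\<close>, as functionals of \<open>F\<close> and \<open>G\<close>. In the first one the
  operators act on the variables \<open>x\<close> and \<open>y\<close> for fixed \<open>t\<close>.
\<close>

definition hard_edge_expansion ::
  "(real \<Rightarrow> real) \<Rightarrow> (real \<Rightarrow> real) \<Rightarrow> real \<Rightarrow> real \<Rightarrow> nat \<Rightarrow> real" where
  "hard_edge_expansion F G x y N =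
     (LBINT t:{0..1}. correction_op (- (1 / (2 * real N))) (\<lambda>u. F (u * t)) x *
                      correction_op (1 / (2 * real N)) (\<lambda>v. G (v * t)) y)"

definition simpler_expansion ::
  "(real \<Rightarrow> real) \<Rightarrow> (real \<Rightarrow> real) \<Rightarrow> real \<Rightarrow> real \<Rightarrow> nat \<Rightarrow> real" where
  "simpler_expansion F G x y N =
     (LBINT t:{0..1}. F (x * t) * G (y * t)) -
     1 / (2 * real N) * (euler_op (\<lambda>u. F u * G y) x - euler_op (\<lambda>v. F x * G v) y)"

text \<open>
  The kernel does not depend on the normalisation of \<open>w\<close>, and with \<open>F\<close> normalised by
  \<open>F 0 = 1\<close> and \<open>G\<close> by its Mellin-Barnes integral, the limit of \<open>K\<^sub>N(x/N, y/N) / N\<close> is the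
  integral of \<open>F(xt) G(yt)\<close> divided by the following product. For instance, for \<open>M = 1\<close>,
  \<open>F(x) = \<Gamma>(a+1) x\<^bsup>-a/2\<^esup> J\<^sub>a(2\<surd>x)\<close> and \<open>G(y) = y\<^bsup>a/2\<^esup> J\<^sub>a(2\<surd>y)\<close>, whereas the Bessel kernel
  has no Gamma factor.
\<close>

definition gamma_norm :: "nat \<Rightarrow> (nat \<Rightarrow> real) \<Rightarrow> real" where
  "gamma_norm M a = (\<Prod>l=1..M. Gamma (a l + 1))"

end

theory Submission
  imports Defs
begin

text \<open>
  Write \<open>F(x) = \<Sum>\<^sub>j f\<^sub>j x\<^sup>j\<close> and \<open>G(y) = \<integral> \<psi>(\<omega>) y\<^bsup>s(\<omega>)\<^esup> d\<mu>(\<omega>)\<close>, where for \<open>M = 1\<close> the measure is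
  counting measure on the exponents \<open>a + k\<close> (the residues of the Mellin-Barnes integral), and for
  \<open>M \<ge> 2\<close> it is Lebesgue measure on a vertical line \<open>Re s = c'\<close> with \<open>-1 < c' < min a\<^sub>j\<close>, on which the
  Mellin-Barnes integral converges absolutely. Up to a constant, the weight is the same superposition with density
  \<open>\<psi>(\<omega>) \<Gamma>(1 + s(\<omega>))\<close>. Summing over the degree in closed form gives
  \<open>K\<^sub>N(x/N, y/N) / N = const \<integral> \<Sum>\<^sub>j f\<^sub>j x\<^sup>j \<psi> y\<^sup>s b\<^sub>N(j) R\<^sub>N(s) / (s + j + 1) d\<mu>\<close> with
  \<open>b\<^sub>N(j) = \<Prod>\<^sub>k\<^sub>\<le>\<^sub>j (1 - k/N) = 1 - j(j+1)/2N + O(N\<^sup>-\<^sup>2)\<close> and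
  \<open>R\<^sub>N(s) = \<Gamma>(N+1+s) / (N! N\<^sup>s) = 1 + s(s+1)/2N + O(N\<^sup>-\<^sup>2)\<close>, the errors being polynomial in \<open>j\<close> and
  \<open>s\<close> up to a factor \<open>1 + \<Gamma>(2 + Re s)\<close>. The Euler operator multiplies a power by its exponent, so
  this is the first expansion; the second one follows from \<open>s(s+1) - j(j+1) = (s - j)(s + j + 1)\<close>.
\<close>

section \<open>The Gamma ratio and its expansion\<close>

text \<open>One superposition cannot serve every \<open>M\<close>. For \<open>M = 1\<close> the
  Mellin-Barnes integrand decays along a line only like a fixed power of the height, so convergence
  does not survive multiplication by powers of \<open>s\<close>, which the Euler operators and the
  error terms bring in; the residue series converges like an exponential series instead. For
  \<open>M >= 2\<close> residues would bring logarithms when the \<open>a j\<close> differ by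
  integers, whereas the surplus Gamma factors make the line integral decay faster than any power. An
  abstract measure lets one argument treat both.

  The exponents must satisfy Re s > -1: there Gamma(1+s) has no pole, t^(s+j) is integrable on (0,1]
  for every j, and 1/(s+j+1) is bounded. The abscissa in the definition of \<open>G\<close> may lie
  further left, which forces a shift of the contour when \<open>M >= 2\<close>.

  The main obstacle is uniformity. The two expansions in 1/N are informative only for j and s small
  against N, while the sum and the integral run over all of them. Both are therefore proved as
  inequalities for all j, all s with Re s > -1 and all N >= 1, with a majorant that is integrable
  against the coefficients of F(x) G(y).\<close>

lemma norm_le_of_telescoping:
  fixes e :: "nat \<Rightarrow> complex" and g :: "nat \<Rightarrow> real"
  assumes "e \<longlonglongrightarrow> 0" "g \<longlonglongrightarrow> 0"
    and step: "\<And>m. m \<ge> N \<Longrightarrow> norm (e m - e (Suc m)) \<le> g m - g (Suc m)"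
  shows "norm (e N) \<le> g N"
proof -
  have *: "norm (e N - e n) \<le> g N - g n" if "n \<ge> N" for n
    using that
  proof (induction n rule: dec_induct)
    case (step n)
    have "norm (e N - e (Suc n)) \<le> norm (e N - e n) + norm (e n - e (Suc n))"
      using norm_triangle_ineq[of "e N - e n" "e n - e (Suc n)"] by simp
    also have "\<dots> \<le> (g N - g n) + (g n - g (Suc n))"
      using step.IH assms(3)[of n] step.hyps by (intro add_mono) auto
    finally show ?case by simp
  qed auto
  have "(\<lambda>n. norm (e N - e n)) \<longlonglongrightarrow> norm (e N - 0)" "(\<lambda>n. g N - g n) \<longlonglongrightarrow> g N - 0"
    by (intro tendsto_intros assms)+
  then show ?thesis
    using * by (intro LIMSEQ_le[of "\<lambda>n. norm (e N - e n)" _ "\<lambda>n. g N - g n"]) auto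
qed

text \<open>Taylor's theorem on the half plane Re <= ln 2, which is convex, contains 0 and bounds
  \<open>exp\<close> by 2. It is made for w = -s ln(1 + 1/N) with Re s > -1: then Re w <= ln(1 +
  1/N) <= ln 2, whatever the size of s.\<close>

lemma norm_exp_minus_Taylor2_le:
  assumes "Re w \<le> ln 2"
  shows "norm (exp w - (1 + w + w\<^sup>2 / 2)) \<le> norm w ^ 3"
proof -
  have "cmod (exp w - (\<Sum>i\<le>2. exp 0 * (w - 0) ^ i / fact i)) \<le> 2 * cmod (w - 0) ^ Suc 2 / fact 2"
  proof (rule complex_Taylor[of "{z. Re z \<le> ln 2}" 2 "\<lambda>_. exp" 2])
    show "convex {z. Re z \<le> ln 2}" by (rule convex_halfspace_Re_le)
    show "cmod (exp x) \<le> 2" if "x \<in> {z. Re z \<le> ln 2}" for x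
      using that by (simp add: ln_ge_iff)
  qed (use assms in \<open>auto intro: DERIV_subset DERIV_exp\<close>)
  moreover have "(\<Sum>i\<le>2. exp 0 * (w - 0) ^ i / fact i) = 1 + w + w\<^sup>2 / 2"
    by (simp add: numeral_2_eq_2)
  ultimately show ?thesis by (simp add: eval_nat_numeral)
qed

text \<open>At x = 1/N the subtracted terms are 1/(N+1) and 1/(2N(N+1)), the quantities that occur
  in one step of the Gamma ratio. The difference has derivative -u^2 / (2(1+u)^2), which lies
  between -u^2/2 and 0.\<close>

lemma ln_one_plus_expansion:
  fixes x :: real
  assumes "x \<ge> 0"
  shows "\<bar>ln (1 + x) - x / (1 + x) - x\<^sup>2 / (2 * (1 + x))\<bar> \<le> x ^ 3 / 6"
proof -
  define d where "d = (\<lambda>x::real. ln (1 + x) - x / (1 + x) - x\<^sup>2 / (2 * (1 + x)))"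
  have der: "(d has_real_derivative - u\<^sup>2 / (2 * (1 + u)\<^sup>2)) (at u)" if "u \<ge> 0" for u
  proof -
    have "(d has_real_derivative 1 / (1 + u) - (1 * (1 + u) - u * 1) / ((1 + u) * (1 + u)) -
        (2 * u * (2 * (1 + u)) - u\<^sup>2 * 2) / ((2 * (1 + u)) * (2 * (1 + u)))) (at u)"
      unfolding d_def using that by (auto intro!: derivative_eq_intros)
    also have "1 / (1 + u) - (1 * (1 + u) - u * 1) / ((1 + u) * (1 + u)) -
        (2 * u * (2 * (1 + u)) - u\<^sup>2 * 2) / ((2 * (1 + u)) * (2 * (1 + u))) = - u\<^sup>2 / (2 * (1 + u)\<^sup>2)"
      using that by (simp add: divide_simps) (simp add: power2_eq_square algebra_simps)
    finally show ?thesis .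
  qed
  have "d x \<le> d 0"
    by (rule DERIV_nonpos_imp_nonincreasing[OF assms])
       (use der in \<open>metis divide_nonneg_nonneg mult_nonneg_nonneg neg_le_0_iff_le minus_divide_left zero_le_numeral zero_le_power2\<close>)
  moreover have "d 0 + 0 ^ 3 / 6 \<le> d x + x ^ 3 / 6"
  proof (rule DERIV_nonneg_imp_nondecreasing[OF assms, of "\<lambda>u. d u + u ^ 3 / 6"])
    fix u :: real assume u: "0 \<le> u" "u \<le> x"
    have "u\<^sup>2 / (2 * (1 + u)\<^sup>2) \<le> u\<^sup>2 / 2"
      using u one_le_power[of "1 + u" 2] by (intro frac_le) auto
    then show "\<exists>y. ((\<lambda>u. d u + u ^ 3 / 6) has_real_derivative y) (at u) \<and> 0 \<le> y"
      by (intro exI[of _ "- u\<^sup>2 / (2 * (1 + u)\<^sup>2) + u\<^sup>2 / 2"] conjI)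
         (auto intro!: derivative_eq_intros der u)
  qed
  ultimately show ?thesis by (simp add: d_def)
qed

text \<open>In Euler's product \<open>Gamma_series\<close> each denominator factor satisfies |z + k|
  >= Re z + k, while the modulus of the numerator depends on Re z alone.\<close>

lemma norm_Gamma_le_Gamma_Re:
  assumes "Re z > 0"
  shows "norm (Gamma z) \<le> Gamma (Re z)"
proof (rule LIMSEQ_le)
  show "(\<lambda>n. norm (Gamma_series z n)) \<longlonglongrightarrow> norm (Gamma z)"
    "Gamma_series (Re z) \<longlonglongrightarrow> Gamma (Re z)"
    by (intro tendsto_intros)+
  have "norm (Gamma_series z n) \<le> Gamma_series (Re z) n" if "n \<ge> 1" for n
  proof -
    have "pochhammer (Re z) (n + 1) \<le> norm (pochhammer z (n + 1))"
      unfolding pochhammer_prod prod_norm[symmetric] using assms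
      by (intro prod_mono conjI) (use complex_Re_le_cmod[of "z + of_nat _"] in auto)
    moreover have "pochhammer (Re z) (n + 1) > 0"
      using assms by (intro pochhammer_pos)
    ultimately show ?thesis
      unfolding Gamma_series_def norm_divide norm_mult using that
      by (intro divide_mono mult_mono) auto
  qed
  then show "\<exists>N. \<forall>n\<ge>N. norm (Gamma_series z n) \<le> Gamma_series (Re z) n" by blast
qed

text \<open>For \<open>Re s > -1\<close> this is \<open>\<Gamma>(N + 1 + s) / (N! N\<^sup>s)\<close>, in the form in which the derivatives produce it.\<close>

definition gamma_ratio :: "nat \<Rightarrow> complex \<Rightarrow> complex" where
  "gamma_ratio N s = Gamma (1 + s) * pochhammer (1 + s) N / fact N * exp (- s * of_real (ln (real N)))"

lemma not_nonpos_Int_of_Re_pos: "Re z > 0 \<Longrightarrow> z \<notin> \<int>\<^sub>\<le>\<^sub>0"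
  by (auto elim!: nonpos_Ints_cases)

lemma not_nonpos_Int_of_pos: "(x::real) > 0 \<Longrightarrow> x \<notin> \<int>\<^sub>\<le>\<^sub>0"
  by (auto elim!: nonpos_Ints_cases)

lemma gamma_ratio_Gamma:
  assumes "Re s > -1"
  shows "gamma_ratio N s = Gamma (of_nat N + 1 + s) / fact N * exp (- s * of_real (ln (real N)))"
proof -
  have "1 + s \<notin> \<int>\<^sub>\<le>\<^sub>0" using assms by (intro not_nonpos_Int_of_Re_pos) auto
  then show ?thesis
    by (simp add: gamma_ratio_def pochhammer_Gamma Gamma_eq_zero_iff add_ac)
qed

text \<open>Euler's limit formula for Gamma(1+s). \<open>Gamma_series (1 + s) N\<close> has one
  Pochhammer factor and one power of N more than the ratio, which accounts for the factor N / (1 + s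
  + N).\<close>

lemma tendsto_gamma_ratio:
  assumes "Re s > -1"
  shows "(\<lambda>N. gamma_ratio N s) \<longlonglongrightarrow> 1"
proof -
  have nz: "1 + s \<notin> \<int>\<^sub>\<le>\<^sub>0" using assms by (intro not_nonpos_Int_of_Re_pos) auto
  then have G: "Gamma (1 + s) \<noteq> 0" by (simp add: Gamma_eq_zero_iff)
  have "(\<lambda>N. of_nat N / (1 + s + of_nat N)) \<longlonglongrightarrow> (1::complex)"
  proof -
    have "(\<lambda>N. 1 / ((1 + s) / of_nat N + 1)) \<longlonglongrightarrow> (1::complex) / (0 + 1)"
      by (intro tendsto_intros tendsto_divide_0[OF tendsto_const] tendsto_of_nat) auto
    then have "(\<lambda>N. 1 / ((1 + s) / of_nat N + 1)) \<longlonglongrightarrow> (1::complex)" by simp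
    then show ?thesis
    proof (rule Lim_transform_eventually)
      show "\<forall>\<^sub>F N in sequentially. 1 / ((1 + s) / of_nat N + 1) = of_nat N / (1 + s + of_nat N)"
        using eventually_gt_at_top[of 0] by eventually_elim (auto simp: field_simps)
    qed
  qed
  then have "(\<lambda>N. Gamma (1 + s) / Gamma_series (1 + s) N * (of_nat N / (1 + s + of_nat N))) \<longlonglongrightarrow> Gamma (1 + s) / Gamma (1 + s) * 1"
    by (intro tendsto_intros G)
  then have "(\<lambda>N. Gamma (1 + s) / Gamma_series (1 + s) N * (of_nat N / (1 + s + of_nat N))) \<longlonglongrightarrow> 1"
    using G by simp
  then show ?thesis
  proof (rule Lim_transform_eventually)
    show "\<forall>\<^sub>F N in sequentially. Gamma (1 + s) / Gamma_series (1 + s) N * (of_nat N / (1 + s + of_nat N)) = gamma_ratio N s"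
      using eventually_gt_at_top[of 0]
    proof eventually_elim
      case (elim N)
      have "1 + s + of_nat N \<noteq> 0" using assms by (auto simp: complex_eq_iff)
      moreover define E P where "E = exp (s * of_real (ln (real N)))" and "P = pochhammer (1 + s) N"
      moreover have "exp ((1 + s) * of_real (ln (real N))) = of_nat N * E"
        using elim by (simp add: E_def ring_distribs exp_add exp_of_real)
      ultimately have g: "Gamma_series (1 + s) N = fact N * (of_nat N * E) / (P * (1 + s + of_nat N))"
        by (simp add: Gamma_series_def pochhammer_Suc)
      have r: "gamma_ratio N s = Gamma (1 + s) * P / fact N * inverse E"
        by (simp add: gamma_ratio_def exp_minus E_def P_def)
      have key: "g / (f * (n * E) / (P * d)) * (n / d) = g * P / f * inverse E"
        if "n \<noteq> 0" "E \<noteq> 0" "f \<noteq> 0" "d \<noteq> 0" for g f n E P d :: complex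
        using that by (simp add: field_simps)
      show ?case unfolding g r
        by (rule key) (use elim \<open>1 + s + of_nat N \<noteq> 0\<close> in \<open>auto simp: E_def\<close>)
    qed
  qed
qed

lemma gamma_ratio_Suc:
  assumes "N \<ge> 1"
  shows "gamma_ratio (Suc N) s = gamma_ratio N s *
    ((1 + s * of_real (1 / real (Suc N))) * exp (- s * of_real (ln (1 + 1 / real N))))"
proof -
  have "ln (real (Suc N)) = ln (real N) + ln (1 + 1 / real N)"
  proof -
    have "real (Suc N) = real N * (1 + 1 / real N)" using assms by (simp add: field_simps)
    moreover have "ln (real N * (1 + 1 / real N)) = ln (real N) + ln (1 + 1 / real N)"
      using assms by (intro ln_mult_pos) (auto simp: add_pos_nonneg)
    ultimately show ?thesis by simp
  qed
  then have "exp (- s * of_real (ln (real (Suc N)))) =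
     exp (- s * of_real (ln (real N))) * exp (- s * of_real (ln (1 + 1 / real N)))"
    by (simp add: exp_add[symmetric] algebra_simps)
  moreover have "(1 + s + of_nat N) / of_nat (Suc N) = 1 + s * of_real (1 / real (Suc N))"
    by (simp add: field_simps del: of_nat_Suc) simp
  then have "pochhammer (1 + s) (Suc N) / fact (Suc N) =
      pochhammer (1 + s) N / fact N * (1 + s * of_real (1 / real (Suc N)))"
    by (metis (no_types, lifting) fact_Suc mult.commute of_nat_mult pochhammer_Suc times_divide_times_eq)
  ultimately show ?thesis
    unfolding gamma_ratio_def times_divide_eq_right[symmetric] by (simp only: mult.assoc mult.commute mult.left_commute)
qed

text \<open>The first-order terms of the two factors of \<open>\<rho>\<close> cancel. At second
  order there remains -s(s+1)/2 times 1/(N(N+1)) = 1/N - 1/(N+1), and these increments telescope to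
  the term s(s+1)/(2N) of the final expansion. The fourth power of 1 + |s| comes from multiplying 1
  + s/(N+1) by the cubic Taylor remainder.\<close>

lemma gamma_ratio_step_expansion:
  fixes s :: complex
  assumes "Re s > -1" "N \<ge> 1"
  defines "\<rho> \<equiv> (1 + s * of_real (1 / real (Suc N))) * exp (- s * of_real (ln (1 + 1 / real N)))"
  shows "norm (\<rho> - 1 + s * (s + 1) / 2 * of_real (1 / (real N * real (Suc N)))) \<le> (1 + norm s) ^ 4 / real N ^ 3"
    and "norm (\<rho> - 1) \<le> 2 * (1 + norm s) ^ 4 / real N ^ 2"
proof -
  define x where "x = 1 / real N"
  define x' where "x' = 1 / real (Suc N)"
  define l where "l = ln (1 + x)"
  have x: "0 < x" "x \<le> 1" using assms by (auto simp: x_def)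
  have x': "x' = x / (1 + x)" using assms by (simp add: x_def x'_def field_simps)
  have x'b: "0 < x'" "x' \<le> x" using x by (auto simp: x' field_simps)
  have xx': "x - x' = x * x'" using x by (simp add: x' field_simps)
  have lx: "0 \<le> l" "l \<le> x" using x ln_add_one_self_le_self[of x] by (auto simp: l_def)
  have lx': "x' \<le> l"
    using ln_le_minus_one[of "1 / (1 + x)"] x unfolding l_def x' by (simp add: ln_div field_simps)
  define R where "R = exp (- s * of_real l) - (1 + (- s * of_real l) + (- s * of_real l)\<^sup>2 / 2)"
  have "Re (- s * of_real l) \<le> ln 2"
  proof -
    have "Re (- s * of_real l) \<le> 1 * l" using assms(1) lx by (simp add: mult_right_mono) (smt (verit) mult_le_cancel_right1 mult_minus_left)
    also have "\<dots> \<le> ln 2" using x by (simp add: l_def)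
    finally show ?thesis .
  qed
  then have "norm R \<le> norm (- s * of_real l) ^ 3"
    unfolding R_def by (rule norm_exp_minus_Taylor2_le)
  also have "\<dots> \<le> norm s ^ 3 * x ^ 3"
    using lx by (simp add: norm_mult power_mult_distrib mult_left_mono power_mono)
  finally have R: "norm R \<le> norm s ^ 3 * x ^ 3" .
  define t where "t = norm s"
  have t: "t \<ge> 0" by (simp add: t_def)
  \<comment> \<open>An exact identity, since \<open>R\<close> is the Taylor remainder. It is
    arranged by powers of \<open>s\<close> so that each coefficient is of third order in
    \<open>x\<close> by itself; for s^2 this is seen by completing the square in l - x'.\<close>
  have e: "\<rho> - 1 + s * (s + 1) / 2 * of_real (x * x') =
     of_real (x' - l + x * x' / 2) * s + of_real ((l - x')\<^sup>2 / 2 + x' * (x - x') / 2) * s\<^sup>2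
       + of_real (x' * l\<^sup>2 / 2) * s ^ 3 + (1 + s * of_real x') * R"
    unfolding \<rho>_def R_def x_def[symmetric] x'_def[symmetric] l_def[symmetric]
    by (simp add: field_simps power2_eq_square power3_eq_cube)
  have x3: "x ^ 3 \<ge> 0" using x by simp
  have c1: "\<bar>x' - l + x * x' / 2\<bar> \<le> x ^ 3"
  proof -
    have "x' - l + x * x' / 2 = - (ln (1 + x) - x / (1 + x) - x\<^sup>2 / (2 * (1 + x)))"
      by (simp add: x' l_def power2_eq_square)
    then have "\<bar>x' - l + x * x' / 2\<bar> = \<bar>ln (1 + x) - x / (1 + x) - x\<^sup>2 / (2 * (1 + x))\<bar>"
      by (simp only: abs_minus_cancel)
    then show ?thesis using ln_one_plus_expansion[of x] x x3 by linarith
  qed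
  have c2: "\<bar>(l - x')\<^sup>2 / 2 + x' * (x - x') / 2\<bar> \<le> x ^ 3"
  proof -
    have d: "l - x' \<le> x * x" using lx x'b xx' mult_left_mono[of x' x x] x by linarith
    have "(l - x')\<^sup>2 \<le> (x * x)\<^sup>2" using d lx' by (intro power_mono) auto
    also have "\<dots> = x ^ 3 * x" by (simp add: eval_nat_numeral)
    also have "\<dots> \<le> x ^ 3" using x by (simp add: mult_left_le)
    finally have 1: "(l - x')\<^sup>2 \<le> x ^ 3" .
    have "x' * (x - x') = x * (x' * x')" by (simp add: xx')
    also have "\<dots> \<le> x * (x * x)" using x x'b by (intro mult_left_mono mult_mono) auto
    finally have 2: "x' * (x - x') \<le> x ^ 3" by (simp add: power3_eq_cube)
    have 3: "x' * (x - x') \<ge> 0" using x'b by simp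
    show ?thesis using 1 2 3 zero_le_power2[of "l - x'"] by (simp only: abs_le_iff) linarith
  qed
  have c3: "\<bar>x' * l\<^sup>2 / 2\<bar> \<le> x ^ 3"
  proof -
    have "x' * l\<^sup>2 \<le> x * x\<^sup>2" using x x'b lx by (intro mult_mono power_mono) auto
    also have "\<dots> = x ^ 3" by (simp add: eval_nat_numeral)
    finally have "x' * l\<^sup>2 \<le> x ^ 3" .
    moreover have "0 \<le> x' * l\<^sup>2" using x'b by simp
    ultimately show ?thesis using x3 by linarith
  qed
  have c4: "norm (1 + s * of_real x') \<le> 1 + t"
  proof -
    have "norm (1 + s * of_real x') \<le> 1 + t * x'"
      using norm_triangle_ineq[of 1 "s * of_real x'"] x'b by (simp add: norm_mult t_def)
    also have "t * x' \<le> t" using x'b x t by (simp add: mult_left_le)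
    finally show ?thesis by simp
  qed
  have "norm (\<rho> - 1 + s * (s + 1) / 2 * of_real (x * x')) \<le>
     x ^ 3 * t + x ^ 3 * t ^ 2 + x ^ 3 * t ^ 3 + (1 + t) * (t ^ 3 * x ^ 3)"
    unfolding e
  proof (intro norm_triangle_le add_mono)
    show "norm (of_real (x' - l + x * x' / 2) * s) \<le> x ^ 3 * t"
      unfolding norm_mult norm_of_real t_def[symmetric] by (rule mult_right_mono[OF c1 t])
    show "norm (of_real ((l - x')\<^sup>2 / 2 + x' * (x - x') / 2) * s\<^sup>2) \<le> x ^ 3 * t ^ 2"
      unfolding norm_mult norm_of_real norm_power t_def[symmetric] using t by (intro mult_right_mono[OF c2]) simp
    show "norm (of_real (x' * l\<^sup>2 / 2) * s ^ 3) \<le> x ^ 3 * t ^ 3"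
      unfolding norm_mult norm_of_real norm_power t_def[symmetric] using t by (intro mult_right_mono[OF c3]) simp
    show "norm ((1 + s * of_real x') * R) \<le> (1 + t) * (t ^ 3 * x ^ 3)"
      unfolding norm_mult using c4 R t x3 by (intro mult_mono) (auto simp: t_def)
  qed
  also have "\<dots> \<le> (1 + t) ^ 4 * x ^ 3"
  proof -
    have "(1 + t) ^ 4 * x ^ 3 - (x ^ 3 * t + x ^ 3 * t ^ 2 + x ^ 3 * t ^ 3 + (1 + t) * (t ^ 3 * x ^ 3)) =
      x ^ 3 * (1 + 3 * t + 5 * t ^ 2 + 2 * t ^ 3)" by (simp add: algebra_simps eval_nat_numeral)
    also have "\<dots> \<ge> 0" using x3 t by (intro mult_nonneg_nonneg add_nonneg_nonneg) auto
    finally show ?thesis by linarith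
  qed
  finally have main: "norm (\<rho> - 1 + s * (s + 1) / 2 * of_real (x * x')) \<le> (1 + t) ^ 4 * x ^ 3" .
  then show "norm (\<rho> - 1 + s * (s + 1) / 2 * of_real (1 / (real N * real (Suc N)))) \<le> (1 + norm s) ^ 4 / real N ^ 3"
    by (simp add: x_def x'_def t_def power_divide)
  have "norm (\<rho> - 1) \<le> norm (\<rho> - 1 + s * (s + 1) / 2 * of_real (x * x')) + norm (s * (s + 1) / 2 * of_real (x * x'))"
    using norm_triangle_ineq4[of "\<rho> - 1 + s * (s + 1) / 2 * of_real (x * x')" "s * (s + 1) / 2 * of_real (x * x')"] by simp
  also have "\<dots> \<le> (1 + t) ^ 4 * x ^ 2 + (1 + t) ^ 4 * x ^ 2"
  proof (rule add_mono)
    have "x ^ 3 \<le> x ^ 2" using x by (intro power_decreasing) auto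
    then show "norm (\<rho> - 1 + s * (s + 1) / 2 * of_real (x * x')) \<le> (1 + t) ^ 4 * x ^ 2"
      using main t by (meson mult_left_mono order_trans zero_le_power add_nonneg_nonneg zero_le_one)
    have "norm (s * (s + 1) / 2 * of_real (x * x')) = t * norm (s + 1) / 2 * (x * x')"
      using x x'b by (simp add: norm_mult norm_divide t_def)
    also have "\<dots> \<le> (1 + t) * (1 + t) / 1 * (x * x)"
      using x x'b t norm_triangle_ineq[of s 1] unfolding t_def
      by (intro mult_mono frac_le) auto
    also have "\<dots> \<le> (1 + t) ^ 4 * x\<^sup>2"
      using power_increasing[of 2 4 "1 + t"] t x by (simp add: power2_eq_square mult_right_mono)
    finally show "norm (s * (s + 1) / 2 * of_real (x * x')) \<le> (1 + t) ^ 4 * x ^ 2" .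
  qed
  finally show "norm (\<rho> - 1) \<le> 2 * (1 + norm s) ^ 4 / real N ^ 2"
    by (simp add: x_def t_def power_divide)
qed

text \<open>Passing to real parts leaves the real ratio \<open>r\<close>. For
  \<open>\<sigma> \<ge> 0\<close> it decreases in N, starting from r 1 = Gamma(2 + \<sigma>). For -1
  < \<sigma> < 0 the point N + 1 + \<sigma> lies between N and N + 1, and log-convexity of Gamma
  gives r N <= 1. The sum of the two bounds covers both cases.\<close>

lemma norm_gamma_ratio_le:
  assumes "Re s > -1" "N \<ge> 1"
  shows "norm (gamma_ratio N s) \<le> 1 + Gamma (2 + Re s)"
proof -
  define \<sigma> where "\<sigma> = Re s"
  define r where "r = (\<lambda>N. Gamma (real N + 1 + \<sigma>) / fact N * exp (- \<sigma> * ln (real N)))"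
  have sig: "\<sigma> > -1" using assms by (simp add: \<sigma>_def)
  have G2: "Gamma (2 + \<sigma>) > 0" using sig by simp
  have "norm (gamma_ratio N s) = norm (Gamma (of_nat N + 1 + s)) / fact N * exp (- \<sigma> * ln (real N))"
    using assms by (simp add: gamma_ratio_Gamma norm_mult norm_divide \<sigma>_def)
  also have "\<dots> \<le> r N"
    unfolding r_def using norm_Gamma_le_Gamma_Re[of "of_nat N + 1 + s"] sig
    by (intro mult_right_mono divide_right_mono) (auto simp: \<sigma>_def)
  also have "r N \<le> 1 + Gamma (2 + \<sigma>)"
  proof (cases "\<sigma> \<ge> 0")
    case True
    have "r N \<le> Gamma (2 + \<sigma>)"
      using assms(2)
    proof (induction N rule: dec_induct)
      case base
      show ?case by (simp add: r_def)
    next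
      case (step n)
      have n: "n > 0" using step.hyps by simp
      have pos: "real n + 1 + \<sigma> > 0" using True by simp
      have G: "Gamma (real (Suc n) + 1 + \<sigma>) = (real n + 1 + \<sigma>) * Gamma (real n + 1 + \<sigma>)"
        using Gamma_plus1[OF not_nonpos_Int_of_pos[OF pos]] by (simp add: add_ac)
      have "1 + \<sigma> / real (Suc n) \<le> exp (\<sigma> / real (Suc n))" by (rule exp_ge_add_one_self)
      also have "\<dots> \<le> exp (\<sigma> * (ln (real (Suc n)) - ln (real n)))"
      proof -
        have "ln (real n / real (Suc n)) \<le> real n / real (Suc n) - 1"
          using n by (intro ln_le_minus_one) auto
        then have "1 / real (Suc n) \<le> ln (real (Suc n)) - ln (real n)"
          using n by (simp add: ln_div field_simps)
        from mult_left_mono[OF this True] show ?thesis by simp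
      qed
      finally have A: "(1 + \<sigma> / real (Suc n)) * exp (- \<sigma> * ln (real (Suc n))) \<le> exp (- \<sigma> * ln (real n))"
      proof -
        assume "1 + \<sigma> / real (Suc n) \<le> exp (\<sigma> * (ln (real (Suc n)) - ln (real n)))"
        from mult_right_mono[OF this, of "exp (- \<sigma> * ln (real (Suc n)))"] show ?thesis
          by (simp only: mult.assoc mult_exp_exp right_diff_distrib mult_minus_left diff_add_cancel) simp
      qed
      have "r (Suc n) = (Gamma (real n + 1 + \<sigma>) / fact n) * ((1 + \<sigma> / real (Suc n)) * exp (- \<sigma> * ln (real (Suc n))))"
        unfolding r_def G fact_Suc by (simp add: divide_simps)
      also have "\<dots> \<le> r n"
        unfolding r_def using A pos by (intro mult_left_mono) auto
      finally show ?case using step.IH by simp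
    qed
    then show ?thesis by simp
  next
    case False
    have N: "real N > 0" using assms by simp
    have "(ln \<circ> Gamma) ((1 - (1 + \<sigma>)) *\<^sub>R real N + (1 + \<sigma>) *\<^sub>R (real N + 1)) \<le>
        (1 - (1 + \<sigma>)) * (ln \<circ> Gamma) (real N) + (1 + \<sigma>) * (ln \<circ> Gamma) (real N + 1)"
      by (rule convex_onD[OF log_convex_Gamma_real]) (use False sig N in auto)
    moreover have "(1 - (1 + \<sigma>)) *\<^sub>R real N + (1 + \<sigma>) *\<^sub>R (real N + 1) = real N + 1 + \<sigma>"
      by (simp add: algebra_simps)
    moreover have "Gamma (real N + 1) = real N * Gamma (real N)"
      by (intro Gamma_plus1 not_nonpos_Int_of_pos N)
    moreover have "ln (real N * Gamma (real N)) = ln (real N) + ln (Gamma (real N))"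
      by (intro ln_mult_pos Gamma_real_pos N)
    ultimately have "ln (Gamma (real N + 1 + \<sigma>)) \<le> ln (Gamma (real N + 1)) + \<sigma> * ln (real N)"
      by (simp add: algebra_simps)
    then have "Gamma (real N + 1 + \<sigma>) \<le> exp (ln (Gamma (real N + 1)) + \<sigma> * ln (real N))"
      using N sig by (subst ln_le_cancel_iff[symmetric]) auto
    also have "\<dots> = fact N * exp (\<sigma> * ln (real N))"
      using N Gamma_fact[of N, where 'a = real] by (simp add: exp_add add_ac)
    finally have "r N \<le> 1" by (simp add: r_def exp_minus field_simps)
    then show ?thesis using G2 by linarith
  qed
  finally show ?thesis by (simp add: \<sigma>_def)
qed

text \<open>Increments are summed from infinity back to N, since the limit 1 is the value known in
  advance. This is done twice: the first round gives only R - 1 = O(1/m), and that bound enters the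
  increments of the second round through the product (\<rho> - 1)(R - 1). The constant is 18 = 2 (2
  * 4 + 1), where the outer factor 2 is lost in comparing 1/k^3 with the telescoping 1/k^2 -
  1/(k+1)^2.\<close>

proposition gamma_ratio_expansion:
  assumes "Re s > -1" "N \<ge> 1"
  shows "norm (gamma_ratio N s - 1 - s * (s + 1) / (2 * of_nat N)) \<le>
    18 * (1 + Gamma (2 + Re s)) * (1 + norm s) ^ 8 / real N ^ 2"
proof -
  define A where "A = 1 + Gamma (2 + Re s)"
  define t where "t = 1 + norm s"
  define R where "R = (\<lambda>N. gamma_ratio N s)"
  define \<rho> where "\<rho> = (\<lambda>N. (1 + s * of_real (1 / real (Suc N))) * exp (- s * of_real (ln (1 + 1 / real N))))"
  have A: "A \<ge> 1" using assms unfolding A_def by (simp add: Gamma_real_nonneg)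
  have t: "t \<ge> 1" by (simp add: t_def)
  have RS: "R (Suc m) = R m * \<rho> m" if "m \<ge> 1" for m
    using gamma_ratio_Suc[OF that] by (simp add: R_def \<rho>_def)
  have \<rho>1: "norm (\<rho> m - 1 + s * (s + 1) / 2 * of_real (1 / (real m * real (Suc m)))) \<le> t ^ 4 / real m ^ 3"
    and \<rho>2: "norm (\<rho> m - 1) \<le> 2 * t ^ 4 / real m ^ 2" if "m \<ge> 1" for m
    using gamma_ratio_step_expansion[OF assms(1) that] by (simp_all add: \<rho>_def t_def)
  have Rb: "norm (R m) \<le> A" if "m \<ge> 1" for m
    using norm_gamma_ratio_le[OF assms(1) that] by (simp add: R_def A_def)
  have R1: "norm (R m - 1) \<le> 4 * A * t ^ 4 / real m" if m: "m \<ge> 1" for m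
  proof (rule norm_le_of_telescoping[where e = "\<lambda>m. R m - 1" and g = "\<lambda>m. 4 * A * t ^ 4 / real m"])
    have "(\<lambda>m. R m - 1) \<longlonglongrightarrow> 1 - 1"
      unfolding R_def by (intro tendsto_intros tendsto_gamma_ratio assms)
    then show "(\<lambda>m. R m - 1) \<longlonglongrightarrow> 0" by simp
    show "(\<lambda>m. 4 * A * t ^ 4 / real m) \<longlonglongrightarrow> 0"
      by (rule lim_const_over_n)
    fix k assume "k \<ge> m"
    then have k: "k \<ge> 1" "real k \<ge> 1" using m by auto
    have "norm (R k - 1 - (R (Suc k) - 1)) = norm (R k) * norm (\<rho> k - 1)"
      unfolding RS[OF k(1)] norm_mult[symmetric] by (subst norm_minus_commute) (simp add: algebra_simps)
    also have "\<dots> \<le> A * (2 * t ^ 4 / real k ^ 2)"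
      using Rb[OF k(1)] \<rho>2[OF k(1)] A by (intro mult_mono) auto
    also have "\<dots> = 2 * A * t ^ 4 * (1 / real k ^ 2)" by simp
    also have "\<dots> \<le> 2 * A * t ^ 4 * (2 * (1 / real k - 1 / real (Suc k)))"
    proof (rule mult_left_mono)
      have "1 / real k - 1 / real (Suc k) = 1 / (real k * real (Suc k))"
        using k by (simp add: field_simps)
      moreover have "real k * real (Suc k) \<le> 2 * real k ^ 2"
        using k mult_left_mono[of "real (Suc k)" "2 * real k" "real k"] by (simp add: power2_eq_square)
      ultimately show "1 / real k ^ 2 \<le> 2 * (1 / real k - 1 / real (Suc k))"
        using k divide_left_mono[of "real k * real (Suc k)" "2 * real k ^ 2" 2] by simp
    qed (use A t in simp)
    finally show "norm (R k - 1 - (R (Suc k) - 1)) \<le> 4 * A * t ^ 4 / real k - 4 * A * t ^ 4 / real (Suc k)"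
      by (simp add: field_simps)
  qed
  define e where "e = (\<lambda>m. R m - 1 - s * (s + 1) / (2 * of_nat m))"
  have "norm (e N) \<le> 18 * A * t ^ 8 / real N ^ 2"
  proof (rule norm_le_of_telescoping[where e = e and g = "\<lambda>m. 18 * A * t ^ 8 / real m ^ 2"])
    have "(\<lambda>m. R m - 1 - (s * (s + 1) / 2) / of_nat m) \<longlonglongrightarrow> 1 - 1 - 0"
      unfolding R_def by (intro tendsto_intros tendsto_gamma_ratio assms lim_const_over_n)
    then show "e \<longlonglongrightarrow> 0" by (simp add: e_def)
    show "(\<lambda>m. 18 * A * t ^ 8 / real m ^ 2) \<longlonglongrightarrow> 0"
      by (rule real_tendsto_divide_at_top[OF tendsto_const])
         (intro filterlim_pow_at_top filterlim_real_sequentially; simp)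
    fix k assume "k \<ge> N"
    then have k: "k \<ge> 1" "real k \<ge> 1" using assms by auto
    have "e k - e (Suc k) = - ((\<rho> k - 1) * (R k - 1)) - (\<rho> k - 1 + s * (s + 1) / 2 * of_real (1 / (real k * real (Suc k))))"
    proof -
      have "s * (s + 1) / (2 * of_nat k) - s * (s + 1) / (2 * of_nat (Suc k)) = s * (s + 1) / 2 * (1 / of_nat k - 1 / of_nat (Suc k))"
        by (simp add: right_diff_distrib)
      also have "1 / of_nat k - 1 / of_nat (Suc k) = (of_real (1 / (real k * real (Suc k))) :: complex)"
        using k by (simp add: divide_simps del: of_nat_Suc) simp
      finally show ?thesis unfolding e_def RS[OF k(1)] by (simp add: algebra_simps)
    qed
    also have "norm \<dots> \<le> norm ((\<rho> k - 1) * (R k - 1)) + norm (\<rho> k - 1 + s * (s + 1) / 2 * of_real (1 / (real k * real (Suc k))))"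
      using norm_triangle_ineq4[of "- ((\<rho> k - 1) * (R k - 1))"] by (simp only: norm_minus_cancel)
    also have "\<dots> \<le> (2 * t ^ 4 / real k ^ 2) * (4 * A * t ^ 4 / real k) + t ^ 4 / real k ^ 3"
      unfolding norm_mult using \<rho>1[OF k(1)] \<rho>2[OF k(1)] R1[OF k(1)] t A
      by (intro add_mono mult_mono) auto
    also have "\<dots> = (8 * A * t ^ 8 + t ^ 4) / real k ^ 3"
      using k by (simp add: field_simps eval_nat_numeral)
    also have "\<dots> \<le> 9 * A * t ^ 8 / real k ^ 3"
    proof -
      have "t ^ 4 \<le> t ^ 8" using t by (intro power_increasing) auto
      also have "\<dots> \<le> A * t ^ 8" using A t by simp
      finally show ?thesis using k by (intro divide_right_mono) auto
    qed
    also have "\<dots> = 9 * A * t ^ 8 * (1 / real k ^ 3)" by simp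
    also have "1 / real k ^ 3 \<le> 2 * (1 / real k ^ 2 - 1 / real (Suc k) ^ 2)"
    proof -
      have "1 / real k ^ 2 - 1 / real (Suc k) ^ 2 = (2 * real k + 1) / (real k ^ 2 * real (Suc k) ^ 2)"
        using k by (simp add: divide_simps) (simp add: power2_eq_square algebra_simps)
      moreover have "(real k + 1)\<^sup>2 \<le> 4 * real k ^ 2 + 2 * real k"
        using mult_mono[of 1 "real k" 1 "real k"] k by (simp add: power2_eq_square algebra_simps)
      then have "real k ^ 2 * real (Suc k) ^ 2 \<le> 2 * (2 * real k + 1) * real k ^ 3"
        using mult_left_mono[of "(real k + 1)\<^sup>2" "4 * real k ^ 2 + 2 * real k" "real k ^ 2"]
        by (simp add: eval_nat_numeral algebra_simps)
      ultimately show ?thesis using k by (simp add: divide_simps)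
    qed
    also have "9 * A * t ^ 8 * (2 * (1 / real k ^ 2 - 1 / real (Suc k) ^ 2)) = 18 * A * t ^ 8 / real k ^ 2 - 18 * A * t ^ 8 / real (Suc k) ^ 2"
      by (simp add: algebra_simps)
    finally show "norm (e k - e (Suc k)) \<le> 18 * A * t ^ 8 / real k ^ 2 - 18 * A * t ^ 8 / real (Suc k) ^ 2"
      using A t by (simp add: mult_left_mono)
  qed
  then show ?thesis by (simp add: e_def R_def A_def t_def)
qed

text \<open>Both bounds hold for every j, also for j >= N, where the product contains the factor 1 -
  N/N = 0; so the sum over degrees below N can be treated as a full series in j. As for the Gamma
  ratio, a first-order bound (\<open>b1\<close>) feeds the second-order one.\<close>

lemma falling_product_expansion:
  assumes "N \<ge> 1"
  defines "b \<equiv> \<lambda>j::nat. \<Prod>k=1..j. (1 - real k / real N)"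
  shows "\<bar>b j\<bar> \<le> 1" and "\<bar>b j - 1 + real (j * (j + 1)) / (2 * real N)\<bar> \<le> (1 + real j) ^ 4 / real N ^ 2"
proof -
  have N: "real N \<ge> 1" using assms by simp
  have b_zero: "b j = 0" if "j \<ge> N" for j
    unfolding b_def using that assms by (auto intro!: prod_zero bexI[of _ N])
  have b01: "0 \<le> b j \<and> b j \<le> 1" for j
  proof (cases "j \<ge> N")
    case False
    then show ?thesis unfolding b_def using N
      by (intro conjI prod_nonneg prod_le_1) (auto simp: field_simps)
  qed (simp add: b_zero)
  show "\<bar>b j\<bar> \<le> 1" using b01[of j] by simp
  have bS: "b (Suc j) = b j * (1 - real (Suc j) / real N)" for j
    unfolding b_def by simp
  have b1: "\<bar>b j - 1\<bar> \<le> (1 + real j)\<^sup>2 / real N" for j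
  proof (induction j)
    case 0
    show ?case by (simp add: b_def)
  next
    case (Suc j)
    have "b (Suc j) - 1 = (b j - 1) - b j * (real (Suc j) / real N)"
      unfolding bS by (simp add: algebra_simps)
    then have "\<bar>b (Suc j) - 1\<bar> \<le> \<bar>b j - 1\<bar> + \<bar>b j * (real (Suc j) / real N)\<bar>"
      by (simp only: abs_triangle_ineq4)
    also have "\<dots> \<le> (1 + real j)\<^sup>2 / real N + 1 * (real (Suc j) / real N)"
      unfolding abs_mult using Suc b01[of j] by (intro add_mono mult_mono) auto
    also have "\<dots> = ((1 + real j)\<^sup>2 + real (Suc j)) / real N" by (simp add: add_divide_distrib)
    also have "\<dots> \<le> (1 + real (Suc j))\<^sup>2 / real N"
      using N by (intro divide_right_mono) (auto simp: power2_eq_square algebra_simps)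
    finally show ?case .
  qed
  show "\<bar>b j - 1 + real (j * (j + 1)) / (2 * real N)\<bar> \<le> (1 + real j) ^ 4 / real N ^ 2"
  proof (induction j)
    case 0
    show ?case by (simp add: b_def)
  next
    case (Suc j)
    define t where "t = real j"
    have t: "t \<ge> 0" by (simp add: t_def)
    have "b (Suc j) - 1 + real (Suc j * (Suc j + 1)) / (2 * real N) =
       (b j - 1 + real (j * (j + 1)) / (2 * real N)) - (real (Suc j) / real N) * (b j - 1)"
      unfolding bS using N by (simp add: field_simps)
    also have "\<bar>\<dots>\<bar> \<le> \<bar>b j - 1 + real (j * (j + 1)) / (2 * real N)\<bar> + (real (Suc j) / real N) * \<bar>b j - 1\<bar>"
      by (rule order_trans[OF abs_triangle_ineq4]) (simp add: abs_mult)
    also have "\<dots> \<le> (1 + real j) ^ 4 / real N ^ 2 + (real (Suc j) / real N) * ((1 + real j)\<^sup>2 / real N)"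
      using b1[of j] Suc by (intro add_mono mult_left_mono) auto
    also have "\<dots> = ((1 + t) ^ 4 + (1 + t) ^ 3) / real N ^ 2"
    proof -
      have "real (Suc j) = 1 + t" by (simp add: t_def)
      moreover have "((1 + t) / real N) * ((1 + t)\<^sup>2 / real N) = (1 + t) ^ 3 / real N ^ 2"
        by (simp add: power2_eq_square power3_eq_cube)
      ultimately show ?thesis unfolding t_def[symmetric] by (simp only: add_divide_distrib)
    qed
    also have "\<dots> \<le> (1 + real (Suc j)) ^ 4 / real N ^ 2"
    proof (rule divide_right_mono)
      have "(2 + t) ^ 4 - ((1 + t) ^ 4 + (1 + t) ^ 3) = 14 + 25 * t + 15 * t ^ 2 + 3 * t ^ 3"
        by (simp add: algebra_simps eval_nat_numeral)
      also have "\<dots> \<ge> 0" using t by simp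
      finally show "(1 + t) ^ 4 + (1 + t) ^ 3 \<le> (1 + real (Suc j)) ^ 4" by (simp add: t_def add_ac)
    qed simp
    finally show ?case .
  qed
qed

section \<open>Generalised power series\<close>

lemma norm_integral_le_integral:
  fixes f :: "'a \<Rightarrow> 'b::{banach, second_countable_topology}"
  assumes "integrable M f" "integrable M g" "\<And>x. x \<in> space M \<Longrightarrow> norm (f x) \<le> g x"
  shows "norm (\<integral>x. f x \<partial>M) \<le> (\<integral>x. g x \<partial>M)"
  by (rule order_trans[OF integral_norm_bound integral_mono]) (use assms in auto)

definition gpow :: "'b measure \<Rightarrow> ('b \<Rightarrow> complex) \<Rightarrow> ('b \<Rightarrow> complex) \<Rightarrow> real \<Rightarrow> complex" where
  "gpow \<mu> s \<kappa> x = (\<integral>\<omega>. \<kappa> \<omega> * exp (s \<omega> * of_real (ln x)) \<partial>\<mu>)"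

text \<open>All polynomial moments are required so that the class is stable under Euler operators.
  Having them at every \<open>r\<close> supplies, at the point l = ln x, the majorants taken at l +
  1 and l - 1 with which one differentiates under the integral.\<close>

definition gpow_ok :: "'b measure \<Rightarrow> ('b \<Rightarrow> complex) \<Rightarrow> ('b \<Rightarrow> complex) \<Rightarrow> bool" where
  "gpow_ok \<mu> s \<kappa> \<longleftrightarrow> s \<in> borel_measurable \<mu> \<and> \<kappa> \<in> borel_measurable \<mu> \<and>
     (\<forall>n r. integrable \<mu> (\<lambda>\<omega>. (1 + norm (s \<omega>)) ^ n * exp (Re (s \<omega>) * r) * norm (\<kappa> \<omega>)))"

lemma gpow_ok_measurable:
  assumes "gpow_ok \<mu> s \<kappa>"
  shows "s \<in> borel_measurable \<mu>" "\<kappa> \<in> borel_measurable \<mu>"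
  using assms by (auto simp: gpow_ok_def)

lemma gpow_ok_integrable:
  assumes "gpow_ok \<mu> s \<kappa>"
  shows "integrable \<mu> (\<lambda>\<omega>. \<kappa> \<omega> * exp (s \<omega> * of_real r))"
proof (rule Bochner_Integration.integrable_bound)
  note [measurable] = gpow_ok_measurable[OF assms]
  show "integrable \<mu> (\<lambda>\<omega>. (1 + norm (s \<omega>)) ^ 0 * exp (Re (s \<omega>) * r) * norm (\<kappa> \<omega>))"
    using assms unfolding gpow_ok_def by blast
  show "(\<lambda>\<omega>. \<kappa> \<omega> * exp (s \<omega> * of_real r)) \<in> borel_measurable \<mu>" by measurable
qed (simp add: norm_mult mult.commute)

lemma gpow_ok_mult:
  assumes ok: "gpow_ok \<mu> s \<kappa>" and p: "p \<in> borel_measurable \<mu>"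
    and bound: "\<And>\<omega>. norm (p \<omega>) \<le> C * (1 + norm (s \<omega>)) ^ m"
  shows "gpow_ok \<mu> s (\<lambda>\<omega>. \<kappa> \<omega> * p \<omega>)"
  unfolding gpow_ok_def
proof (intro conjI allI)
  note [measurable] = gpow_ok_measurable[OF ok] p
  show "s \<in> borel_measurable \<mu>" by measurable
  show "(\<lambda>\<omega>. \<kappa> \<omega> * p \<omega>) \<in> borel_measurable \<mu>" by measurable
  fix n :: nat and r :: real
  show "integrable \<mu> (\<lambda>\<omega>. (1 + norm (s \<omega>)) ^ n * exp (Re (s \<omega>) * r) * norm (\<kappa> \<omega> * p \<omega>))"
  proof (rule Bochner_Integration.integrable_bound)
    show "integrable \<mu> (\<lambda>\<omega>. C * ((1 + norm (s \<omega>)) ^ (n + m) * exp (Re (s \<omega>) * r) * norm (\<kappa> \<omega>)))"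
      using ok unfolding gpow_ok_def by (intro integrable_mult_right) blast
    show "AE \<omega> in \<mu>. norm ((1 + norm (s \<omega>)) ^ n * exp (Re (s \<omega>) * r) * norm (\<kappa> \<omega> * p \<omega>))
      \<le> norm (C * ((1 + norm (s \<omega>)) ^ (n + m) * exp (Re (s \<omega>) * r) * norm (\<kappa> \<omega>)))"
    proof (rule AE_I2)
      fix \<omega>
      have "norm ((1 + norm (s \<omega>)) ^ n * exp (Re (s \<omega>) * r) * norm (\<kappa> \<omega> * p \<omega>)) =
        ((1 + norm (s \<omega>)) ^ n * exp (Re (s \<omega>) * r) * norm (\<kappa> \<omega>)) * norm (p \<omega>)"
        by (simp add: norm_mult)
      also have "\<dots> \<le> ((1 + norm (s \<omega>)) ^ n * exp (Re (s \<omega>) * r) * norm (\<kappa> \<omega>)) * (C * (1 + norm (s \<omega>)) ^ m)"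
        by (intro mult_left_mono bound) auto
      also have "\<dots> = C * ((1 + norm (s \<omega>)) ^ (n + m) * exp (Re (s \<omega>) * r) * norm (\<kappa> \<omega>))"
        by (simp add: power_add)
      also have "\<dots> \<le> norm \<dots>" by simp
      finally show "norm ((1 + norm (s \<omega>)) ^ n * exp (Re (s \<omega>) * r) * norm (\<kappa> \<omega> * p \<omega>))
        \<le> norm (C * ((1 + norm (s \<omega>)) ^ (n + m) * exp (Re (s \<omega>) * r) * norm (\<kappa> \<omega>)))" .
    qed
  qed measurable
qed

lemma gpow_ok_mult_exponent:
  "gpow_ok \<mu> s \<kappa> \<Longrightarrow> gpow_ok \<mu> s (\<lambda>\<omega>. \<kappa> \<omega> * s \<omega>)"
  by (rule gpow_ok_mult[where C = 1 and m = 1]) (auto dest: gpow_ok_measurable)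

lemma gpow_ok_mult_exponent_add:
  assumes "gpow_ok \<mu> s \<kappa>"
  shows "gpow_ok \<mu> s (\<lambda>\<omega>. \<kappa> \<omega> * (s \<omega> + c))"
proof (rule gpow_ok_mult[where C = "1 + norm c" and m = 1, OF assms])
  note [measurable] = gpow_ok_measurable[OF assms]
  show "(\<lambda>\<omega>. s \<omega> + c) \<in> borel_measurable \<mu>" by measurable
  show "norm (s \<omega> + c) \<le> (1 + norm c) * (1 + norm (s \<omega>)) ^ 1" for \<omega>
  proof -
    have "0 \<le> norm c * norm (s \<omega>)" by simp
    then have "norm (s \<omega>) + norm c \<le> (1 + norm c) * (1 + norm (s \<omega>))" by (simp add: algebra_simps)
    then show ?thesis using norm_triangle_ineq[of "s \<omega>" c] by simp
  qed
qed

lemma gpow_ok_cmult: "gpow_ok \<mu> s \<kappa> \<Longrightarrow> gpow_ok \<mu> s (\<lambda>\<omega>. \<kappa> \<omega> * c)"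
  by (rule gpow_ok_mult[where C = "norm c" and m = 0]) auto

lemma gpow_ok_scale:
  assumes "gpow_ok \<mu> s \<kappa>"
  shows "gpow_ok \<mu> s (\<lambda>\<omega>. \<kappa> \<omega> * exp (s \<omega> * of_real r))"
  unfolding gpow_ok_def
proof (intro conjI allI)
  note [measurable] = gpow_ok_measurable[OF assms]
  show "s \<in> borel_measurable \<mu>" by measurable
  show "(\<lambda>\<omega>. \<kappa> \<omega> * exp (s \<omega> * of_real r)) \<in> borel_measurable \<mu>" by measurable
  fix n :: nat and r' :: real
  have "integrable \<mu> (\<lambda>\<omega>. (1 + norm (s \<omega>)) ^ n * exp (Re (s \<omega>) * (r' + r)) * norm (\<kappa> \<omega>))"
    using assms unfolding gpow_ok_def by blast
  then show "integrable \<mu> (\<lambda>\<omega>. (1 + norm (s \<omega>)) ^ n * exp (Re (s \<omega>) * r') * norm (\<kappa> \<omega> * exp (s \<omega> * of_real r)))"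
    by (simp add: norm_mult distrib_left exp_add mult_ac)
qed

lemma gpow_scale:
  assumes "x > 0" "t > 0"
  shows "gpow \<mu> s \<kappa> (x * t) = gpow \<mu> s (\<lambda>\<omega>. \<kappa> \<omega> * exp (s \<omega> * of_real (ln t))) x"
  using assms by (simp add: gpow_def ln_mult_pos distrib_left exp_add mult_ac)

text \<open>In the variable l = ln x the integrand is an exponential, whose second-order remainder
  is at most |s|^2 h^2 exp |Re s h|. For |h| <= 1 the last factor is absorbed by adding the moduli
  of the integrand at l + 1 and l - 1, so the remainder is h^2 times the fixed integrable function
  \<open>M\<close>.\<close>

lemma gpow_has_vector_derivative:
  assumes ok: "gpow_ok \<mu> s \<kappa>" and x: "x > 0"
  shows "(gpow \<mu> s \<kappa> has_vector_derivative gpow \<mu> s (\<lambda>\<omega>. \<kappa> \<omega> * s \<omega>) x /\<^sub>R x) (at x)"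
proof -
  note [measurable] = gpow_ok_measurable[OF ok]
  define g where "g = (\<lambda>l::real. \<integral>\<omega>. \<kappa> \<omega> * exp (s \<omega> * of_real l) \<partial>\<mu>)"
  define g1 where "g1 = (\<lambda>l::real. \<integral>\<omega>. \<kappa> \<omega> * s \<omega> * exp (s \<omega> * of_real l) \<partial>\<mu>)"
  have der: "(g has_vector_derivative g1 l) (at l)" for l
  proof -
    define M where "M = (\<lambda>\<omega>. (1 + norm (s \<omega>)) ^ 2 * exp (Re (s \<omega>) * (l + 1)) * norm (\<kappa> \<omega>) +
       (1 + norm (s \<omega>)) ^ 2 * exp (Re (s \<omega>) * (l - 1)) * norm (\<kappa> \<omega>))"
    have M: "integrable \<mu> M"
      unfolding M_def by (intro Bochner_Integration.integrable_add) (use ok in \<open>auto simp: gpow_ok_def\<close>)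
    have int: "integrable \<mu> (\<lambda>\<omega>. \<kappa> \<omega> * exp (s \<omega> * of_real l))" for l
      by (rule gpow_ok_integrable[OF ok])
    have int1: "integrable \<mu> (\<lambda>\<omega>. \<kappa> \<omega> * s \<omega> * exp (s \<omega> * of_real l))" for l
      by (rule gpow_ok_integrable[OF gpow_ok_mult_exponent[OF ok]])
    have rem: "norm (g l' - g l - (l' - l) *\<^sub>R g1 l) \<le> (l' - l)\<^sup>2 * (\<integral>\<omega>. M \<omega> \<partial>\<mu>)" if "\<bar>l' - l\<bar> \<le> 1" for l'
    proof -
      define h where "h = l' - l"
      have h: "\<bar>h\<bar> \<le> 1" using that by (simp add: h_def)
      have "g l' - g l - (l' - l) *\<^sub>R g1 l =
        (\<integral>\<omega>. \<kappa> \<omega> * exp (s \<omega> * of_real l') - \<kappa> \<omega> * exp (s \<omega> * of_real l) -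
            h *\<^sub>R (\<kappa> \<omega> * s \<omega> * exp (s \<omega> * of_real l)) \<partial>\<mu>)"
        unfolding g_def g1_def h_def by (simp add: int int1)
      also have "norm \<dots> \<le> (\<integral>\<omega>. h\<^sup>2 * M \<omega> \<partial>\<mu>)"
      proof (rule norm_integral_le_integral)
        fix \<omega>
        have "cmod (exp (s \<omega> * of_real h) - (\<Sum>k\<le>1. (s \<omega> * of_real h) ^ k / fact k)) \<le>
            exp \<bar>Re (s \<omega> * of_real h)\<bar> * cmod (s \<omega> * of_real h) ^ Suc 1 / fact 1"
          by (rule Taylor_exp)
        then have T: "cmod (exp (s \<omega> * of_real h) - 1 - s \<omega> * of_real h) \<le>
            exp \<bar>Re (s \<omega>) * h\<bar> * (norm (s \<omega>) ^ 2 * h\<^sup>2)"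
          by (simp add: norm_mult power2_eq_square algebra_simps)
        have "exp \<bar>Re (s \<omega>) * h\<bar> \<le> exp \<bar>Re (s \<omega>)\<bar>"
          using h by (simp add: abs_mult mult_left_le)
        also have "\<dots> \<le> exp (Re (s \<omega>)) + exp (- Re (s \<omega>))"
          by (cases "Re (s \<omega>) \<ge> 0") auto
        finally have E: "exp \<bar>Re (s \<omega>) * h\<bar> \<le> exp (Re (s \<omega>)) + exp (- Re (s \<omega>))" .
        have "\<kappa> \<omega> * exp (s \<omega> * of_real l') - \<kappa> \<omega> * exp (s \<omega> * of_real l) -
            h *\<^sub>R (\<kappa> \<omega> * s \<omega> * exp (s \<omega> * of_real l)) =
          \<kappa> \<omega> * exp (s \<omega> * of_real l) * (exp (s \<omega> * of_real h) - 1 - s \<omega> * of_real h)"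
        proof -
          have "exp (s \<omega> * of_real l') = exp (s \<omega> * of_real l) * exp (s \<omega> * of_real h)"
            by (simp add: h_def exp_add[symmetric] algebra_simps)
          then show ?thesis by (simp add: algebra_simps scaleR_conv_of_real)
        qed
        also have "norm \<dots> \<le> norm (\<kappa> \<omega>) * exp (Re (s \<omega>) * l) *
            ((exp (Re (s \<omega>)) + exp (- Re (s \<omega>))) * ((1 + norm (s \<omega>)) ^ 2 * h\<^sup>2))"
        proof -
          have "cmod (exp (s \<omega> * of_real h) - 1 - s \<omega> * of_real h) \<le>
              (exp (Re (s \<omega>)) + exp (- Re (s \<omega>))) * ((1 + norm (s \<omega>)) ^ 2 * h\<^sup>2)"
            by (rule order_trans[OF T]) (intro mult_mono[OF E] mult_right_mono power_mono, auto)
          then show ?thesis unfolding norm_mult by (intro mult_mono) auto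
        qed
        also have "\<dots> = h\<^sup>2 * M \<omega>"
          by (simp add: M_def algebra_simps exp_add[symmetric] exp_diff exp_minus) (simp add: exp_add exp_diff field_simps)
        finally show "norm (\<kappa> \<omega> * exp (s \<omega> * of_real l') - \<kappa> \<omega> * exp (s \<omega> * of_real l) -
            h *\<^sub>R (\<kappa> \<omega> * s \<omega> * exp (s \<omega> * of_real l))) \<le> h\<^sup>2 * M \<omega>" .
      qed (use int int1 M in auto)
      finally show ?thesis by (simp add: h_def)
    qed
    show ?thesis
      unfolding has_vector_derivative_def
    proof (rule has_derivativeI_sandwich[where e = 1])
      show "bounded_linear (\<lambda>h. h *\<^sub>R g1 l)" by (rule bounded_linear_scaleR_left)
      define B where "B = (\<integral>\<omega>. M \<omega> \<partial>\<mu>)"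
      show "((\<lambda>y. \<bar>y - l\<bar> * B) \<longlongrightarrow> 0) (at l)"
        by (auto intro!: tendsto_eq_intros)
      fix y assume y: "y \<noteq> l" "dist y l < 1"
      then have "norm (g y - g l - (y - l) *\<^sub>R g1 l) \<le> (y - l)\<^sup>2 * B"
        unfolding B_def by (intro rem) (auto simp: dist_real_def)
      also have "\<dots> = \<bar>y - l\<bar> * B * \<bar>y - l\<bar>" by (simp add: power2_eq_square)
      finally show "norm (g y - g l - (y - l) *\<^sub>R g1 l) / norm (y - l) \<le> \<bar>y - l\<bar> * B"
        using y by (simp add: divide_le_eq)
    qed simp
  qed
  have eq: "gpow \<mu> s \<kappa> = g \<circ> ln" by (auto simp: gpow_def g_def)
  have "(ln has_vector_derivative inverse x) (at x)"
    using x by (auto intro!: derivative_eq_intros simp: has_real_derivative_iff_has_vector_derivative[symmetric] inverse_eq_divide)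
  from vector_diff_chain_at[OF this der] show ?thesis
    by (simp add: eq gpow_def g1_def)
qed

lemma Re_gpow_has_real_derivative:
  assumes "gpow_ok \<mu> s \<kappa>" "x > 0"
  shows "((\<lambda>x. Re (gpow \<mu> s \<kappa> x)) has_real_derivative Re (gpow \<mu> s (\<lambda>\<omega>. \<kappa> \<omega> * s \<omega>) x) / x) (at x)"
proof -
  have "((\<lambda>x. Re (gpow \<mu> s \<kappa> x)) has_vector_derivative Re (gpow \<mu> s (\<lambda>\<omega>. \<kappa> \<omega> * s \<omega>) x /\<^sub>R x)) (at x)"
    by (rule bounded_linear.has_vector_derivative[OF bounded_linear_Re gpow_has_vector_derivative[OF assms]])
  then show ?thesis by (simp add: has_real_derivative_iff_has_vector_derivative field_simps)
qed

lemma has_real_derivative_cong_pos: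
  fixes f g :: "real \<Rightarrow> real"
  assumes "(g has_real_derivative D) (at x)" "x > 0" "\<And>u. u > 0 \<Longrightarrow> f u = g u"
  shows "(f has_real_derivative D) (at x)"
  using assms(1)
  by (rule has_field_derivative_transform_within_open[of _ _ _ "{0<..}"]) (use assms in auto)

lemma euler_op_gpow:
  assumes "gpow_ok \<mu> s \<kappa>" "\<And>u. u > 0 \<Longrightarrow> f u = Re (gpow \<mu> s \<kappa> u)" "x > 0"
  shows "euler_op f x = Re (gpow \<mu> s (\<lambda>\<omega>. \<kappa> \<omega> * s \<omega>) x)"
proof -
  have "(f has_real_derivative Re (gpow \<mu> s (\<lambda>\<omega>. \<kappa> \<omega> * s \<omega>) x) / x) (at x)"
    by (rule has_real_derivative_cong_pos[OF Re_gpow_has_real_derivative]) (use assms in auto)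
  then show ?thesis using assms(3) by (simp add: euler_op_def DERIV_imp_deriv)
qed

lemma gpow_add:
  assumes "gpow_ok \<mu> s \<kappa>" "gpow_ok \<mu> s \<kappa>'"
  shows "gpow \<mu> s (\<lambda>\<omega>. \<kappa> \<omega> + \<kappa>' \<omega>) x = gpow \<mu> s \<kappa> x + gpow \<mu> s \<kappa>' x"
  unfolding gpow_def by (subst Bochner_Integration.integral_add[symmetric])
    (auto intro!: gpow_ok_integrable assms simp: ring_distribs)

lemma gpow_cmult: "gpow \<mu> s (\<lambda>\<omega>. \<kappa> \<omega> * c) x = gpow \<mu> s \<kappa> x * c"
proof -
  have "gpow \<mu> s (\<lambda>\<omega>. \<kappa> \<omega> * c) x = (\<integral>\<omega>. \<kappa> \<omega> * exp (s \<omega> * of_real (ln x)) * c \<partial>\<mu>)"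
    by (simp add: gpow_def mult_ac)
  then show ?thesis by (simp add: gpow_def)
qed

text \<open>Dilation by \<open>t\<close> commutes with the Euler operator and only multiplies the
  density by exp(s ln t), so for fixed \<open>t\<close> the operator acts on a superposition with
  the same exponents.\<close>

lemma correction_op_gpow:
  assumes ok: "gpow_ok \<mu> s \<kappa>" and f: "\<And>u. u > 0 \<Longrightarrow> f u = Re (gpow \<mu> s \<kappa> u)"
    and "x > 0" "t > 0"
  shows "correction_op \<epsilon> (\<lambda>u. f (u * t)) x =
    Re (gpow \<mu> s (\<lambda>\<omega>. \<kappa> \<omega> * (1 + of_real \<epsilon> * (s \<omega> * (s \<omega> + 1)))) (x * t))"
proof -
  define k where "k = (\<lambda>\<omega>. \<kappa> \<omega> * exp (s \<omega> * of_real (ln t)))"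
  have ok0: "gpow_ok \<mu> s k" unfolding k_def by (rule gpow_ok_scale[OF ok])
  have ok1: "gpow_ok \<mu> s (\<lambda>\<omega>. k \<omega> * s \<omega>)" by (rule gpow_ok_mult_exponent[OF ok0])
  have ok2: "gpow_ok \<mu> s (\<lambda>\<omega>. k \<omega> * s \<omega> * s \<omega>)" by (rule gpow_ok_mult_exponent[OF ok1])
  have e0: "f (u * t) = Re (gpow \<mu> s k u)" if "u > 0" for u
    using that assms by (simp add: f gpow_scale k_def)
  have e1: "euler_op (\<lambda>u. f (u * t)) u = Re (gpow \<mu> s (\<lambda>\<omega>. k \<omega> * s \<omega>) u)" if "u > 0" for u
    using e0 that by (intro euler_op_gpow ok0)
  have e2: "euler_op (euler_op (\<lambda>u. f (u * t))) x = Re (gpow \<mu> s (\<lambda>\<omega>. k \<omega> * s \<omega> * s \<omega>) x)"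
    by (rule euler_op_gpow[OF ok1 e1 \<open>x > 0\<close>])
  have "(\<lambda>\<omega>. \<kappa> \<omega> * (1 + of_real \<epsilon> * (s \<omega> * (s \<omega> + 1))) * exp (s \<omega> * of_real (ln t))) =
      (\<lambda>\<omega>. (k \<omega> + (k \<omega> * s \<omega> + k \<omega> * s \<omega> * s \<omega>) * of_real \<epsilon>))"
    by (auto simp: k_def algebra_simps)
  then have "gpow \<mu> s (\<lambda>\<omega>. \<kappa> \<omega> * (1 + of_real \<epsilon> * (s \<omega> * (s \<omega> + 1)))) (x * t) =
      gpow \<mu> s (\<lambda>\<omega>. k \<omega> + (k \<omega> * s \<omega> + k \<omega> * s \<omega> * s \<omega>) * of_real \<epsilon>) x"
    using assms by (subst gpow_scale) auto
  also have "\<dots> = gpow \<mu> s k x + (gpow \<mu> s (\<lambda>\<omega>. k \<omega> * s \<omega>) x + gpow \<mu> s (\<lambda>\<omega>. k \<omega> * s \<omega> * s \<omega>) x) * of_real \<epsilon>"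
  proof -
    have "gpow_ok \<mu> s (\<lambda>\<omega>. k \<omega> * s \<omega> * (s \<omega> + 1))" by (rule gpow_ok_mult_exponent_add[OF ok1])
    then have "gpow_ok \<mu> s (\<lambda>\<omega>. k \<omega> * s \<omega> + k \<omega> * s \<omega> * s \<omega>)" by (simp add: algebra_simps)
    then show ?thesis by (simp add: gpow_add gpow_cmult ok0 ok1 ok2 gpow_ok_cmult)
  qed
  finally show ?thesis
    unfolding correction_op_def e2 e1[OF \<open>x > 0\<close>] e0[OF \<open>x > 0\<close>] by (simp add: algebra_simps)
qed

text \<open>The effect of the Rodrigues formula in \<open>polya_q\<close> on a single power: u^(n+s)
  differentiated n times is (s+n)(s+n-1)...(s+1) u^s. After \<open>m\<close> derivatives the
  function is u^(n-m) times a superposition with density \<open>k m\<close>. The induction keeps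
  \<open>u\<close> arbitrary because the next \<open>deriv\<close> needs the formula on a
  neighbourhood.\<close>

lemma higher_deriv_power_times_gpow:
  assumes ok: "gpow_ok \<mu> s \<kappa>" and f: "\<And>u. u > 0 \<Longrightarrow> f u = C * Re (gpow \<mu> s \<kappa> u)" and "x > 0"
  shows "(deriv ^^ n) (\<lambda>u. (- u) ^ n * f u) x =
    (- 1) ^ n * C * Re (gpow \<mu> s (\<lambda>\<omega>. \<kappa> \<omega> * pochhammer (1 + s \<omega>) n) x)"
proof -
  define k where "k = (\<lambda>m \<omega>. \<kappa> \<omega> * (\<Prod>i<m. s \<omega> + of_nat (n - i)))"
  have k_Suc: "k (Suc m) = (\<lambda>\<omega>. k m \<omega> * (s \<omega> + of_nat (n - m)))" for m
    by (simp add: k_def mult_ac)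
  have okk: "gpow_ok \<mu> s (k m)" for m
  proof (induction m)
    case 0
    then show ?case using ok by (simp add: k_def)
  next
    case (Suc m)
    then show ?case unfolding k_Suc by (rule gpow_ok_mult_exponent_add)
  qed
  have main: "(deriv ^^ m) (\<lambda>u. (- u) ^ n * f u) u = (- 1) ^ n * C * (u ^ (n - m) * Re (gpow \<mu> s (k m) u))"
    if "m \<le> n" "u > 0" for m u
    using that
  proof (induction m arbitrary: u)
    case 0
    then show ?case by (simp add: f k_def power_minus[of u])
  next
    case (Suc m)
    define p where "p = n - Suc m"
    have p: "n - m = Suc p" using Suc.prems by (simp add: p_def)
    have sp: "of_nat (n - m) = (of_nat (Suc p) :: complex)" by (simp only: p)
    have d: "((\<lambda>u. (- 1) ^ n * C * (u ^ Suc p * Re (gpow \<mu> s (k m) u))) has_real_derivative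
        (- 1) ^ n * C * (u ^ p * Re (gpow \<mu> s (k (Suc m)) u))) (at u)"
    proof -
      have "((\<lambda>u. (- 1) ^ n * C * (u ^ Suc p * Re (gpow \<mu> s (k m) u))) has_real_derivative
        (- 1) ^ n * C * (real (Suc p) * u ^ p * Re (gpow \<mu> s (k m) u) +
          Re (gpow \<mu> s (\<lambda>\<omega>. k m \<omega> * s \<omega>) u) / u * u ^ Suc p)) (at u)"
      proof -
        have "((\<lambda>u. u ^ Suc p) has_real_derivative real (Suc p) * u ^ p) (at u)"
          using DERIV_pow[of "Suc p" u] by simp
        from DERIV_cmult[OF DERIV_mult[OF this Re_gpow_has_real_derivative[OF okk Suc.prems(2)]]]
        show ?thesis .
      qed
      also have "real (Suc p) * u ^ p * Re (gpow \<mu> s (k m) u) +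
          Re (gpow \<mu> s (\<lambda>\<omega>. k m \<omega> * s \<omega>) u) / u * u ^ Suc p =
          u ^ p * Re (gpow \<mu> s (k (Suc m)) u)"
        unfolding k_Suc distrib_left sp
        using Suc.prems
        by (simp add: gpow_add gpow_cmult okk gpow_ok_mult_exponent gpow_ok_cmult del: of_nat_Suc)
           (simp add: algebra_simps)
      finally show ?thesis .
    qed
    have "((deriv ^^ m) (\<lambda>u. (- u) ^ n * f u) has_real_derivative
        (- 1) ^ n * C * (u ^ p * Re (gpow \<mu> s (k (Suc m)) u))) (at u)"
      by (rule has_real_derivative_cong_pos[OF d]) (use Suc p in auto)
    then show ?case by (simp add: DERIV_imp_deriv p_def)
  qed
  have "(\<Prod>i<n. z + of_nat (n - i)) = pochhammer (1 + z) n" for z :: complex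
  proof -
    have "(\<Prod>i<n. z + of_nat (n - i)) = (\<Prod>i<n. z + of_nat (Suc i))"
      by (subst prod.nat_diff_reindex[symmetric]) (auto intro!: prod.cong simp: Suc_diff_Suc)
    then show ?thesis by (simp add: pochhammer_prod atLeast0LessThan add_ac)
  qed
  then show ?thesis using main[of n x] assms(3) by (simp add: k_def)
qed

section \<open>Kernel and expansions as pairings\<close>

lemma (in pair_sigma_finite) integrable_product_mult:
  fixes f :: "_ \<Rightarrow> 'c::{real_normed_field, banach, second_countable_topology}"
  assumes f: "integrable M1 f" and g: "integrable M2 g"
  shows "integrable (M1 \<Otimes>\<^sub>M M2) (\<lambda>(x, y). f x * g y)"
proof (rule Fubini_integrable)
  note [measurable] = borel_measurable_integrable[OF f] borel_measurable_integrable[OF g]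
  show "(\<lambda>(x, y). f x * g y) \<in> borel_measurable (M1 \<Otimes>\<^sub>M M2)" by measurable
qed (use f g in \<open>auto simp: norm_mult\<close>)

lemma (in pair_sigma_finite) integral_product_mult:
  fixes f :: "_ \<Rightarrow> 'c::{real_normed_field, banach, second_countable_topology}"
  assumes f: "integrable M1 f" and g: "integrable M2 g"
  shows "(\<integral>(x, y). f x * g y \<partial>(M1 \<Otimes>\<^sub>M M2)) = (\<integral>x. f x \<partial>M1) * (\<integral>y. g y \<partial>M2)"
  by (subst integral_fst[symmetric]) (use integrable_product_mult[OF f g] in simp_all)

lemma set_integrable_powr_Ioc:
  assumes "\<sigma> > (-1::real)"
  shows "set_integrable lborel {0<..1} (\<lambda>t. t powr \<sigma>)"
proof -
  have "set_integrable lborel {0..1} (\<lambda>t. t powr (\<sigma> + 1 - 1) * (1 - t) powr (1 - 1))"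
    by (rule integrable_Beta) (use assms in auto)
  then have "set_integrable lborel {0<..1} (\<lambda>t. t powr (\<sigma> + 1 - 1) * (1 - t) powr (1 - 1))"
    by (rule set_integrable_subset) auto
  \<comment> \<open>With second parameter 1 the Beta integrand is t powr \<sigma> except at t = 1,
    where its second factor is 0 powr 0 = 0.\<close>
  then show ?thesis
    unfolding set_integrable_def
    by (rule integrable_cong_AE_imp) (auto intro!: AE_I[where N = "{1}"] simp: indicator_def)
qed

text \<open>For e = s + j this is the source of the denominator s + j + 1 in the expansions: the
  integral over \<open>t\<close> of t^j from \<open>F\<close> times t^s from
  \<open>G\<close>.\<close>

lemma exp_mult_ln_Ioc_integral:
  fixes e :: complex
  assumes e: "Re e > -1"
  shows "set_integrable lborel {0<..1} (\<lambda>t. exp (e * of_real (ln t)))"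
    and "(LINT t:{0<..1}|lborel. exp (e * of_real (ln t))) = 1 / (e + 1)"
proof -
  have e1: "e + 1 \<noteq> 0" using e by (auto simp: complex_eq_iff)
  show int: "set_integrable lborel {0<..1} (\<lambda>t. exp (e * of_real (ln t)))"
    unfolding set_integrable_def
  proof (rule Bochner_Integration.integrable_bound)
    show "integrable lborel (\<lambda>t. indicator {0<..1} t *\<^sub>R (t powr Re e))"
      using set_integrable_powr_Ioc[OF e] by (simp add: set_integrable_def)
    show "AE t in lborel. norm (indicator {0<..1} t *\<^sub>R exp (e * of_real (ln t)))
        \<le> norm (indicator {0<..1} t *\<^sub>R (t powr Re e))"
      by (auto simp: indicator_def powr_def)
  qed measurable
  \<comment> \<open>The primitive is given its limit at 0 by hand; an exponential cannot take the
    value 0 there.\<close>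
  define g where "g = (\<lambda>t::real. if t = 0 then 0 else exp ((e + 1) * of_real (ln t)) / (e + 1))"
  have "((\<lambda>t. exp (e * of_real (ln t))) has_integral g 1 - g 0) {0..1}"
  proof (rule fundamental_theorem_of_calculus_interior)
    show "continuous_on {0..1} g"
      unfolding continuous_on_def
    proof
      fix t :: real assume t: "t \<in> {0..1}"
      show "(g \<longlongrightarrow> g t) (at t within {0..1})"
      proof (cases "t = 0")
        case True
        have "((\<lambda>t. t powr (Re e + 1) / norm (e + 1)) \<longlongrightarrow> 0) (at_right 0)"
          using e by (intro tendsto_divide_zero tendsto_zero_powrI[OF tendsto_ident_at tendsto_const])
            (auto simp: eventually_at_filter)
        then have "((\<lambda>t. norm (g t)) \<longlongrightarrow> 0) (at_right 0)"
          by (rule Lim_transform_eventually)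
             (auto simp: eventually_at_filter g_def norm_divide powr_def intro!: always_eventually)
        then have "(g \<longlongrightarrow> 0) (at_right 0)" by (rule tendsto_norm_zero_cancel)
        then have "(g \<longlongrightarrow> 0) (at 0 within {0..1})"
          by (simp add: at_within_Icc_at_right)
        then show ?thesis using True by (simp add: g_def)
      next
        case False
        have "((\<lambda>t. exp ((e + 1) * of_real (ln t)) / (e + 1)) \<longlongrightarrow> exp ((e + 1) * of_real (ln t)) / (e + 1)) (at t within {0..1})"
          using False t e1 by (intro tendsto_intros) auto
        then have "(g \<longlongrightarrow> exp ((e + 1) * of_real (ln t)) / (e + 1)) (at t within {0..1})"
        proof (rule Lim_transform_eventually)
          show "\<forall>\<^sub>F u in at t within {0..1}. exp ((e + 1) * of_real (ln u)) / (e + 1) = g u"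
            by (rule eventually_mono[OF tendsto_imp_eventually_ne[OF tendsto_ident_at False]]) (simp add: g_def)
        qed
        then show ?thesis using False by (simp add: g_def)
      qed
    qed
    fix t :: real assume t: "t \<in> {0<..<1}"
    have "((\<lambda>z. exp ((e + 1) * z) / (e + 1)) has_field_derivative exp ((e + 1) * of_real (ln t))) (at (of_real (ln t)))"
      using e1 by (auto intro!: derivative_eq_intros)
    moreover have "((\<lambda>t. complex_of_real (ln t)) has_vector_derivative of_real (inverse t)) (at t)"
      using t by (auto intro!: derivative_eq_intros has_vector_derivative_of_real simp: inverse_eq_divide)
    ultimately have "((\<lambda>t. exp ((e + 1) * of_real (ln t)) / (e + 1)) has_vector_derivative of_real (inverse t) * exp ((e + 1) * of_real (ln t))) (at t)"
      using field_vector_diff_chain_at[of "\<lambda>t. complex_of_real (ln t)" "of_real (inverse t)" t "\<lambda>z. exp ((e + 1) * z) / (e + 1)"]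
      by (simp add: o_def)
    also have "of_real (inverse t) * exp ((e + 1) * of_real (ln t)) = exp (e * of_real (ln t))"
      using t by (simp add: ring_distribs exp_add exp_of_real)
    finally show "(g has_vector_derivative exp (e * of_real (ln t))) (at t)"
      by (rule has_vector_derivative_transform_within_open[of _ _ _ "{0<..}"]) (use t in \<open>auto simp: g_def\<close>)
  qed simp
  then have "((\<lambda>t. exp (e * of_real (ln t))) has_integral 1 / (e + 1)) {0..1}"
    by (simp add: g_def)
  then have "((\<lambda>t. exp (e * of_real (ln t))) has_integral 1 / (e + 1)) {0<..1}"
    by (rule has_integral_spike_set_eq[THEN iffD1, rotated 2]) (rule negligible_subset[of "{0}"]; auto)+
  moreover have "(LINT t:{0<..1}|lborel. exp (e * of_real (ln t))) = integral {0<..1} (\<lambda>t. exp (e * of_real (ln t)))"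
    by (rule set_borel_integral_eq_integral[OF int])
  ultimately show "(LINT t:{0<..1}|lborel. exp (e * of_real (ln t))) = 1 / (e + 1)"
    by (simp add: integral_unique)
qed

section \<open>Measurability of the Gamma factors, and the closed sum over the degree\<close>

lemma borel_measurable_rGamma [measurable]: "(rGamma :: complex \<Rightarrow> complex) \<in> borel_measurable borel"
  by (intro borel_measurable_continuous_onI continuous_on_rGamma)

lemma borel_measurable_Gamma [measurable]: "(Gamma :: complex \<Rightarrow> complex) \<in> borel_measurable borel"
  unfolding Gamma_def by measurable

lemma borel_measurable_rGamma_real [measurable]: "(rGamma :: real \<Rightarrow> real) \<in> borel_measurable borel"
  by (intro borel_measurable_continuous_onI continuous_on_rGamma)

lemma borel_measurable_Gamma_real [measurable]: "(Gamma :: real \<Rightarrow> real) \<in> borel_measurable borel"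
  unfolding Gamma_def by measurable

lemma borel_measurable_pochhammer [measurable (raw)]:
  fixes f :: "'a \<Rightarrow> complex"
  assumes [measurable]: "f \<in> borel_measurable M"
  shows "(\<lambda>x. pochhammer (f x) n) \<in> borel_measurable M"
  unfolding pochhammer_prod by measurable

lemma borel_measurable_gamma_ratio [measurable (raw)]:
  assumes [measurable]: "f \<in> borel_measurable M"
  shows "(\<lambda>x. gamma_ratio N (f x)) \<in> borel_measurable M"
  unfolding gamma_ratio_def by measurable

text \<open>A hockey-stick summation that collapses the sum over the degree \<open>n\<close> for
  fixed \<open>j\<close>. Its denominator z + j + 1 is the one obtained by integrating t^(z+j) over
  (0,1]; this coincidence links the kernel with the integral over \<open>t\<close>.\<close>

lemma sum_pochhammer_over_fact:
  fixes z :: complex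
  assumes nz: "z + of_nat j + 1 \<noteq> 0"
  shows "(\<Sum>n=j..<Suc (j + m). pochhammer (1 + z) n / fact (n - j)) =
    pochhammer (1 + z) (Suc (j + m)) / (fact m * (z + of_nat j + 1))"
proof (induction m)
  case 0
  then show ?case using nz by (simp add: pochhammer_Suc add_ac)
next
  case (Suc m)
  define P where "P = pochhammer (1 + z) (Suc (j + m))"
  define e where "e = z + of_nat j + 1"
  have "(\<Sum>n=j..<Suc (j + Suc m). pochhammer (1 + z) n / fact (n - j)) = P / (fact m * e) + P / fact (Suc m)"
    using Suc by (simp add: P_def e_def del: pochhammer_Suc fact_Suc)
  also have "\<dots> = P * (of_nat (Suc m) + e) / (fact (Suc m) * e)"
    using nz by (simp add: e_def[symmetric] divide_simps del: of_nat_Suc) (simp add: algebra_simps)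
  also have "P * (of_nat (Suc m) + e) = pochhammer (1 + z) (Suc (j + Suc m))"
    by (simp add: P_def e_def pochhammer_Suc[of _ "Suc (j + m)"] add_ac del: pochhammer_Suc)
  finally show ?case by (simp add: e_def)
qed

lemma Re_divide_fact: "Re (z / fact n) = Re z / fact n"
  by (metis Re_divide_of_real of_real_fact)

lemma prod_eq_fact_ratio:
  assumes "j < N"
  shows "(\<Prod>k=1..j. 1 - real k / real N) = fact (N - 1) / (real N ^ j * fact (N - 1 - j))"
  using assms
proof (induction j)
  case (Suc j)
  have "N - 1 - j = Suc (N - 1 - Suc j)" using Suc.prems by simp
  then have "fact (N - 1 - j) = real (N - 1 - j) * fact (N - 1 - Suc j)"
    by (metis fact_Suc of_nat_mult of_nat_fact)
  moreover have "real (N - 1 - j) = real N - real (Suc j)" using Suc.prems by simp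
  moreover have "1 - real (Suc j) / real N = (real N - real (Suc j)) / real N"
    using Suc.prems by (simp add: field_simps)
  ultimately show ?case using Suc by (simp del: of_nat_Suc)
qed auto

text \<open>
  The factor \<open>1 + \<Gamma>(2 + Re s)\<close> bounds \<open>gamma_ratio N s\<close> uniformly in \<open>N\<close>; it only matters for \<open>M = 1\<close>,
  where \<open>Re s\<close> is unbounded.
\<close>

locale hard_edge_density = sigma_finite_measure \<mu>
  for \<mu> :: "'b measure" +
  fixes s \<psi> :: "'b \<Rightarrow> complex" and \<sigma> :: real
  assumes s_measurable [measurable]: "s \<in> borel_measurable \<mu>"
    and \<psi>_measurable [measurable]: "\<psi> \<in> borel_measurable \<mu>"
    and Re_s: "\<And>\<omega>. \<sigma> \<le> Re (s \<omega>)"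
    and \<sigma>: "\<sigma> > -1"
    and \<psi>_integrable: "\<And>n r. integrable \<mu> (\<lambda>\<omega>. (1 + norm (s \<omega>)) ^ n * exp (Re (s \<omega>) * r) *
          ((1 + Gamma (2 + Re (s \<omega>))) * norm (\<psi> \<omega>)))"
begin

lemma Gamma_weight_ge_1: "1 + Gamma (2 + Re (s \<omega>)) \<ge> 1"
  using Re_s[of \<omega>] \<sigma> by (simp add: Gamma_real_nonneg)

lemma gpow_ok_\<psi>: "gpow_ok \<mu> s \<psi>"
  unfolding gpow_ok_def
proof (intro conjI allI)
  fix n :: nat and r :: real
  show "integrable \<mu> (\<lambda>\<omega>. (1 + norm (s \<omega>)) ^ n * exp (Re (s \<omega>) * r) * norm (\<psi> \<omega>))"
  proof (rule Bochner_Integration.integrable_bound[OF \<psi>_integrable[of n r]])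
    show "AE \<omega> in \<mu>. norm ((1 + norm (s \<omega>)) ^ n * exp (Re (s \<omega>) * r) * norm (\<psi> \<omega>)) \<le>
      norm ((1 + norm (s \<omega>)) ^ n * exp (Re (s \<omega>) * r) * ((1 + Gamma (2 + Re (s \<omega>))) * norm (\<psi> \<omega>)))"
    proof (rule AE_I2)
      fix \<omega>
      show "norm ((1 + norm (s \<omega>)) ^ n * exp (Re (s \<omega>) * r) * norm (\<psi> \<omega>)) \<le>
        norm ((1 + norm (s \<omega>)) ^ n * exp (Re (s \<omega>) * r) * ((1 + Gamma (2 + Re (s \<omega>))) * norm (\<psi> \<omega>)))"
        using Gamma_weight_ge_1[of \<omega>] unfolding norm_mult
        by (intro mult_left_mono) (auto simp: mult_le_cancel_right1)
    qed
  qed measurable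
qed auto

text \<open>By the recursion, |Gamma(1+s)| <= Gamma(2 + Re s) / (1 + Re s) with a denominator of at
  least 1 + \<sigma> > 0, so the Gamma factor already present in \<open>\<psi>_integrable\<close>
  pays for it.\<close>

lemma gpow_ok_\<psi>_Gamma: "gpow_ok \<mu> s (\<lambda>\<omega>. \<psi> \<omega> * Gamma (1 + s \<omega>))"
  unfolding gpow_ok_def
proof (intro conjI allI)
  fix n :: nat and r :: real
  show "integrable \<mu> (\<lambda>\<omega>. (1 + norm (s \<omega>)) ^ n * exp (Re (s \<omega>) * r) * norm (\<psi> \<omega> * Gamma (1 + s \<omega>)))"
  proof (rule Bochner_Integration.integrable_bound)
    show "integrable \<mu> (\<lambda>\<omega>. 1 / (1 + \<sigma>) * ((1 + norm (s \<omega>)) ^ n * exp (Re (s \<omega>) * r) *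
        ((1 + Gamma (2 + Re (s \<omega>))) * norm (\<psi> \<omega>))))"
      by (intro integrable_mult_right \<psi>_integrable)
    show "AE \<omega> in \<mu>. norm ((1 + norm (s \<omega>)) ^ n * exp (Re (s \<omega>) * r) * norm (\<psi> \<omega> * Gamma (1 + s \<omega>))) \<le>
      norm (1 / (1 + \<sigma>) * ((1 + norm (s \<omega>)) ^ n * exp (Re (s \<omega>) * r) * ((1 + Gamma (2 + Re (s \<omega>))) * norm (\<psi> \<omega>))))"
    proof (rule AE_I2)
      fix \<omega>
      have p: "1 + Re (s \<omega>) > 0" using Re_s[of \<omega>] \<sigma> by simp
      have "norm (Gamma (1 + s \<omega>)) \<le> Gamma (1 + Re (s \<omega>))"
        using norm_Gamma_le_Gamma_Re[of "1 + s \<omega>"] p by simp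
      also have "\<dots> = Gamma (2 + Re (s \<omega>)) / (1 + Re (s \<omega>))"
        using Gamma_plus1[OF not_nonpos_Int_of_pos[OF p]] p by (simp add: add_ac)
      also have "\<dots> \<le> (1 + Gamma (2 + Re (s \<omega>))) / (1 + \<sigma>)"
        using Re_s[of \<omega>] \<sigma> p by (intro frac_le) (auto simp: add_nonneg_nonneg)
      finally have "norm (Gamma (1 + s \<omega>)) \<le> 1 / (1 + \<sigma>) * (1 + Gamma (2 + Re (s \<omega>)))" by simp
      then have "(1 + norm (s \<omega>)) ^ n * exp (Re (s \<omega>) * r) * norm (\<psi> \<omega>) * norm (Gamma (1 + s \<omega>)) \<le>
        (1 + norm (s \<omega>)) ^ n * exp (Re (s \<omega>) * r) * norm (\<psi> \<omega>) * (1 / (1 + \<sigma>) * (1 + Gamma (2 + Re (s \<omega>))))"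
        by (intro mult_left_mono) auto
      also have "\<dots> = 1 / (1 + \<sigma>) * ((1 + norm (s \<omega>)) ^ n * exp (Re (s \<omega>) * r) * ((1 + Gamma (2 + Re (s \<omega>))) * norm (\<psi> \<omega>)))"
        by simp
      also have "\<dots> \<le> norm \<dots>" by (simp only: real_norm_def abs_ge_self)
      finally show "norm ((1 + norm (s \<omega>)) ^ n * exp (Re (s \<omega>) * r) * norm (\<psi> \<omega> * Gamma (1 + s \<omega>))) \<le>
        norm (1 / (1 + \<sigma>) * ((1 + norm (s \<omega>)) ^ n * exp (Re (s \<omega>) * r) * ((1 + Gamma (2 + Re (s \<omega>))) * norm (\<psi> \<omega>))))"
        by (simp add: norm_mult mult_ac)
    qed
  qed measurable
qed auto

end

text \<open>What each of the two cases must supply. \<open>f_eq\<close> ties the series of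
  \<open>F\<close> to the Mellin moments of the weight: apart from a factor depending on n, the
  coefficient of X^j in \<open>polya_p\<close> is f j / (n - j)!. In the applications
  \<open>\<gamma>\<close> is \<open>gamma_norm M a\<close>.\<close>

locale hard_edge_representation = hard_edge_density \<mu> s \<psi> \<sigma>
  for \<mu> :: "'b measure" and s \<psi> :: "'b \<Rightarrow> complex" and \<sigma> :: real +
  fixes \<gamma> :: real and f :: "nat \<Rightarrow> real" and w F G :: "real \<Rightarrow> real"
  assumes f_summable: "\<And>n r. summable (\<lambda>j. (1 + real j) ^ n * exp (real j * r) * \<bar>f j\<bar>)"
    and w_eq: "\<And>u. u > 0 \<Longrightarrow> w u = 1 / \<gamma> * Re (gpow \<mu> s (\<lambda>\<omega>. \<psi> \<omega> * Gamma (1 + s \<omega>)) u)"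
    and G_eq: "\<And>u. u > 0 \<Longrightarrow> G u = Re (gpow \<mu> s \<psi> u)"
    and F_eq: "\<And>u. F u = (\<Sum>j. f j * u ^ j)"
    and mellin_nonzero: "\<And>j. mellin w (real j + 1) \<noteq> 0"
    and f_eq: "\<And>j. f j = (- 1) ^ j / (fact j * mellin w (real j + 1))"
begin

section \<open>Symbols and their pairing with the coefficients of F(x) G(y)\<close>

abbreviation "\<nu>1 \<equiv> count_space (UNIV :: nat set)"

sublocale count: sigma_finite_measure \<nu>1
  by (rule sigma_finite_measure_count_space)

sublocale pair: pair_sigma_finite \<nu>1 \<mu> ..

sublocale pair_measure: sigma_finite_measure "\<nu>1 \<Otimes>\<^sub>M \<mu>"
  by (rule sigma_finite_pair_measure) unfold_locales

sublocale lborel_pair: pair_sigma_finite lborel "\<nu>1 \<Otimes>\<^sub>M \<mu>" ..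

lemma gpow_ok_f: "gpow_ok \<nu>1 of_nat (\<lambda>j. of_real (f j))"
  unfolding gpow_ok_def using f_summable by (auto simp: integrable_count_space_nat_iff abs_mult)

text \<open>A common majorant for all symbols and all errors. The power of 1 + |s| and the Gamma
  factor are those of \<open>gamma_ratio_expansion\<close>; the power of 1 + j covers the fourth
  power from \<open>falling_product_expansion\<close>.\<close>

definition weight :: "nat \<times> 'b \<Rightarrow> real" where
  "weight = (\<lambda>(j, \<omega>). (1 + real j) ^ 8 * ((1 + norm (s \<omega>)) ^ 8 * (1 + Gamma (2 + Re (s \<omega>)))))"

lemma weight_ge_1: "weight p \<ge> 1"
proof -
  have *: "(1 + u) ^ 8 \<ge> (1::real)" if "u \<ge> 0" for u using that by (intro one_le_power) simp
  have "1 * (1 * 1) \<le> (1 + real j) ^ 8 * ((1 + norm (s \<omega>)) ^ 8 * (1 + Gamma (2 + Re (s \<omega>))))" for j \<omega>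
    by (intro mult_mono * Gamma_weight_ge_1) auto
  then show ?thesis by (cases p) (simp add: weight_def)
qed

lemma poly_le_weight:
  assumes "m \<le> 8" "n \<le> 8"
  shows "(1 + real j) ^ m * (1 + norm (s \<omega>)) ^ n \<le> weight (j, \<omega>)"
proof -
  have "(1 + real j) ^ m * ((1 + norm (s \<omega>)) ^ n * 1) \<le> (1 + real j) ^ 8 * ((1 + norm (s \<omega>)) ^ 8 * (1 + Gamma (2 + Re (s \<omega>))))"
    using Gamma_weight_ge_1[of \<omega>] assms by (intro mult_mono power_increasing) auto
  then show ?thesis by (simp add: weight_def)
qed

definition coeff :: "real \<Rightarrow> real \<Rightarrow> nat \<times> 'b \<Rightarrow> complex" where
  "coeff x y = (\<lambda>(j, \<omega>). of_real (f j * x ^ j) * (\<psi> \<omega> * exp (s \<omega> * of_real (ln y))))"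

lemma pair_measurable:
  assumes "\<And>j. (\<lambda>\<omega>. u (j, \<omega>)) \<in> borel_measurable \<mu>"
  shows "u \<in> borel_measurable (\<nu>1 \<Otimes>\<^sub>M \<mu>)"
  by (rule measurable_pair_measure_countable1) (use assms in auto)

lemma coeff_measurable [measurable]: "coeff x y \<in> borel_measurable (\<nu>1 \<Otimes>\<^sub>M \<mu>)"
  by (rule pair_measurable) (simp add: coeff_def)

lemma weight_measurable [measurable]: "weight \<in> borel_measurable (\<nu>1 \<Otimes>\<^sub>M \<mu>)"
  by (rule pair_measurable) (simp add: weight_def)

lemma integrable_weight_coeff:
  assumes "x > 0"
  shows "integrable (\<nu>1 \<Otimes>\<^sub>M \<mu>) (\<lambda>p. weight p * norm (coeff x y p))"
proof -
  have "integrable \<nu>1 (\<lambda>j. (1 + real j) ^ 8 * exp (real j * ln x) * \<bar>f j\<bar>)"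
    using f_summable[of 8 "ln x"] by (simp add: integrable_count_space_nat_iff abs_mult)
  from pair.integrable_product_mult[OF this \<psi>_integrable[of 8 "ln y"]]
  show ?thesis
  proof (rule Bochner_Integration.integrable_cong[THEN iffD1, rotated 2])
    show "(case p of (j, \<omega>) \<Rightarrow> (1 + real j) ^ 8 * exp (real j * ln x) * \<bar>f j\<bar> *
        ((1 + norm (s \<omega>)) ^ 8 * exp (Re (s \<omega>) * ln y) * ((1 + Gamma (2 + Re (s \<omega>))) * norm (\<psi> \<omega>)))) =
        weight p * norm (coeff x y p)" for p
      using assms exp_of_nat_mult[of _ "ln x"]
      by (cases p) (auto simp: weight_def coeff_def norm_mult abs_mult norm_power mult_ac)
  qed simp
qed

lemma integrable_coeff:
  assumes "x > 0" and [measurable]: "u \<in> borel_measurable (\<nu>1 \<Otimes>\<^sub>M \<mu>)"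
    and bound: "\<And>p. norm (u p) \<le> C * weight p"
  shows "integrable (\<nu>1 \<Otimes>\<^sub>M \<mu>) (\<lambda>p. coeff x y p * u p)"
proof (rule Bochner_Integration.integrable_bound)
  show "integrable (\<nu>1 \<Otimes>\<^sub>M \<mu>) (\<lambda>p. C * (weight p * norm (coeff x y p)))"
    by (intro integrable_mult_right integrable_weight_coeff assms)
  show "AE p in \<nu>1 \<Otimes>\<^sub>M \<mu>. norm (coeff x y p * u p) \<le> norm (C * (weight p * norm (coeff x y p)))"
  proof (rule AE_I2)
    fix p
    have "norm (coeff x y p * u p) \<le> norm (coeff x y p) * (C * weight p)"
      unfolding norm_mult by (intro mult_left_mono bound) auto
    also have "\<dots> = C * (weight p * norm (coeff x y p))" by simp
    also have "\<dots> \<le> norm \<dots>" by simp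
    finally show "norm (coeff x y p * u p) \<le> norm (C * (weight p * norm (coeff x y p)))" .
  qed
qed measurable

text \<open>The product F(x) G(y) is the real part of the pairing with symbol 1. Differential
  operators, the integral over \<open>t\<close> and the finite-N kernel change only the symbol
  \<open>u\<close>, so comparing the expansions becomes a pointwise comparison of symbols.\<close>

definition pairing :: "real \<Rightarrow> real \<Rightarrow> (nat \<times> 'b \<Rightarrow> complex) \<Rightarrow> complex" where
  "pairing x y u = (\<integral>p. coeff x y p * u p \<partial>(\<nu>1 \<Otimes>\<^sub>M \<mu>))"

text \<open>The O-terms of the theorem come from here: for symbols depending on N, a pointwise bound
  by C times \<open>weight\<close> turns into C times an integral that is free of N. Integrability
  for \<open>u\<close> is inherited from the bounds on \<open>v\<close> and on the
  difference.\<close>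

lemma pairing_diff_bound:
  assumes "x > 0" and "u \<in> borel_measurable (\<nu>1 \<Otimes>\<^sub>M \<mu>)" "v \<in> borel_measurable (\<nu>1 \<Otimes>\<^sub>M \<mu>)"
    and "\<And>p. norm (v p) \<le> C' * weight p"
    and d: "\<And>p. norm (u p - v p) \<le> C * weight p"
  shows "norm (pairing x y u - pairing x y v) \<le> C * (\<integral>p. weight p * norm (coeff x y p) \<partial>(\<nu>1 \<Otimes>\<^sub>M \<mu>))"
proof -
  have u: "norm (u p) \<le> (C + C') * weight p" for p
    using norm_triangle_sub[of "u p" "v p"] assms(4)[of p] d[of p] by (simp add: algebra_simps)
  have iu: "integrable (\<nu>1 \<Otimes>\<^sub>M \<mu>) (\<lambda>p. coeff x y p * u p)"
    and iv: "integrable (\<nu>1 \<Otimes>\<^sub>M \<mu>) (\<lambda>p. coeff x y p * v p)"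
    by (rule integrable_coeff[OF assms(1,2) u] integrable_coeff[OF assms(1,3,4)])+
  have "pairing x y u - pairing x y v = (\<integral>p. coeff x y p * u p - coeff x y p * v p \<partial>(\<nu>1 \<Otimes>\<^sub>M \<mu>))"
    unfolding pairing_def by (simp add: iu iv)
  also have "norm \<dots> \<le> (\<integral>p. C * (weight p * norm (coeff x y p)) \<partial>(\<nu>1 \<Otimes>\<^sub>M \<mu>))"
  proof (rule norm_integral_le_integral)
    fix p
    have "norm (coeff x y p * u p - coeff x y p * v p) = norm (coeff x y p) * norm (u p - v p)"
      by (simp add: norm_mult[symmetric] right_diff_distrib)
    also have "\<dots> \<le> norm (coeff x y p) * (C * weight p)" by (intro mult_left_mono d) simp
    finally show "norm (coeff x y p * u p - coeff x y p * v p) \<le> C * (weight p * norm (coeff x y p))"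
      by (simp add: mult_ac)
  qed (use iu iv integrable_weight_coeff[OF assms(1)] in auto)
  finally show ?thesis by simp
qed

lemma gpow_count_real:
  assumes "x > 0"
  shows "gpow \<nu>1 of_nat (\<lambda>j. of_real (f j) * of_real (p j)) x \<in> \<real>"
proof -
  have "gpow \<nu>1 of_nat (\<lambda>j. of_real (f j) * of_real (p j)) x =
      (\<integral>j. of_real (f j * p j * exp (real j * ln x)) \<partial>\<nu>1)"
    unfolding gpow_def by (intro Bochner_Integration.integral_cong) (auto simp: exp_of_real[symmetric])
  then show ?thesis by (simp only: integral_complex_of_real) simp
qed

text \<open>Taking real parts is not multiplicative in general; it is here because the factor from
  the series of \<open>F\<close> is real (\<open>gpow_count_real\<close>).\<close>

lemma gpow_product:
  assumes x: "x > 0" and okp: "gpow_ok \<nu>1 of_nat (\<lambda>j. of_real (f j) * of_real (p j))"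
    and okq: "gpow_ok \<mu> s (\<lambda>\<omega>. \<psi> \<omega> * q \<omega>)"
  shows "Re (gpow \<nu>1 of_nat (\<lambda>j. of_real (f j) * of_real (p j)) x) * Re (gpow \<mu> s (\<lambda>\<omega>. \<psi> \<omega> * q \<omega>) y) =
    Re (pairing x y (\<lambda>(j, \<omega>). of_real (p j) * q \<omega>))"
proof -
  let ?A = "gpow \<nu>1 of_nat (\<lambda>j. of_real (f j) * of_real (p j)) x"
  let ?B = "gpow \<mu> s (\<lambda>\<omega>. \<psi> \<omega> * q \<omega>) y"
  have "?A * ?B = (\<integral>(j, \<omega>). (of_real (f j) * of_real (p j) * exp (of_nat j * of_real (ln x))) *
      (\<psi> \<omega> * q \<omega> * exp (s \<omega> * of_real (ln y))) \<partial>(\<nu>1 \<Otimes>\<^sub>M \<mu>))"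
    unfolding gpow_def
    by (rule pair.integral_product_mult[symmetric]) (rule gpow_ok_integrable[OF okp] gpow_ok_integrable[OF okq])+
  also have "\<dots> = pairing x y (\<lambda>(j, \<omega>). of_real (p j) * q \<omega>)"
    unfolding pairing_def coeff_def using x
    by (intro Bochner_Integration.integral_cong) (auto simp: exp_of_nat_mult exp_of_real)
  finally have *: "?A * ?B = pairing x y (\<lambda>(j, \<omega>). of_real (p j) * q \<omega>)" .
  have "Im ?A = 0" using gpow_count_real[OF x] by (simp add: complex_is_Real_iff)
  then have "Re ?A * Re ?B = Re (?A * ?B)" by (simp only: times_complex.sel)
  then show ?thesis by (simp only: *)
qed

definition exponent_plus_1 :: "nat \<times> 'b \<Rightarrow> complex" where
  "exponent_plus_1 = (\<lambda>(j, \<omega>). s \<omega> + of_nat j + 1)"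

lemma exponent_plus_1_measurable [measurable]: "exponent_plus_1 \<in> borel_measurable (\<nu>1 \<Otimes>\<^sub>M \<mu>)"
  by (rule pair_measurable) (simp add: exponent_plus_1_def)

lemma norm_exponent_plus_1: "1 + \<sigma> \<le> norm (exponent_plus_1 p)" and exponent_plus_1_nonzero: "exponent_plus_1 p \<noteq> 0"
proof -
  obtain j \<omega> where p: "p = (j, \<omega>)" by (cases p)
  have "1 + \<sigma> \<le> Re (exponent_plus_1 p)" using Re_s[of \<omega>] by (simp add: exponent_plus_1_def p)
  also have "\<dots> \<le> norm (exponent_plus_1 p)" by (rule complex_Re_le_cmod)
  finally show "1 + \<sigma> \<le> norm (exponent_plus_1 p)" .
  then show "exponent_plus_1 p \<noteq> 0" using \<sigma> by auto
qed

lemma norm_divide_exponent_le: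
  assumes "norm z \<le> C * weight p"
  shows "norm (z / exponent_plus_1 p) \<le> C / (1 + \<sigma>) * weight p"
proof -
  have "norm (z / exponent_plus_1 p) \<le> (C * weight p) / (1 + \<sigma>)"
    unfolding norm_divide using assms norm_exponent_plus_1[of p] \<sigma> by (intro frac_le) (auto intro: order_trans[OF norm_ge_zero])
  then show ?thesis by simp
qed

text \<open>Replacing (x, y) by (xt, yt) multiplies \<open>coeff\<close> by t^(s+j), and Fubini
  moves the integral over \<open>t\<close> inside. For t <= 1 one has |t^(s+j)| <= t^\<sigma>
  because Re s + j >= \<sigma>, and \<sigma> > -1 makes this majorant integrable.\<close>

lemma set_integral_pairing:
  assumes x: "x > 0" "y > 0" and u [measurable]: "u \<in> borel_measurable (\<nu>1 \<Otimes>\<^sub>M \<mu>)"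
    and bound: "\<And>p. norm (u p) \<le> C * weight p"
    and H: "\<And>t. t > 0 \<Longrightarrow> H t = Re (pairing (x * t) (y * t) u)"
  shows "(LBINT t:{0..1}. H t) = Re (pairing x y (\<lambda>p. u p / exponent_plus_1 p))"
proof -
  define E where "E = (\<lambda>t p. exp ((exponent_plus_1 p - 1) * of_real (ln t)))"
  have E: "case_prod E \<in> borel_measurable (lborel \<Otimes>\<^sub>M (\<nu>1 \<Otimes>\<^sub>M \<mu>))"
    unfolding E_def by measurable
  note [measurable] = E
  have coeff_t: "coeff (x * t) (y * t) p = coeff x y p * E t p" if "t > 0" for t p
  proof -
    have "complex_of_real t ^ j = exp (of_nat j * of_real (ln t))" for j
      using that by (simp add: exp_of_nat_mult exp_of_real)
    then show ?thesis using that x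
      by (cases p) (simp add: coeff_def E_def exponent_plus_1_def ln_mult_pos ring_distribs exp_add power_mult_distrib)
  qed
  define K where "K = (\<lambda>t p. indicator {0<..1} t *\<^sub>R (coeff x y p * u p * E t p))"
  have intc: "integrable (\<nu>1 \<Otimes>\<^sub>M \<mu>) (\<lambda>p. coeff x y p * u p)"
    by (rule integrable_coeff[OF x(1) u bound])
  have K_int: "integrable (lborel \<Otimes>\<^sub>M (\<nu>1 \<Otimes>\<^sub>M \<mu>)) (case_prod K)"
  proof (rule Bochner_Integration.integrable_bound)
    have "integrable lborel (\<lambda>t. indicator {0<..1} t *\<^sub>R (t powr \<sigma>))"
      using set_integrable_powr_Ioc[OF \<sigma>] by (simp add: set_integrable_def)
    from lborel_pair.integrable_product_mult[OF this integrable_norm[OF intc]]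
    show "integrable (lborel \<Otimes>\<^sub>M (\<nu>1 \<Otimes>\<^sub>M \<mu>)) (\<lambda>(t, p). indicator {0<..1} t *\<^sub>R (t powr \<sigma>) * norm (coeff x y p * u p))" .
    show "case_prod K \<in> borel_measurable (lborel \<Otimes>\<^sub>M (\<nu>1 \<Otimes>\<^sub>M \<mu>))"
      unfolding K_def by measurable
    show "AE z in lborel \<Otimes>\<^sub>M (\<nu>1 \<Otimes>\<^sub>M \<mu>). norm (case_prod K z) \<le>
        norm (case z of (t, p) \<Rightarrow> indicator {0<..1} t *\<^sub>R (t powr \<sigma>) * norm (coeff x y p * u p))"
    proof (rule AE_I2)
      fix z :: "real \<times> nat \<times> 'b"
      obtain t j \<omega> where z: "z = (t, (j, \<omega>))" by (cases z) auto
      show "norm (case_prod K z) \<le>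
        norm (case z of (t, p) \<Rightarrow> indicator {0<..1} t *\<^sub>R (t powr \<sigma>) * norm (coeff x y p * u p))"
      proof (cases "t \<in> {0<..1}")
        case True
        have "norm (E t (j, \<omega>)) = exp ((Re (s \<omega>) + real j) * ln t)"
          by (simp add: E_def exponent_plus_1_def)
        also have "\<dots> \<le> exp (\<sigma> * ln t)"
          using True Re_s[of \<omega>] by (intro exp_le_cancel_iff[THEN iffD2] mult_right_mono_neg) auto
        also have "\<dots> = t powr \<sigma>" using True by (simp add: powr_def)
        finally have "norm (E t (j, \<omega>)) \<le> t powr \<sigma>" .
        then have "norm (coeff x y (j, \<omega>) * u (j, \<omega>)) * norm (E t (j, \<omega>)) \<le> norm (coeff x y (j, \<omega>) * u (j, \<omega>)) * t powr \<sigma>"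
          by (intro mult_left_mono) auto
        then show ?thesis using True by (simp add: z K_def norm_mult mult_ac)
      qed (simp add: z K_def)
    qed
  qed
  have "(LBINT t:{0..1}. H t) = (\<integral>t. Re (\<integral>p. K t p \<partial>(\<nu>1 \<Otimes>\<^sub>M \<mu>)) \<partial>lborel)"
    unfolding set_lebesgue_integral_def
  proof (rule integral_cong_AE)
    have "(\<lambda>t. \<integral>p. K t p \<partial>(\<nu>1 \<Otimes>\<^sub>M \<mu>)) \<in> borel_measurable lborel"
      by (rule borel_measurable_integrable[OF lborel_pair.integrable_fst[OF K_int]])
    then show K_meas: "(\<lambda>t. Re (\<integral>p. K t p \<partial>(\<nu>1 \<Otimes>\<^sub>M \<mu>))) \<in> borel_measurable lborel" by measurable
    have eq: "indicator {0..1} t *\<^sub>R H t = Re (\<integral>p. K t p \<partial>(\<nu>1 \<Otimes>\<^sub>M \<mu>))" if "t \<noteq> 0" for t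
    proof (cases "t \<in> {0<..1}")
      case True
      then have "t > 0" by simp
      then have "(\<lambda>p. coeff (x * t) (y * t) p * u p) = (\<lambda>p. coeff x y p * u p * E t p)"
        using coeff_t by (auto simp: mult.assoc mult.commute[of "u _"])
      then have "H t = Re (\<integral>p. coeff x y p * u p * E t p \<partial>(\<nu>1 \<Otimes>\<^sub>M \<mu>))"
        unfolding H[OF \<open>t > 0\<close>] pairing_def by (simp only:)
      then show ?thesis using True by (simp add: K_def)
    qed (use that in \<open>auto simp: K_def indicator_def\<close>)
    then show "AE t in lborel. indicator {0..1} t *\<^sub>R H t = Re (\<integral>p. K t p \<partial>(\<nu>1 \<Otimes>\<^sub>M \<mu>))"
      by (intro AE_I[where N = "{0}"]) auto
    \<comment> \<open>Nothing is known about \<open>H 0\<close>, which is whatever the operators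
      return at t = 0. Isolating that single value gives measurability of the integrand without any
      assumption on it.\<close>
    have "(\<lambda>t. if t = 0 then H 0 else Re (\<integral>p. K t p \<partial>(\<nu>1 \<Otimes>\<^sub>M \<mu>))) \<in> borel_measurable lborel"
      using K_meas by (intro measurable_If) auto
    also have "(\<lambda>t. if t = 0 then H 0 else Re (\<integral>p. K t p \<partial>(\<nu>1 \<Otimes>\<^sub>M \<mu>))) = (\<lambda>t. indicator {0..1} t *\<^sub>R H t)"
      using eq by auto
    finally show "(\<lambda>t. indicator {0..1} t *\<^sub>R H t) \<in> borel_measurable lborel" .
  qed
  also have "\<dots> = Re (\<integral>t. (\<integral>p. K t p \<partial>(\<nu>1 \<Otimes>\<^sub>M \<mu>)) \<partial>lborel)"
    by (rule integral_Re[OF lborel_pair.integrable_fst[OF K_int]])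
  also have "(\<integral>t. (\<integral>p. K t p \<partial>(\<nu>1 \<Otimes>\<^sub>M \<mu>)) \<partial>lborel) = (\<integral>p. (\<integral>t. K t p \<partial>lborel) \<partial>(\<nu>1 \<Otimes>\<^sub>M \<mu>))"
    by (rule lborel_pair.Fubini_integral[OF K_int, symmetric])
  also have "\<dots> = pairing x y (\<lambda>p. u p / exponent_plus_1 p)"
    unfolding pairing_def
  proof (rule Bochner_Integration.integral_cong[OF refl])
    fix p :: "nat \<times> 'b"
    obtain j \<omega> where p: "p = (j, \<omega>)" by (cases p)
    have "(\<integral>t. K t p \<partial>lborel) = coeff x y p * u p * (LINT t:{0<..1}|lborel. exp ((exponent_plus_1 p - 1) * of_real (ln t)))"
      unfolding K_def E_def set_lebesgue_integral_def
      by (simp only: mult_scaleR_right[symmetric] integral_mult_right_zero)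
    also have "(LINT t:{0<..1}|lborel. exp ((exponent_plus_1 p - 1) * of_real (ln t))) = 1 / (exponent_plus_1 p - 1 + 1)"
      using Re_s[of \<omega>] \<sigma> by (intro exp_mult_ln_Ioc_integral) (simp add: p exponent_plus_1_def)
    finally show "(\<integral>t. K t p \<partial>lborel) = coeff x y p * (u p / exponent_plus_1 p)" by simp
  qed
  finally show ?thesis .
qed

section \<open>The finite-N kernel in closed form\<close>

definition falling :: "nat \<Rightarrow> nat \<Rightarrow> real" where
  "falling N j = (\<Prod>k=1..j. (1 - real k / real N))"

definition kernel_symbol :: "nat \<Rightarrow> nat \<times> 'b \<Rightarrow> complex" where
  "kernel_symbol N = (\<lambda>(j, \<omega>). of_real (falling N j) * gamma_ratio N (s \<omega>))"

lemma kernel_symbol_measurable [measurable]: "kernel_symbol N \<in> borel_measurable (\<nu>1 \<Otimes>\<^sub>M \<mu>)"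
  by (rule pair_measurable) (simp add: kernel_symbol_def)

lemma kernel_symbol_bound:
  assumes "N \<ge> 1"
  shows "norm (kernel_symbol N p) \<le> 1 * weight p"
proof -
  obtain j \<omega> where p: "p = (j, \<omega>)" by (cases p)
  have "norm (kernel_symbol N p) \<le> 1 * (1 + Gamma (2 + Re (s \<omega>)))"
    unfolding p kernel_symbol_def split norm_mult norm_of_real falling_def
    using falling_product_expansion(1)[OF assms] norm_gamma_ratio_le[OF _ assms, of "s \<omega>"] Re_s[of \<omega>] \<sigma>
    by (intro mult_mono) auto
  also have "\<dots> \<le> ((1 + real j) ^ 8 * (1 + norm (s \<omega>)) ^ 8) * (1 + Gamma (2 + Re (s \<omega>)))"
    using Gamma_weight_ge_1[of \<omega>] mult_mono[of 1 "(1 + real j) ^ 8" 1 "(1 + norm (s \<omega>)) ^ 8"]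
    by (intro mult_right_mono) auto
  finally show ?thesis by (simp add: p weight_def mult_ac)
qed

text \<open>The factors n! and the moments \<open>mellin w (real n + 1)\<close> cancel between
  \<open>polya_p\<close> and \<open>polya_q\<close>. After exchanging the sums over n and j <= n,
  the inner sum over n is closed by \<open>sum_pochhammer_over_fact\<close>. The scaling by 1/N then
  supplies the powers of N: y/N completes \<open>gamma_ratio\<close>, and x/N completes
  \<open>falling\<close>.\<close>

lemma scaled_kernel_eq_pairing:
  assumes N: "N \<ge> 1" and x: "x > 0" and y: "y > 0" and \<gamma>: "\<gamma> \<noteq> 0"
  shows "1 / real N * polya_kernel w N (x / real N) (y / real N) =
    1 / \<gamma> * Re (pairing x y (\<lambda>p. kernel_symbol N p / exponent_plus_1 p))"
proof -
  define X where "X = x / real N"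
  define Y where "Y = y / real N"
  have N0: "real N > 0" using N by simp
  have Y: "Y > 0" using y N0 by (simp add: Y_def)
  define k where "k = (\<lambda>n \<omega>. \<psi> \<omega> * Gamma (1 + s \<omega>) * pochhammer (1 + s \<omega>) n)"
  have okk: "gpow_ok \<mu> s (k n)" for n
  proof (induction n)
    case 0
    show ?case using gpow_ok_\<psi>_Gamma by (simp add: k_def)
  next
    case (Suc n)
    have "k (Suc n) = (\<lambda>\<omega>. k n \<omega> * (s \<omega> + (1 + of_nat n)))"
      by (simp add: k_def pochhammer_Suc add_ac mult_ac)
    then show ?case using gpow_ok_mult_exponent_add[OF Suc] by simp
  qed
  have pq: "polya_p w n X * polya_q w n Y = 1 / \<gamma> * (\<Sum>j=0..n. f j * X ^ j / fact (n - j) * Re (gpow \<mu> s (k n) Y))" for n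
  proof -
    have q: "polya_q w n Y = 1 / (fact n * mellin w (real n + 1)) * ((- 1) ^ n * (1 / \<gamma>) * Re (gpow \<mu> s (k n) Y))"
      unfolding polya_q_def k_def
      by (subst higher_deriv_power_times_gpow[OF gpow_ok_\<psi>_Gamma w_eq Y]) simp_all
    have "(- X) ^ j / (fact j * fact (n - j) * mellin w (real j + 1)) = f j * X ^ j / fact (n - j)" for j
      by (simp add: f_eq power_minus[of X] field_simps)
    then have p: "polya_p w n X = (- 1) ^ n * fact n * mellin w (real n + 1) * (\<Sum>j=0..n. f j * X ^ j / fact (n - j))"
      by (simp add: polya_p_def)
    have "polya_p w n X * polya_q w n Y = ((- 1) ^ n * (- 1) ^ n) * (1 / \<gamma> * ((\<Sum>j=0..n. f j * X ^ j / fact (n - j)) * Re (gpow \<mu> s (k n) Y)))"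
      unfolding p q using mellin_nonzero[of n] by (simp add: field_simps)
    also have "(- 1) ^ n * (- 1) ^ n = (1 :: real)" by (simp add: power_mult_distrib[symmetric])
    finally show ?thesis by (simp add: sum_distrib_right)
  qed
  have "polya_kernel w N X Y = (\<Sum>n<N. 1 / \<gamma> * (\<Sum>j=0..n. f j * X ^ j / fact (n - j) * Re (gpow \<mu> s (k n) Y)))"
    by (simp add: polya_kernel_def pq)
  also have "\<dots> = 1 / \<gamma> * (\<Sum>n<N. \<Sum>j=0..n. f j * X ^ j / fact (n - j) * Re (gpow \<mu> s (k n) Y))"
    by (simp only: sum_distrib_left)
  also have "(\<Sum>n<N. \<Sum>j=0..n. f j * X ^ j / fact (n - j) * Re (gpow \<mu> s (k n) Y)) =
      (\<Sum>n<N. \<Sum>j\<in>{j\<in>{..<N}. j \<le> n}. f j * X ^ j / fact (n - j) * Re (gpow \<mu> s (k n) Y))"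
    by (intro sum.cong refl) auto
  also have "\<dots> = (\<Sum>j<N. \<Sum>n\<in>{n\<in>{..<N}. j \<le> n}. f j * X ^ j / fact (n - j) * Re (gpow \<mu> s (k n) Y))"
    by (rule sum.swap_restrict) auto
  also have "\<dots> = (\<Sum>j<N. real N * Re (\<integral>\<omega>. coeff x y (j, \<omega>) * (kernel_symbol N (j, \<omega>) / exponent_plus_1 (j, \<omega>)) \<partial>\<mu>))"
  proof (rule sum.cong[OF refl])
    fix j assume "j \<in> {..<N}"
    then have j: "j < N" by simp
    have "(\<Sum>n\<in>{n\<in>{..<N}. j \<le> n}. f j * X ^ j / fact (n - j) * Re (gpow \<mu> s (k n) Y)) =
        f j * X ^ j * (\<Sum>n=j..<N. Re (gpow \<mu> s (k n) Y) / fact (n - j))"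
      by (subst sum_distrib_left) (intro sum.cong, auto)
    also have "(\<Sum>n=j..<N. Re (gpow \<mu> s (k n) Y) / fact (n - j)) = Re (\<Sum>n=j..<N. gpow \<mu> s (k n) Y / fact (n - j))"
      by (simp add: Re_divide_fact)
    also have "(\<Sum>n=j..<N. gpow \<mu> s (k n) Y / fact (n - j)) =
        (\<integral>\<omega>. (\<Sum>n=j..<N. k n \<omega> * exp (s \<omega> * of_real (ln Y)) / fact (n - j)) \<partial>\<mu>)"
      unfolding gpow_def using gpow_ok_integrable[OF okk]
      by (subst Bochner_Integration.integral_sum) auto
    also have "f j * X ^ j * Re (\<integral>\<omega>. (\<Sum>n=j..<N. k n \<omega> * exp (s \<omega> * of_real (ln Y)) / fact (n - j)) \<partial>\<mu>) =
      Re (\<integral>\<omega>. of_real (f j * X ^ j) * (\<Sum>n=j..<N. k n \<omega> * exp (s \<omega> * of_real (ln Y)) / fact (n - j)) \<partial>\<mu>)"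
      by simp
    also have "(\<lambda>\<omega>. of_real (f j * X ^ j) * (\<Sum>n=j..<N. k n \<omega> * exp (s \<omega> * of_real (ln Y)) / fact (n - j))) =
       (\<lambda>\<omega>. of_real (real N) * (coeff x y (j, \<omega>) * (kernel_symbol N (j, \<omega>) / exponent_plus_1 (j, \<omega>))))"
    proof
      fix \<omega>
      define e where "e = s \<omega> + of_nat j + 1"
      have e: "e \<noteq> 0" using exponent_plus_1_nonzero[of "(j, \<omega>)"] by (simp add: exponent_plus_1_def e_def)
      have "(\<Sum>n=j..<N. pochhammer (1 + s \<omega>) n / fact (n - j)) = pochhammer (1 + s \<omega>) N / (fact (N - 1 - j) * e)"
        using sum_pochhammer_over_fact[of "s \<omega>" j "N - 1 - j"] e j by (simp add: e_def)
      moreover have "(\<Sum>n=j..<N. k n \<omega> * exp (s \<omega> * of_real (ln Y)) / fact (n - j)) =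
          \<psi> \<omega> * Gamma (1 + s \<omega>) * exp (s \<omega> * of_real (ln Y)) * (\<Sum>n=j..<N. pochhammer (1 + s \<omega>) n / fact (n - j))"
        unfolding sum_distrib_left by (intro sum.cong refl) (simp add: k_def)
      ultimately have "(\<Sum>n=j..<N. k n \<omega> * exp (s \<omega> * of_real (ln Y)) / fact (n - j)) =
          \<psi> \<omega> * Gamma (1 + s \<omega>) * exp (s \<omega> * of_real (ln Y)) * (pochhammer (1 + s \<omega>) N / (fact (N - 1 - j) * e))"
        by (simp only:)
      moreover have EY: "exp (s \<omega> * of_real (ln Y)) = exp (s \<omega> * of_real (ln y)) * exp (- s \<omega> * of_real (ln (real N)))"
        using y N0 by (simp add: Y_def ln_div right_diff_distrib exp_diff exp_minus field_simps)
      ultimately have S: "(\<Sum>n=j..<N. k n \<omega> * exp (s \<omega> * of_real (ln Y)) / fact (n - j)) =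
          \<psi> \<omega> * exp (s \<omega> * of_real (ln y)) * gamma_ratio N (s \<omega>) / e * (fact N / fact (N - 1 - j))"
        by (simp add: gamma_ratio_def mult_ac)
      \<comment> \<open>The N! introduced to complete \<open>gamma_ratio\<close> combines with X^j =
        x^j / N^j into the falling product, with one factor N left over that cancels the prefactor
        1/N of the kernel.\<close>
      have "fact N = real N * fact (N - 1)" using N by (subst fact_reduce) auto
      then have "X ^ j * (fact N / fact (N - 1 - j)) = real N * (x ^ j * falling N j)"
        unfolding falling_def prod_eq_fact_ratio[OF j] X_def using N0 by (simp add: power_divide field_simps)
      then have "complex_of_real (X ^ j * (fact N / fact (N - 1 - j))) = of_real (real N * (x ^ j * falling N j))" by (rule arg_cong)
      then have XN: "of_real (X ^ j) * (fact N / fact (N - 1 - j)) = complex_of_real (real N) * (of_real (x ^ j) * of_real (falling N j))"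
        by simp
      have "of_real (f j * X ^ j) * (\<psi> \<omega> * exp (s \<omega> * of_real (ln y)) * gamma_ratio N (s \<omega>) / e * (fact N / fact (N - 1 - j))) =
        of_real (f j) * (\<psi> \<omega> * exp (s \<omega> * of_real (ln y)) * gamma_ratio N (s \<omega>) / e) * (of_real (X ^ j) * (fact N / fact (N - 1 - j)))"
        by (simp only: of_real_mult mult_ac)
      also have "\<dots> = of_real (real N) * (coeff x y (j, \<omega>) * (kernel_symbol N (j, \<omega>) / exponent_plus_1 (j, \<omega>)))"
        unfolding XN by (simp add: coeff_def kernel_symbol_def exponent_plus_1_def e_def)
      finally show "of_real (f j * X ^ j) * (\<Sum>n=j..<N. k n \<omega> * exp (s \<omega> * of_real (ln Y)) / fact (n - j)) =
          of_real (real N) * (coeff x y (j, \<omega>) * (kernel_symbol N (j, \<omega>) / exponent_plus_1 (j, \<omega>)))"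
        unfolding S .
    qed
    finally show "(\<Sum>n\<in>{n\<in>{..<N}. j \<le> n}. f j * X ^ j / fact (n - j) * Re (gpow \<mu> s (k n) Y)) =
        real N * Re (\<integral>\<omega>. coeff x y (j, \<omega>) * (kernel_symbol N (j, \<omega>) / exponent_plus_1 (j, \<omega>)) \<partial>\<mu>)"
      by (simp only: integral_mult_right_zero) simp
  qed
  also have "\<dots> = real N * Re (\<Sum>j<N. \<integral>\<omega>. coeff x y (j, \<omega>) * (kernel_symbol N (j, \<omega>) / exponent_plus_1 (j, \<omega>)) \<partial>\<mu>)"
    by (simp add: sum_distrib_left)
  also have "(\<Sum>j<N. \<integral>\<omega>. coeff x y (j, \<omega>) * (kernel_symbol N (j, \<omega>) / exponent_plus_1 (j, \<omega>)) \<partial>\<mu>) =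
     pairing x y (\<lambda>p. kernel_symbol N p / exponent_plus_1 p)"
  proof -
    define g where "g = (\<lambda>j. \<integral>\<omega>. coeff x y (j, \<omega>) * (kernel_symbol N (j, \<omega>) / exponent_plus_1 (j, \<omega>)) \<partial>\<mu>)"
    have int: "integrable (\<nu>1 \<Otimes>\<^sub>M \<mu>) (\<lambda>p. coeff x y p * (kernel_symbol N p / exponent_plus_1 p))"
      by (rule integrable_coeff[OF x _ norm_divide_exponent_le[OF kernel_symbol_bound[OF N]]]) measurable
    have "pairing x y (\<lambda>p. kernel_symbol N p / exponent_plus_1 p) = (\<integral>j. g j \<partial>\<nu>1)"
      unfolding pairing_def g_def by (rule pair.integral_fst'[OF int, symmetric])
    also have "\<dots> = (\<Sum>j. g j)"
      unfolding g_def by (rule integral_count_space_nat[OF pair.integrable_fst'[OF int]])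
    also have "\<dots> = (\<Sum>j<N. g j)"
    proof (rule suminf_finite)
      \<comment> \<open>The factor k = N of the product vanishes, so the finite sum over degrees
        equals the full series.\<close>
      fix j assume "j \<notin> {..<N}"
      then have "falling N j = 0"
        unfolding falling_def using N by (auto intro!: prod_zero bexI[of _ N])
      then show "g j = 0" by (simp add: g_def kernel_symbol_def)
    qed simp
    finally show ?thesis by (simp add: g_def)
  qed
  finally have "polya_kernel w N X Y = 1 / \<gamma> * (real N * Re (pairing x y (\<lambda>p. kernel_symbol N p / exponent_plus_1 p)))" .
  then show ?thesis using N0 by (simp add: X_def Y_def)
qed

section \<open>Symbols of the two expansions and the comparison\<close>

definition correction_symbol :: "nat \<Rightarrow> nat \<times> 'b \<Rightarrow> complex" where
  "correction_symbol N = (\<lambda>(j, \<omega>). of_real (1 + - (1 / (2 * real N)) * (real j * (real j + 1))) *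
     (1 + of_real (1 / (2 * real N)) * (s \<omega> * (s \<omega> + 1))))"

text \<open>In contrast to \<open>kernel_symbol\<close> and \<open>correction_symbol\<close>, this
  already includes the division by s + j + 1. In the term of order 1/N the denominator has cancelled
  against the factor s + j + 1 of s(s+1) - j(j+1), which is why no integral over \<open>t\<close> is
  left there.\<close>

definition simpler_symbol :: "nat \<Rightarrow> nat \<times> 'b \<Rightarrow> complex" where
  "simpler_symbol N = (\<lambda>(j, \<omega>). 1 / exponent_plus_1 (j, \<omega>) - of_real (1 / (2 * real N)) * (of_nat j - s \<omega>))"

lemma correction_symbol_measurable [measurable]: "correction_symbol N \<in> borel_measurable (\<nu>1 \<Otimes>\<^sub>M \<mu>)"
  by (rule pair_measurable) (simp add: correction_symbol_def)

lemma simpler_symbol_measurable [measurable]: "simpler_symbol N \<in> borel_measurable (\<nu>1 \<Otimes>\<^sub>M \<mu>)"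
  by (rule pair_measurable) (simp add: simpler_symbol_def exponent_plus_1_def)

lemma norm_s_mult_le: "norm (s \<omega> * (s \<omega> + 1)) \<le> (1 + norm (s \<omega>)) ^ 2"
proof -
  have "norm (s \<omega> * (s \<omega> + 1)) \<le> (1 + norm (s \<omega>)) * (1 + norm (s \<omega>))"
    unfolding norm_mult using norm_triangle_ineq[of "s \<omega>" 1] by (intro mult_mono) auto
  then show ?thesis by (simp add: power2_eq_square)
qed

lemma norm_correction_factor_le:
  assumes "N \<ge> 1"
  shows "norm (1 + of_real (1 / (2 * real N)) * (s \<omega> * (s \<omega> + 1))) \<le> 2 * (1 + norm (s \<omega>)) ^ 2"
proof -
  have "norm (1 + of_real (1 / (2 * real N)) * (s \<omega> * (s \<omega> + 1))) \<le> 1 + 1 / (2 * real N) * norm (s \<omega> * (s \<omega> + 1))"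
    by (rule order_trans[OF norm_triangle_ineq]) (simp add: norm_mult norm_divide)
  also have "\<dots> \<le> 1 + 1 * (1 + norm (s \<omega>)) ^ 2"
    using assms norm_s_mult_le by (intro add_left_mono mult_mono) auto
  also have "\<dots> \<le> 2 * (1 + norm (s \<omega>)) ^ 2"
    using one_le_power[of "1 + norm (s \<omega>)" 2] by simp
  finally show ?thesis .
qed

lemma correction_symbol_bound:
  assumes "N \<ge> 1"
  shows "norm (correction_symbol N p) \<le> 4 * weight p"
proof -
  obtain j \<omega> where p: "p = (j, \<omega>)" by (cases p)
  have jj: "real j * (real j + 1) \<le> (1 + real j) ^ 2" by (simp add: power2_eq_square algebra_simps)
  have "1 / (2 * real N) * (real j * (real j + 1)) \<le> 1 * (1 + real j) ^ 2"
    using assms jj by (intro mult_mono) auto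
  moreover have "0 \<le> 1 / (2 * real N) * (real j * (real j + 1))" by simp
  moreover have "1 \<le> (1 + real j) ^ 2" by (intro one_le_power) simp
  ultimately have 1: "\<bar>1 + - (1 / (2 * real N)) * (real j * (real j + 1))\<bar> \<le> 2 * (1 + real j) ^ 2"
    by linarith
  have "norm (correction_symbol N p) \<le> (2 * (1 + real j) ^ 2) * (2 * (1 + norm (s \<omega>)) ^ 2)"
    unfolding p correction_symbol_def split norm_mult[of "of_real _"] norm_of_real
    using 1 norm_correction_factor_le[OF assms] by (intro mult_mono) auto
  also have "\<dots> \<le> 4 * weight p"
    using poly_le_weight[of 2 2 j \<omega>] by (simp add: p)
  finally show ?thesis .
qed

lemma simpler_symbol_bound:
  assumes "N \<ge> 1"
  shows "norm (simpler_symbol N p) \<le> (1 / (1 + \<sigma>) + 2) * weight p"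
proof -
  obtain j \<omega> where p: "p = (j, \<omega>)" by (cases p)
  have "norm (1 / exponent_plus_1 p) \<le> 1 / (1 + \<sigma>) * weight p"
    using norm_divide_exponent_le[of 1 1 p] weight_ge_1[of p] by simp
  moreover have "norm (of_real (1 / (2 * real N)) * (of_nat j - s \<omega>)) \<le> 2 * weight p"
  proof -
    have "norm (of_nat j - s \<omega>) \<le> real j + norm (s \<omega>)"
      using norm_triangle_ineq4[of "of_nat j" "s \<omega>"] by simp
    moreover have "real j \<le> weight p" "norm (s \<omega>) \<le> weight p"
      using poly_le_weight[of 1 0 j \<omega>] poly_le_weight[of 0 1 j \<omega>] by (simp_all add: p)
    ultimately have "norm (of_nat j - s \<omega>) \<le> 2 * weight p" by linarith
    then have "1 / (2 * real N) * norm (of_nat j - s \<omega>) \<le> 1 * (2 * weight p)"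
      using assms by (intro mult_mono) auto
    then show ?thesis by (simp add: norm_mult norm_divide)
  qed
  ultimately show ?thesis
    using norm_triangle_ineq4[of "1 / exponent_plus_1 p" "of_real (1 / (2 * real N)) * (of_nat j - s \<omega>)"]
    by (simp add: simpler_symbol_def p ring_distribs)
qed

lemma F_eq_gpow: "u > 0 \<Longrightarrow> F u = Re (gpow \<nu>1 of_nat (\<lambda>j. of_real (f j)) u)"
proof -
  assume u: "u > 0"
  have "gpow \<nu>1 of_nat (\<lambda>j. of_real (f j)) u = (\<Sum>j. complex_of_real (f j) * exp (of_nat j * of_real (ln u)))"
    unfolding gpow_def by (rule integral_count_space_nat[OF gpow_ok_integrable[OF gpow_ok_f]])
  also have "(\<lambda>j. complex_of_real (f j) * exp (of_nat j * of_real (ln u))) = (\<lambda>j. of_real (f j * u ^ j))"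
    using u by (auto simp: exp_of_nat_mult exp_of_real)
  also have "(\<Sum>j. complex_of_real (f j * u ^ j)) = of_real (\<Sum>j. f j * u ^ j)"
  proof (rule suminf_of_real[symmetric])
    have "summable (\<lambda>j. \<bar>f j * u ^ j\<bar>)"
      using f_summable[of 0 "ln u"] u by (simp add: exp_of_nat_mult abs_mult mult_ac)
    then show "summable (\<lambda>j. f j * u ^ j)" by (rule summable_rabs_cancel)
  qed
  finally show ?thesis by (simp add: F_eq)
qed

lemma hard_edge_expansion_eq_pairing:
  assumes N: "N \<ge> 1" and x: "x > 0" and y: "y > 0"
  shows "hard_edge_expansion F G x y N = Re (pairing x y (\<lambda>p. correction_symbol N p / exponent_plus_1 p))"
  unfolding hard_edge_expansion_def
proof (rule set_integral_pairing[OF x y _ correction_symbol_bound[OF N]])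
  define e where "e = 1 / (2 * real N)"
  fix t :: real assume t: "t > 0"
  define p where "p = (\<lambda>j::nat. 1 + - e * (real j * (real j + 1)))"
  define q where "q = (\<lambda>\<omega>. 1 + of_real e * (s \<omega> * (s \<omega> + 1)))"
  have p: "(\<lambda>j. of_real (f j) * (1 + of_real (- e) * (of_nat j * (of_nat j + 1)))) = (\<lambda>j. complex_of_real (f j) * of_real (p j))"
    by (simp add: p_def)
  have okp: "gpow_ok \<nu>1 of_nat (\<lambda>j. complex_of_real (f j) * of_real (p j))"
  proof (rule gpow_ok_mult[OF gpow_ok_f, where m = 2 and C = "1 + \<bar>e\<bar>"])
    fix j :: nat
    have "\<bar>p j\<bar> \<le> 1 + \<bar>e\<bar> * (real j * (real j + 1))"
      unfolding p_def by (rule order_trans[OF abs_triangle_ineq]) (simp add: abs_mult)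
    also have "\<dots> \<le> 1 * (1 + real j) ^ 2 + \<bar>e\<bar> * (1 + real j) ^ 2"
      by (intro add_mono mult_left_mono) (auto simp: power2_eq_square algebra_simps)
    finally show "norm (complex_of_real (p j)) \<le> (1 + \<bar>e\<bar>) * (1 + norm (of_nat j :: complex)) ^ 2"
      by (simp add: ring_distribs)
  qed simp
  have okq: "gpow_ok \<mu> s (\<lambda>\<omega>. \<psi> \<omega> * q \<omega>)"
    using norm_correction_factor_le[OF N]
    by (intro gpow_ok_mult[OF gpow_ok_\<psi>, where m = 2 and C = 2]) (auto simp: q_def e_def)
  have "correction_op (- e) (\<lambda>u. F (u * t)) x = Re (gpow \<nu>1 of_nat (\<lambda>j. of_real (f j) * of_real (p j)) (x * t))"
    unfolding p[symmetric] by (rule correction_op_gpow[OF gpow_ok_f F_eq_gpow x t])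
  moreover have "correction_op e (\<lambda>v. G (v * t)) y = Re (gpow \<mu> s (\<lambda>\<omega>. \<psi> \<omega> * q \<omega>) (y * t))"
    unfolding q_def by (rule correction_op_gpow[OF gpow_ok_\<psi> G_eq y t])
  ultimately have "correction_op (- e) (\<lambda>u. F (u * t)) x * correction_op e (\<lambda>v. G (v * t)) y =
      Re (pairing (x * t) (y * t) (\<lambda>(j, \<omega>). of_real (p j) * q \<omega>))"
    using gpow_product[OF mult_pos_pos[OF x t] okp okq] by simp
  then show "correction_op (- (1 / (2 * real N))) (\<lambda>u. F (u * t)) x * correction_op (1 / (2 * real N)) (\<lambda>v. G (v * t)) y =
      Re (pairing (x * t) (y * t) (correction_symbol N))"
    by (simp add: e_def p_def q_def correction_symbol_def)
qed measurable

lemma simpler_expansion_eq_pairing: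
  assumes N: "N \<ge> 1" and x: "x > 0" and y: "y > 0"
  shows "simpler_expansion F G x y N = Re (pairing x y (simpler_symbol N))"
proof -
  have okf: "gpow_ok \<nu>1 of_nat (\<lambda>j. of_real (f j) * of_real 1)"
    using gpow_ok_f by simp
  have ok1: "gpow_ok \<mu> s (\<lambda>\<omega>. \<psi> \<omega> * 1)" using gpow_ok_\<psi> by simp
  have okfj: "gpow_ok \<nu>1 of_nat (\<lambda>j. of_real (f j) * of_real (real j))"
    using gpow_ok_mult_exponent[OF gpow_ok_f] by simp
  have oks: "gpow_ok \<mu> s (\<lambda>\<omega>. \<psi> \<omega> * s \<omega>)" by (rule gpow_ok_mult_exponent[OF gpow_ok_\<psi>])
  have one: "norm (1::complex) \<le> 1 * weight p" for p using weight_ge_1[of p] by simp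
  have I: "(LBINT t:{0..1}. F (x * t) * G (y * t)) = Re (pairing x y (\<lambda>p. 1 / exponent_plus_1 p))"
  proof (rule set_integral_pairing[OF x y _ one])
    fix t :: real assume t: "t > 0"
    show "F (x * t) * G (y * t) = Re (pairing (x * t) (y * t) (\<lambda>_. 1))"
      using gpow_product[OF mult_pos_pos[OF x t] okf ok1] x y t
      by (simp add: F_eq_gpow G_eq case_prod_beta')
  qed measurable
  have dF: "(F has_real_derivative Re (gpow \<nu>1 of_nat (\<lambda>j. of_real (f j) * of_nat j) x) / x) (at x)"
    by (rule has_real_derivative_cong_pos[OF Re_gpow_has_real_derivative[OF gpow_ok_f x] x F_eq_gpow])
  have dG: "(G has_real_derivative Re (gpow \<mu> s (\<lambda>\<omega>. \<psi> \<omega> * s \<omega>) y) / y) (at y)"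
    by (rule has_real_derivative_cong_pos[OF Re_gpow_has_real_derivative[OF gpow_ok_\<psi> y] y G_eq])
  have "euler_op (\<lambda>u. F u * G y) x = Re (gpow \<nu>1 of_nat (\<lambda>j. of_real (f j) * of_real (real j)) x) * Re (gpow \<mu> s (\<lambda>\<omega>. \<psi> \<omega> * 1) y)"
    using DERIV_imp_deriv[OF DERIV_cmult_right[OF dF, of "G y"]] x y by (simp add: euler_op_def G_eq)
  then have E1: "euler_op (\<lambda>u. F u * G y) x = Re (pairing x y (\<lambda>(j, \<omega>). of_nat j))"
    using gpow_product[OF x okfj ok1] by simp
  have "euler_op (\<lambda>v. F x * G v) y = Re (gpow \<nu>1 of_nat (\<lambda>j. of_real (f j) * of_real 1) x) * Re (gpow \<mu> s (\<lambda>\<omega>. \<psi> \<omega> * s \<omega>) y)"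
    using DERIV_imp_deriv[OF DERIV_cmult[OF dG, of "F x"]] x y by (simp add: euler_op_def F_eq_gpow)
  then have E2: "euler_op (\<lambda>v. F x * G v) y = Re (pairing x y (\<lambda>(j, \<omega>). s \<omega>))"
    using gpow_product[OF x okf oks] by simp
  have m: "(\<lambda>(j, \<omega>). of_nat j) \<in> borel_measurable (\<nu>1 \<Otimes>\<^sub>M \<mu>)" "(\<lambda>(j, \<omega>). s \<omega>) \<in> borel_measurable (\<nu>1 \<Otimes>\<^sub>M \<mu>)"
    by (rule pair_measurable, simp)+
  have i0: "integrable (\<nu>1 \<Otimes>\<^sub>M \<mu>) (\<lambda>p. coeff x y p * (1 / exponent_plus_1 p))"
    by (rule integrable_coeff[OF x _ norm_divide_exponent_le[OF one]]) measurable
  have i1: "integrable (\<nu>1 \<Otimes>\<^sub>M \<mu>) (\<lambda>p. coeff x y p * (case p of (j, \<omega>) \<Rightarrow> of_nat j))"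
  proof (rule integrable_coeff[OF x m(1), where C = 1])
    show "norm (case p of (j, \<omega>) \<Rightarrow> complex_of_nat j) \<le> 1 * weight p" for p
      using poly_le_weight[of 1 0 "fst p" "snd p"] by (simp add: case_prod_beta')
  qed
  have i2: "integrable (\<nu>1 \<Otimes>\<^sub>M \<mu>) (\<lambda>p. coeff x y p * (case p of (j, \<omega>) \<Rightarrow> s \<omega>))"
  proof (rule integrable_coeff[OF x m(2), where C = 1])
    show "norm (case p of (j, \<omega>) \<Rightarrow> s \<omega>) \<le> 1 * weight p" for p
      using poly_le_weight[of 0 1 "fst p" "snd p"] by (simp add: case_prod_beta')
  qed
  have "pairing x y (simpler_symbol N) = (\<integral>p. coeff x y p * (1 / exponent_plus_1 p) -
      of_real (1 / (2 * real N)) * (coeff x y p * (case p of (j, \<omega>) \<Rightarrow> of_nat j) - coeff x y p * (case p of (j, \<omega>) \<Rightarrow> s \<omega>)) \<partial>(\<nu>1 \<Otimes>\<^sub>M \<mu>))"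
    unfolding pairing_def
    by (intro Bochner_Integration.integral_cong refl) (simp add: simpler_symbol_def case_prod_beta' algebra_simps diff_divide_distrib)
  also have "\<dots> = pairing x y (\<lambda>p. 1 / exponent_plus_1 p) -
      of_real (1 / (2 * real N)) * (pairing x y (\<lambda>(j, \<omega>). of_nat j) - pairing x y (\<lambda>(j, \<omega>). s \<omega>))"
    unfolding pairing_def
    by (subst Bochner_Integration.integral_diff[OF i0] integral_mult_right_zero Bochner_Integration.integral_diff[OF i1 i2] |
        intro integrable_mult_right Bochner_Integration.integrable_diff i1 i2 refl)+
  finally show ?thesis
    by (simp add: simpler_expansion_def I E1 E2)
qed

theorem hard_edge_expansions:
  assumes x: "x > 0" and y: "y > 0" and \<gamma>: "\<gamma> \<noteq> 0"
  shows "(\<lambda>N. 1 / real N * polya_kernel w N (x / real N) (y / real N) - 1 / \<gamma> * hard_edge_expansion F G x y N) \<in> O(\<lambda>N. 1 / real N ^ 2)"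
    and "(\<lambda>N. 1 / real N * polya_kernel w N (x / real N) (y / real N) - 1 / \<gamma> * simpler_expansion F G x y N) \<in> O(\<lambda>N. 1 / real N ^ 2)"
proof -
  define I where "I = (\<integral>p. weight p * norm (coeff x y p) \<partial>(\<nu>1 \<Otimes>\<^sub>M \<mu>))"
  define u where "u = (\<lambda>N p. kernel_symbol N p / exponent_plus_1 p)"
  define v where "v = (\<lambda>N p. correction_symbol N p / exponent_plus_1 p)"
  have uv: "norm (u N p - v N p) \<le> (20 / real N ^ 2) / (1 + \<sigma>) * weight p" if N: "N \<ge> 1" for N p
  proof -
    obtain j \<omega> where p: "p = (j, \<omega>)" by (cases p)
    define b where "b = falling N j"
    define B where "B = real (j * (j + 1)) / (2 * real N)"
    define R where "R = gamma_ratio N (s \<omega>)"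
    define S where "S = s \<omega> * (s \<omega> + 1) / (2 * of_nat N)"
    have b: "\<bar>b\<bar> \<le> 1" "\<bar>b - 1 + B\<bar> \<le> (1 + real j) ^ 4 / real N ^ 2"
      using falling_product_expansion[OF N, of j] by (simp_all add: b_def falling_def B_def)
    have R: "norm (R - 1 - S) \<le> 18 * (1 + Gamma (2 + Re (s \<omega>))) * (1 + norm (s \<omega>)) ^ 8 / real N ^ 2"
      unfolding R_def S_def by (rule gamma_ratio_expansion[OF _ N]) (use Re_s[of \<omega>] \<sigma> in simp)
    have S: "norm (1 + S) \<le> 2 * (1 + norm (s \<omega>)) ^ 2"
      using norm_correction_factor_le[OF N, of \<omega>] by (simp add: S_def)
    have "kernel_symbol N p - correction_symbol N p = of_real b * R - of_real (1 - B) * (1 + S)"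
      by (simp add: kernel_symbol_def correction_symbol_def p b_def R_def B_def S_def algebra_simps)
    \<comment> \<open>The difference of products is split so that each small error multiplies a
      bounded or polynomially growing factor: the exact \<open>b\<close>, and the truncated 1 + S.
      The constants 18 and 2 obtained below add up to 20.\<close>
    also have "\<dots> = of_real b * (R - 1 - S) + of_real (b - 1 + B) * (1 + S)"
      by (simp add: algebra_simps)
    also have "norm \<dots> \<le> \<bar>b\<bar> * norm (R - 1 - S) + \<bar>b - 1 + B\<bar> * norm (1 + S)"
      by (rule order_trans[OF norm_triangle_ineq]) (simp only: norm_mult norm_of_real order_refl)
    also have "\<dots> \<le> 1 * (18 * (1 + Gamma (2 + Re (s \<omega>))) * (1 + norm (s \<omega>)) ^ 8 / real N ^ 2) +
        (1 + real j) ^ 4 / real N ^ 2 * (2 * (1 + norm (s \<omega>)) ^ 2)"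
      by (intro add_mono mult_mono b R S) auto
    also have "\<dots> = (18 * ((1 + Gamma (2 + Re (s \<omega>))) * (1 + norm (s \<omega>)) ^ 8) + 2 * ((1 + real j) ^ 4 * (1 + norm (s \<omega>)) ^ 2)) / real N ^ 2"
    proof -
      have "1 * (18 * g * a / n) + b / n * (2 * c) = (18 * (g * a) + 2 * (b * c)) / n" for g a b c n :: real
        by (simp add: add_divide_distrib mult_ac)
      then show ?thesis .
    qed
    also have "\<dots> \<le> (18 * weight p + 2 * weight p) / real N ^ 2"
    proof (intro divide_right_mono add_mono mult_left_mono)
      have "1 * ((1 + norm (s \<omega>)) ^ 8 * (1 + Gamma (2 + Re (s \<omega>)))) \<le> weight p"
        unfolding p weight_def split using Gamma_weight_ge_1[of \<omega>] by (intro mult_right_mono one_le_power) auto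
      then show "(1 + Gamma (2 + Re (s \<omega>))) * (1 + norm (s \<omega>)) ^ 8 \<le> weight p" by (simp add: mult.commute)
      show "(1 + real j) ^ 4 * (1 + norm (s \<omega>)) ^ 2 \<le> weight p" unfolding p by (rule poly_le_weight) auto
    qed auto
    also have "\<dots> = 20 / real N ^ 2 * weight p" by simp
    finally have "norm (kernel_symbol N p - correction_symbol N p) \<le> 20 / real N ^ 2 * weight p" .
    from norm_divide_exponent_le[OF this] show ?thesis by (simp add: u_def v_def diff_divide_distrib)
  qed
  have vs: "norm (v N p - simpler_symbol N p) \<le> (1 / real N ^ 2) / (1 + \<sigma>) * weight p" if N: "N \<ge> 1" for N p
  proof -
    obtain j \<omega> where p: "p = (j, \<omega>)" by (cases p)
    define e where "e = exponent_plus_1 p"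
    define n where "n = complex_of_nat N"
    have e: "e \<noteq> 0" using exponent_plus_1_nonzero by (simp add: e_def)
    have n: "n \<noteq> 0" using N by (simp add: n_def)
    have ep: "e = s \<omega> + of_nat j + 1" by (simp add: e_def exponent_plus_1_def p)
    have "v N p - simpler_symbol N p = ((1 - of_nat j * (of_nat j + 1) / (2 * n)) * (1 + s \<omega> * (s \<omega> + 1) / (2 * n)) - 1 + (of_nat j - s \<omega>) * e / (2 * n)) / e"
      using e n by (simp add: v_def simpler_symbol_def correction_symbol_def p e_def[unfolded p, symmetric] n_def[symmetric] field_simps)
    \<comment> \<open>Since (j - s)(j + s + 1) = j(j+1) - s(s+1), all terms of order 1/N cancel, and
      only the product of the two corrections survives.\<close>
    also have "(1 - of_nat j * (of_nat j + 1) / (2 * n)) * (1 + s \<omega> * (s \<omega> + 1) / (2 * n)) - 1 + (of_nat j - s \<omega>) * e / (2 * n) =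
        - (of_nat j * (of_nat j + 1) * (s \<omega> * (s \<omega> + 1)) / (4 * n ^ 2))"
      using n unfolding ep by (simp add: field_simps power2_eq_square)
    finally have "v N p - simpler_symbol N p = - (of_nat j * (of_nat j + 1) * (s \<omega> * (s \<omega> + 1)) / (4 * n ^ 2)) / exponent_plus_1 p"
      by (simp add: e_def)
    moreover have "norm (- (of_nat j * (of_nat j + 1) * (s \<omega> * (s \<omega> + 1)) / (4 * n ^ 2))) \<le> 1 / real N ^ 2 * weight p"
    proof -
      have nj: "norm (of_nat j + 1 :: complex) = real j + 1"
        by (metis norm_of_nat of_nat_1 of_nat_add)
      have "real j * (real j + 1) * norm (s \<omega> * (s \<omega> + 1)) \<le> (1 + real j) ^ 2 * (1 + norm (s \<omega>)) ^ 2"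
        using norm_s_mult_le by (intro mult_mono) (auto simp: power2_eq_square algebra_simps)
      also have "\<dots> \<le> weight p" unfolding p by (rule poly_le_weight) auto
      finally have "real j * (real j + 1) * norm (s \<omega> * (s \<omega> + 1)) / (4 * real N ^ 2) \<le> weight p / (1 * real N ^ 2)"
        using weight_ge_1[of p] N by (intro frac_le) auto
      then show ?thesis unfolding norm_minus_cancel norm_divide norm_mult nj by (simp add: n_def norm_power norm_mult)
    qed
    ultimately show ?thesis using norm_divide_exponent_le by metis
  qed
  have meas [measurable]: "u N \<in> borel_measurable (\<nu>1 \<Otimes>\<^sub>M \<mu>)" "v N \<in> borel_measurable (\<nu>1 \<Otimes>\<^sub>M \<mu>)" for N
    unfolding u_def v_def by measurable
  have vb: "norm (v N p) \<le> 4 / (1 + \<sigma>) * weight p" if "N \<ge> 1" for N p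
    unfolding v_def by (rule norm_divide_exponent_le[OF correction_symbol_bound[OF that]])
  have Kuv: "1 / real N * polya_kernel w N (x / real N) (y / real N) = 1 / \<gamma> * Re (pairing x y (u N))"
    "hard_edge_expansion F G x y N = Re (pairing x y (v N))" if "N \<ge> 1" for N
    using scaled_kernel_eq_pairing[OF that x y \<gamma>] hard_edge_expansion_eq_pairing[OF that x y] by (simp_all add: u_def v_def)
  have 1: "norm (pairing x y (u N) - pairing x y (v N)) \<le> (20 / real N ^ 2) / (1 + \<sigma>) * I" if "N \<ge> 1" for N
    unfolding I_def by (rule pairing_diff_bound[OF x meas vb[OF that] uv[OF that]])
  have 2: "norm (pairing x y (v N) - pairing x y (simpler_symbol N)) \<le> (1 / real N ^ 2) / (1 + \<sigma>) * I" if "N \<ge> 1" for N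
    unfolding I_def by (rule pairing_diff_bound[OF x meas(2) simpler_symbol_measurable simpler_symbol_bound[OF that] vs[OF that]])
  have bound: "norm (1 / \<gamma> * Re a - 1 / \<gamma> * Re b) \<le> \<bar>1 / \<gamma>\<bar> * norm (a - b)" for a b
  proof -
    have "1 / \<gamma> * Re a - 1 / \<gamma> * Re b = 1 / \<gamma> * Re (a - b)" by (simp add: algebra_simps)
    then show ?thesis using abs_Re_le_cmod[of "a - b"] by (simp only: real_norm_def abs_mult mult_left_mono abs_ge_zero)
  qed
  show "(\<lambda>N. 1 / real N * polya_kernel w N (x / real N) (y / real N) - 1 / \<gamma> * hard_edge_expansion F G x y N) \<in> O(\<lambda>N. 1 / real N ^ 2)"
  proof (rule bigoI[where c = "\<bar>1 / \<gamma>\<bar> * (20 / (1 + \<sigma>) * I)"], rule eventually_mono[OF eventually_ge_at_top[of 1]])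
    fix N :: nat assume N: "N \<ge> 1"
    have "norm (1 / \<gamma> * Re (pairing x y (u N)) - 1 / \<gamma> * Re (pairing x y (v N))) \<le> \<bar>1 / \<gamma>\<bar> * ((20 / real N ^ 2) / (1 + \<sigma>) * I)"
      by (rule order_trans[OF bound]) (intro mult_left_mono 1 N, simp)
    also have "\<dots> = \<bar>1 / \<gamma>\<bar> * (20 / (1 + \<sigma>) * I) * norm (1 / real N ^ 2)" by simp
    finally show "norm (1 / real N * polya_kernel w N (x / real N) (y / real N) - 1 / \<gamma> * hard_edge_expansion F G x y N) \<le>
        \<bar>1 / \<gamma>\<bar> * (20 / (1 + \<sigma>) * I) * norm (1 / real N ^ 2)"
      unfolding Kuv[OF N] .
  qed
  show "(\<lambda>N. 1 / real N * polya_kernel w N (x / real N) (y / real N) - 1 / \<gamma> * simpler_expansion F G x y N) \<in> O(\<lambda>N. 1 / real N ^ 2)"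
  proof (rule bigoI[where c = "\<bar>1 / \<gamma>\<bar> * (21 / (1 + \<sigma>) * I)"], rule eventually_mono[OF eventually_ge_at_top[of 1]])
    fix N :: nat assume N: "N \<ge> 1"
    have "norm (pairing x y (u N) - pairing x y (simpler_symbol N)) \<le> (20 / real N ^ 2) / (1 + \<sigma>) * I + (1 / real N ^ 2) / (1 + \<sigma>) * I"
      by (rule norm_diff_triangle_le[OF 1[OF N] 2[OF N]])
    then have "norm (1 / \<gamma> * Re (pairing x y (u N)) - 1 / \<gamma> * Re (pairing x y (simpler_symbol N))) \<le>
        \<bar>1 / \<gamma>\<bar> * ((20 / real N ^ 2) / (1 + \<sigma>) * I + (1 / real N ^ 2) / (1 + \<sigma>) * I)"
      by (intro order_trans[OF bound] mult_left_mono) auto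
    also have "\<dots> = \<bar>1 / \<gamma>\<bar> * (21 / (1 + \<sigma>) * I) * norm (1 / real N ^ 2)"
      by (simp add: field_simps)
    finally show "norm (1 / real N * polya_kernel w N (x / real N) (y / real N) - 1 / \<gamma> * simpler_expansion F G x y N) \<le>
        \<bar>1 / \<gamma>\<bar> * (21 / (1 + \<sigma>) * I) * norm (1 / real N ^ 2)"
      unfolding Kuv[OF N] simpler_expansion_eq_pairing[OF N x y] .
  qed
qed

end

section \<open>The Gamma function on vertical lines\<close>

text \<open>The digamma function is the limit of ln m - sum of 1/(z+n), and Re 1/(z+n) =
  (\<sigma>+n) / ((\<sigma>+n)^2 + t^2). The first K terms are at most 1/|t| <= 1/K each, hence at
  most 1 together; the later ones are dominated by telescoping differences of logarithms. Only the
  lower bound \<open>p\<close> on \<sigma> enters, so the estimate is uniform to the right.\<close>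

lemma Re_Digamma_large:
  fixes L p :: real
  obtains T0 where "T0 \<ge> 1" "\<And>\<sigma> t. p \<le> \<sigma> \<Longrightarrow> \<bar>t\<bar> \<ge> T0 \<Longrightarrow> L \<le> Re (Digamma (Complex \<sigma> t))"
proof -
  define P where "P = nat \<lceil>\<bar>p\<bar>\<rceil>"
  have P: "\<bar>p\<bar> \<le> real P" unfolding P_def by linarith
  \<comment> \<open>Chosen so that ln(K - 1 - P) >= L + 1; the extra 1 pays for the first K terms of
    the sum.\<close>
  define K where "K = P + 2 + nat \<lceil>exp (L + 1)\<rceil>"
  have KP: "K \<ge> P + 2" by (simp add: K_def)
  have "exp (L + 1) \<le> real K - 1 - real P" unfolding K_def by simp linarith
  then have lnK: "L + 1 \<le> ln (real K - 1 - real P)"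
    using KP by (subst ln_ge_iff) auto
  have "L \<le> Re (Digamma (Complex \<sigma> t))" if \<sigma>: "p \<le> \<sigma>" and t: "\<bar>t\<bar> \<ge> real K" for \<sigma> t
  proof (rule LIMSEQ_le_const)
    have t0: "\<bar>t\<bar> > 0" using t KP by linarith
    then have "Complex \<sigma> t \<noteq> 0" by (auto simp: complex_eq_iff)
    from tendsto_Re[OF Digamma_LIMSEQ[OF this]]
    show "(\<lambda>m. Re (of_real (ln (real m)) - (\<Sum>n<m. inverse (Complex \<sigma> t + of_nat n)))) \<longlonglongrightarrow> Re (Digamma (Complex \<sigma> t))" .
    have term1: "(\<sigma> + real n) / ((\<sigma> + real n)\<^sup>2 + t\<^sup>2) \<le> 1 / real K" for n
    proof -
      define u where "u = \<sigma> + real n"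
      have "2 * (\<bar>u\<bar> * \<bar>t\<bar>) \<le> u\<^sup>2 + t\<^sup>2"
        using sum_squares_bound[of "\<bar>u\<bar>" "\<bar>t\<bar>"] by simp
      moreover have "0 \<le> \<bar>u\<bar> * \<bar>t\<bar>" by simp
      ultimately have "u * \<bar>t\<bar> \<le> u\<^sup>2 + t\<^sup>2" using mult_right_mono[of u "\<bar>u\<bar>" "\<bar>t\<bar>"] by linarith
      then have "u / (u\<^sup>2 + t\<^sup>2) \<le> 1 / \<bar>t\<bar>"
        using t0 by (simp add: field_simps sum_power2_gt_zero_iff)
      also have "\<dots> \<le> 1 / real K" using t KP by (intro divide_left_mono) auto
      finally show ?thesis by (simp add: u_def)
    qed
    have term2: "(\<sigma> + real n) / ((\<sigma> + real n)\<^sup>2 + t\<^sup>2) \<le> ln (real n - real P) - ln (real n - real P - 1)" if n: "n \<ge> K" for n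
    proof -
      define v where "v = real n - real P"
      have v: "v > 1" using n KP by (simp add: v_def)
      have u: "\<sigma> + real n \<ge> v" using \<sigma> P by (simp add: v_def)
      have "(\<sigma> + real n) / ((\<sigma> + real n)\<^sup>2 + t\<^sup>2) \<le> (\<sigma> + real n) / (\<sigma> + real n)\<^sup>2"
        using u v by (intro divide_left_mono mult_pos_pos add_pos_nonneg) auto
      also have "\<dots> = 1 / (\<sigma> + real n)" using u v by (simp add: power2_eq_square)
      also have "\<dots> \<le> 1 / v" using u v by (intro divide_left_mono) auto
      also have "\<dots> \<le> ln v - ln (v - 1)"
        using ln_le_minus_one[of "(v - 1) / v"] v by (simp add: ln_div field_simps)
      finally show ?thesis by (simp add: v_def)
    qed
    have tele: "(\<Sum>n=K..<K+d. ln (real n - real P) - ln (real n - real P - 1)) = ln (real (K + d) - real P - 1) - ln (real K - real P - 1)" for d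
      by (induction d) (auto simp: algebra_simps)
    show "\<exists>N. \<forall>m\<ge>N. L \<le> Re (of_real (ln (real m)) - (\<Sum>n<m. inverse (Complex \<sigma> t + of_nat n)))"
    proof (intro exI allI impI)
      fix m assume m: "m \<ge> K"
      define g where "g = (\<lambda>n. (\<sigma> + real n) / ((\<sigma> + real n)\<^sup>2 + t\<^sup>2))"
      obtain d where d: "m = K + d" using m le_Suc_ex by blast
      have "Re (\<Sum>n<m. inverse (Complex \<sigma> t + of_nat n)) = (\<Sum>n<m. g n)"
        by (simp add: g_def)
      also have "\<dots> = (\<Sum>n<K. g n) + (\<Sum>n=K..<m. g n)"
        by (metis atLeast0LessThan m sum.atLeastLessThan_concat zero_le)
      also have "(\<Sum>n<K. g n) \<le> (\<Sum>n<K. 1 / real K)"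
        unfolding g_def by (intro sum_mono term1)
      also have "(\<Sum>n<K. 1 / real K) = 1" using KP by simp
      also have "(\<Sum>n=K..<m. g n) \<le> (\<Sum>n=K..<m. ln (real n - real P) - ln (real n - real P - 1))"
        unfolding g_def by (intro sum_mono term2) auto
      also have "\<dots> = ln (real m - real P - 1) - ln (real K - real P - 1)"
        unfolding d by (rule tele)
      also have "ln (real m - real P - 1) \<le> ln (real m)" using m KP by (intro ln_mono) auto
      finally have "Re (\<Sum>n<m. inverse (Complex \<sigma> t + of_nat n)) \<le> 1 + (ln (real m) - ln (real K - real P - 1))" by simp
      moreover have "real K - real P - 1 = real K - 1 - real P" by simp
      ultimately show "L \<le> Re (of_real (ln (real m)) - (\<Sum>n<m. inverse (Complex \<sigma> t + of_nat n)))"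
        using lnK by simp
    qed
  qed
  then show ?thesis using KP by (intro that[of "real K"]) auto
qed

lemma not_nonpos_Int_of_Im: "Im z \<noteq> 0 \<Longrightarrow> z \<notin> \<int>\<^sub>\<le>\<^sub>0"
  by (auto elim!: nonpos_Ints_cases)

text \<open>The real part of the digamma function is the logarithmic derivative of \<open>\<bar>\<Gamma>\<bar>\<close> along horizontal lines.\<close>

lemma norm_Gamma_vertical_growth:
  fixes L p :: real
  obtains T0 where "T0 \<ge> 1" "\<And>\<sigma> \<tau> t. p \<le> \<sigma> \<Longrightarrow> \<sigma> \<le> \<tau> \<Longrightarrow> \<bar>t\<bar> \<ge> T0 \<Longrightarrow>
    norm (Gamma (Complex \<sigma> t)) * exp (L * (\<tau> - \<sigma>)) \<le> norm (Gamma (Complex \<tau> t))"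
proof -
  obtain T0 where T0: "T0 \<ge> 1" "\<And>\<sigma> t. p \<le> \<sigma> \<Longrightarrow> \<bar>t\<bar> \<ge> T0 \<Longrightarrow> L \<le> Re (Digamma (Complex \<sigma> t))"
    using Re_Digamma_large by blast
  have "norm (Gamma (Complex \<sigma> t)) * exp (L * (\<tau> - \<sigma>)) \<le> norm (Gamma (Complex \<tau> t))"
    if \<sigma>: "p \<le> \<sigma>" "\<sigma> \<le> \<tau>" and t: "\<bar>t\<bar> \<ge> T0" for \<sigma> \<tau> t
  proof -
    define g where "g = (\<lambda>u. Gamma (Complex u t))"
    define N where "N = (\<lambda>u. (Re (g u))\<^sup>2 + (Im (g u))\<^sup>2)"
    have N: "N u = (norm (g u))\<^sup>2" for u by (simp add: N_def cmod_power2)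
    have "N \<sigma> * exp (- 2 * L * \<sigma>) \<le> N \<tau> * exp (- 2 * L * \<tau>)"
    proof (rule DERIV_nonneg_imp_nondecreasing[OF \<sigma>(2)])
      fix u assume u: "\<sigma> \<le> u" "u \<le> \<tau>"
      have nz: "Complex u t \<notin> \<int>\<^sub>\<le>\<^sub>0" using t T0(1) by (intro not_nonpos_Int_of_Im) auto
      define D where "D = g u * Digamma (Complex u t)"
      have "((\<lambda>u. Complex u t) has_vector_derivative 1) (at u)"
      proof -
        have "((\<lambda>u. of_real u + \<i> * of_real t) has_vector_derivative 1) (at u)"
          by (auto intro!: derivative_eq_intros)
        then show ?thesis by (simp add: Complex_eq)
      qed
      from field_vector_diff_chain_at[OF this has_field_derivative_Gamma[OF nz]]
      have "(g has_vector_derivative D) (at u)" by (simp add: o_def g_def D_def)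
      then have d: "((\<lambda>u. Re (g u)) has_real_derivative Re D) (at u)" "((\<lambda>u. Im (g u)) has_real_derivative Im D) (at u)"
        by (simp_all add: has_real_derivative_iff_has_vector_derivative bounded_linear.has_vector_derivative[OF bounded_linear_Re] bounded_linear.has_vector_derivative[OF bounded_linear_Im])
      have "(N has_real_derivative 2 * Re (g u) * Re D + 2 * Im (g u) * Im D) (at u)"
        unfolding N_def power2_eq_square
        using DERIV_add[OF DERIV_mult[OF d(1) d(1)] DERIV_mult[OF d(2) d(2)]] by (simp add: algebra_simps)
      then have "((\<lambda>u. N u * exp (- 2 * L * u)) has_real_derivative
         (2 * Re (g u) * Re D + 2 * Im (g u) * Im D) * exp (- 2 * L * u) + N u * (exp (- 2 * L * u) * (- 2 * L))) (at u)"
        by (auto intro!: derivative_eq_intros)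
      also have "2 * Re (g u) * Re D + 2 * Im (g u) * Im D = 2 * N u * Re (Digamma (Complex u t))"
        by (simp add: D_def N_def algebra_simps power2_eq_square)
      also have "2 * N u * Re (Digamma (Complex u t)) * exp (- 2 * L * u) + N u * (exp (- 2 * L * u) * (- 2 * L)) =
          2 * N u * (Re (Digamma (Complex u t)) - L) * exp (- 2 * L * u)"
        by (simp add: algebra_simps)
      finally have "((\<lambda>u. N u * exp (- 2 * L * u)) has_real_derivative
          2 * N u * (Re (Digamma (Complex u t)) - L) * exp (- 2 * L * u)) (at u)" .
      moreover have "0 \<le> 2 * N u * (Re (Digamma (Complex u t)) - L) * exp (- 2 * L * u)"
        using T0(2)[of u t] u \<sigma> t by (simp add: N)
      ultimately show "\<exists>y. ((\<lambda>u. N u * exp (- 2 * L * u)) has_real_derivative y) (at u) \<and> 0 \<le> y"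
        by blast
    qed
    then have "N \<sigma> * exp (- 2 * L * \<sigma>) * exp (2 * L * \<tau>) \<le> N \<tau> * exp (- 2 * L * \<tau>) * exp (2 * L * \<tau>)"
      by (intro mult_right_mono) auto
    also have "\<dots> = N \<tau>" by (simp add: mult.assoc mult_exp_exp)
    also have "N \<sigma> * exp (- 2 * L * \<sigma>) * exp (2 * L * \<tau>) = (norm (g \<sigma>) * exp (L * (\<tau> - \<sigma>)))\<^sup>2"
      by (simp add: N power_mult_distrib mult.assoc mult_exp_exp exp_double[symmetric] algebra_simps flip: exp_of_nat_mult) 
    finally show ?thesis
      unfolding N g_def by (simp add: power2_le_iff_abs_le)
  qed
  then show ?thesis using T0(1) that by blast
qed

section \<open>Bounds for Gamma in vertical strips\<close>

lemma norm_pochhammer_ge: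
  fixes t :: real
  shows "\<bar>t\<bar> ^ n \<le> norm (pochhammer (Complex \<sigma> t) n)"
proof -
  have "(\<Prod>i<n. \<bar>t\<bar>) \<le> (\<Prod>i<n. norm (Complex \<sigma> t + of_nat i))"
    by (intro prod_mono conjI) (use abs_Im_le_cmod[of "Complex \<sigma> t + of_nat _"] in auto)
  then show ?thesis by (simp add: pochhammer_prod prod_norm atLeast0LessThan)
qed

lemma norm_pochhammer_le:
  fixes t :: real
  assumes "\<bar>t\<bar> \<ge> 1" "\<bar>\<sigma>\<bar> \<le> B"
  shows "norm (pochhammer (Complex \<sigma> t) n) \<le> ((B + real n + 1) * \<bar>t\<bar>) ^ n"
proof -
  have "(\<Prod>i<n. norm (Complex \<sigma> t + of_nat i)) \<le> (\<Prod>i<n. (B + real n + 1) * \<bar>t\<bar>)"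
  proof (intro prod_mono conjI)
    fix i assume "i \<in> {..<n}"
    have "norm (Complex \<sigma> t + of_nat i) \<le> \<bar>\<sigma> + real i\<bar> + \<bar>t\<bar>"
      using cmod_le[of "Complex \<sigma> t + of_nat i"] by simp
    also have "\<dots> \<le> (B + real n) * 1 + 1 * \<bar>t\<bar>" using assms \<open>i \<in> _\<close> by simp
    also have "\<dots> \<le> (B + real n) * \<bar>t\<bar> + 1 * \<bar>t\<bar>" using assms by (intro add_right_mono mult_left_mono) auto
    finally show "norm (Complex \<sigma> t + of_nat i) \<le> (B + real n + 1) * \<bar>t\<bar>" by (simp add: algebra_simps)
  qed simp
  then show ?thesis by (simp add: pochhammer_prod prod_norm atLeast0LessThan)
qed

lemma Gamma_shift_vertical:
  assumes "t \<noteq> 0"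
  shows "Gamma (Complex (\<sigma> + real n) t) = pochhammer (Complex \<sigma> t) n * Gamma (Complex \<sigma> t)"
proof -
  have z: "Complex \<sigma> t \<notin> \<int>\<^sub>\<le>\<^sub>0" using assms by (intro not_nonpos_Int_of_Im) auto
  have "Complex (\<sigma> + real n) t = Complex \<sigma> t + of_nat n" by (simp add: complex_eq_iff)
  then show ?thesis using pochhammer_Gamma[OF z, of n] z by (simp add: Gamma_eq_zero_iff)
qed

text \<open>Shift by \<open>m\<close> steps into the region Re >= 2, where |Gamma| is bounded by the
  increasing real Gamma. Every factor of the recursion has modulus at least |t|, so the shift gains
  |t|^m with m >= n.\<close>

lemma norm_Gamma_vertical_decay:
  fixes p q :: real
  obtains C where "C \<ge> 0" "\<And>\<sigma> t. p \<le> \<sigma> \<Longrightarrow> \<sigma> \<le> q \<Longrightarrow> \<bar>t\<bar> \<ge> 1 \<Longrightarrow> norm (Gamma (Complex \<sigma> t)) * \<bar>t\<bar> ^ n \<le> C"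
proof -
  define m where "m = n + nat \<lceil>\<bar>p\<bar>\<rceil> + 2"
  have m: "m \<ge> n" "p + real m \<ge> 2" unfolding m_def by linarith+
  have "norm (Gamma (Complex \<sigma> t)) * \<bar>t\<bar> ^ n \<le> \<bar>Gamma (q + real m)\<bar>" if "p \<le> \<sigma>" "\<sigma> \<le> q" "\<bar>t\<bar> \<ge> 1" for \<sigma> t
  proof -
    have "norm (Gamma (Complex \<sigma> t)) * \<bar>t\<bar> ^ n \<le> norm (Gamma (Complex \<sigma> t)) * \<bar>t\<bar> ^ m"
      using that m by (intro mult_left_mono power_increasing) auto
    also have "\<dots> \<le> norm (Gamma (Complex \<sigma> t)) * norm (pochhammer (Complex \<sigma> t) m)"
      by (intro mult_left_mono norm_pochhammer_ge) auto
    also have "\<dots> = norm (Gamma (Complex (\<sigma> + real m) t))"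
      using that by (subst Gamma_shift_vertical) (auto simp: norm_mult)
    also have "\<dots> \<le> Gamma (\<sigma> + real m)"
      using norm_Gamma_le_Gamma_Re[of "Complex (\<sigma> + real m) t"] that m by simp
    also have "\<dots> \<le> Gamma (q + real m)"
      using Gamma_real_strict_mono[of "\<sigma> + real m" "q + real m"] that m by (cases "\<sigma> = q") auto
    finally show ?thesis by simp
  qed
  then show ?thesis by (intro that[of "\<bar>Gamma (q + real m)\<bar>"]) auto
qed

text \<open>For large |t| the modulus increases along horizontal lines (growth rate L = 0), which
  allows passing from \<sigma> to \<tau> + K, lying to the right of \<sigma> once p' + K >= q.
  Coming back to \<tau> by the recursion costs the factor |t|^K.\<close>

lemma norm_Gamma_vertical_ratio:
  fixes p q p' q' :: real
  obtains C K T0 where "C \<ge> 0" "T0 \<ge> 1" "\<And>\<sigma> \<tau> t. p \<le> \<sigma> \<Longrightarrow> \<sigma> \<le> q \<Longrightarrow> p' \<le> \<tau> \<Longrightarrow> \<tau> \<le> q' \<Longrightarrow> \<bar>t\<bar> \<ge> T0 \<Longrightarrow>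
    norm (Gamma (Complex \<sigma> t)) \<le> C * \<bar>t\<bar> ^ K * norm (Gamma (Complex \<tau> t))"
proof -
  obtain T0 where T0: "T0 \<ge> 1" "\<And>\<sigma> \<tau> t. p \<le> \<sigma> \<Longrightarrow> \<sigma> \<le> \<tau> \<Longrightarrow> \<bar>t\<bar> \<ge> T0 \<Longrightarrow>
    norm (Gamma (Complex \<sigma> t)) * exp (0 * (\<tau> - \<sigma>)) \<le> norm (Gamma (Complex \<tau> t))"
    using norm_Gamma_vertical_growth by blast
  define K where "K = nat \<lceil>\<bar>q - p'\<bar>\<rceil>"
  define B where "B = \<bar>p'\<bar> + \<bar>q'\<bar>"
  have K: "p' + real K \<ge> q" unfolding K_def by linarith
  have "norm (Gamma (Complex \<sigma> t)) \<le> (B + real K + 1) ^ K * \<bar>t\<bar> ^ K * norm (Gamma (Complex \<tau> t))"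
    if "p \<le> \<sigma>" "\<sigma> \<le> q" "p' \<le> \<tau>" "\<tau> \<le> q'" "\<bar>t\<bar> \<ge> T0" for \<sigma> \<tau> t
  proof -
    have t: "\<bar>t\<bar> \<ge> 1" using that T0 by simp
    have "norm (Gamma (Complex \<sigma> t)) \<le> norm (Gamma (Complex (\<tau> + real K) t))"
      using T0(2)[of \<sigma> "\<tau> + real K" t] that K by simp
    also have "\<dots> = norm (pochhammer (Complex \<tau> t) K) * norm (Gamma (Complex \<tau> t))"
      using t by (subst Gamma_shift_vertical) (auto simp: norm_mult)
    also have "\<dots> \<le> ((B + real K + 1) * \<bar>t\<bar>) ^ K * norm (Gamma (Complex \<tau> t))"
      using t that by (intro mult_right_mono norm_pochhammer_le) (auto simp: B_def)
    finally show ?thesis by (simp add: power_mult_distrib)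
  qed
  then show ?thesis by (intro that[of "(B + real K + 1) ^ K" T0 K]) (auto simp: B_def T0)
qed

text \<open>The quotient |Gamma(\<sigma> + it)| / Gamma(\<sigma>) increases with \<sigma>, because
  its Euler product consists of the factors (\<sigma>+k) / |\<sigma>+k+it|, each of which does. In
  contrast to the previous estimates this holds for all \<open>t\<close> and without constants, so
  it stays uniform as the right edge of a contour moves out.\<close>

lemma norm_Gamma_ratio_le_real:
  assumes "0 < \<sigma>" "\<sigma> \<le> \<tau>"
  shows "norm (Gamma (Complex \<sigma> t)) * Gamma \<tau> \<le> norm (Gamma (Complex \<tau> t)) * Gamma \<sigma>"
proof (rule LIMSEQ_le)
  show "(\<lambda>n. norm (Gamma_series (Complex \<sigma> t) n) * Gamma_series \<tau> n) \<longlonglongrightarrow> norm (Gamma (Complex \<sigma> t)) * Gamma \<tau>"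
    "(\<lambda>n. norm (Gamma_series (Complex \<tau> t) n) * Gamma_series \<sigma> n) \<longlonglongrightarrow> norm (Gamma (Complex \<tau> t)) * Gamma \<sigma>"
    by (intro tendsto_intros)+
  have "norm (Gamma_series (Complex \<sigma> t) n) * Gamma_series \<tau> n \<le> norm (Gamma_series (Complex \<tau> t) n) * Gamma_series \<sigma> n" for n
  proof -
    have factor: "norm (Complex \<tau> t + of_nat k) * (\<sigma> + real k) \<le> norm (Complex \<sigma> t + of_nat k) * (\<tau> + real k)" for k
    proof (rule power2_le_imp_le)
      have s: "\<sigma> + real k \<le> \<tau> + real k" "\<sigma> + real k \<ge> 0" using assms by auto
      have "t\<^sup>2 * (\<sigma> + real k)\<^sup>2 \<le> t\<^sup>2 * (\<tau> + real k)\<^sup>2"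
        using s by (intro mult_left_mono power_mono) auto
      then have "((\<tau> + real k)\<^sup>2 + t\<^sup>2) * (\<sigma> + real k)\<^sup>2 \<le> ((\<sigma> + real k)\<^sup>2 + t\<^sup>2) * (\<tau> + real k)\<^sup>2"
        unfolding distrib_right by (simp add: mult.commute)
      moreover have "(norm (Complex u t + of_nat k))\<^sup>2 = (u + real k)\<^sup>2 + t\<^sup>2" for u
        by (simp add: cmod_power2)
      ultimately show "(norm (Complex \<tau> t + of_nat k) * (\<sigma> + real k))\<^sup>2 \<le> (norm (Complex \<sigma> t + of_nat k) * (\<tau> + real k))\<^sup>2"
        by (simp only: power_mult_distrib)
    qed (use assms in auto)
    have "(\<Prod>k<n+1. norm (Complex \<tau> t + of_nat k) * (\<sigma> + real k)) \<le> (\<Prod>k<n+1. norm (Complex \<sigma> t + of_nat k) * (\<tau> + real k))"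
      using assms factor by (intro prod_mono) auto
    then have P: "norm (pochhammer (Complex \<tau> t) (n + 1)) * pochhammer \<sigma> (n + 1) \<le> norm (pochhammer (Complex \<sigma> t) (n + 1)) * pochhammer \<tau> (n + 1)"
      by (simp only: pochhammer_prod prod_norm[symmetric] prod.distrib atLeast0LessThan)
    have pos: "pochhammer \<sigma> (n + 1) > 0" "pochhammer \<tau> (n + 1) > 0"
      using assms by (auto intro!: pochhammer_pos)
    have pos': "norm (pochhammer (Complex u t) (n + 1)) > 0" if "u > 0" for u
    proof -
      have "Complex u t \<notin> \<int>\<^sub>\<le>\<^sub>0" using that by (intro not_nonpos_Int_of_Re_pos) auto
      then show ?thesis using pochhammer_eq_0_imp_nonpos_Int by auto
    qed
    have "1 / (norm (pochhammer (Complex \<sigma> t) (n + 1)) * pochhammer \<tau> (n + 1)) \<le> 1 / (norm (pochhammer (Complex \<tau> t) (n + 1)) * pochhammer \<sigma> (n + 1))"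
      using assms by (intro divide_left_mono mult_pos_pos P pos pos') auto
    then have "fact n * fact n * exp ((\<sigma> + \<tau>) * ln (real n)) * (1 / (norm (pochhammer (Complex \<sigma> t) (n + 1)) * pochhammer \<tau> (n + 1))) \<le>
       fact n * fact n * exp ((\<sigma> + \<tau>) * ln (real n)) * (1 / (norm (pochhammer (Complex \<tau> t) (n + 1)) * pochhammer \<sigma> (n + 1)))"
      by (intro mult_left_mono) auto
    then show ?thesis
      by (simp add: Gamma_series_def norm_divide norm_mult exp_add distrib_right mult_ac)
  qed
  then show "\<exists>N. \<forall>n\<ge>N. norm (Gamma_series (Complex \<sigma> t) n) * Gamma_series \<tau> n \<le> norm (Gamma_series (Complex \<tau> t) n) * Gamma_series \<sigma> n"
    by blast
qed

lemma norm_Gamma_Complex_minus: "norm (Gamma (Complex \<sigma> (- t))) = norm (Gamma (Complex \<sigma> t))"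
proof -
  have "Gamma (Complex \<sigma> (- t)) = cnj (Gamma (Complex \<sigma> t))"
    by (simp add: cnj_Gamma complex_cnj)
  then show ?thesis by simp
qed

section \<open>Closing a vertical contour\<close>

definition vertical_integral :: "real \<Rightarrow> real \<Rightarrow> (complex \<Rightarrow> complex) \<Rightarrow> complex" where
  "vertical_integral c T f = contour_integral (linepath (Complex c (- T)) (Complex c T)) f"

lemma continuous_on_Complex_line [continuous_intros]: "continuous_on A (\<lambda>t. Complex c t)"
  unfolding Complex_eq by (intro continuous_intros)

lemma vertical_integral_eq:
  assumes "T > 0" "continuous_on {-T..T} (\<lambda>t. f (Complex c t))"
  shows "vertical_integral c T f = \<i> * integral {-T..T} (\<lambda>t. f (Complex c t))"
proof -
  have "((\<lambda>t. f (Complex c t)) has_integral (- \<i> * (\<i> * integral {-T..T} (\<lambda>t. f (Complex c t))))) {-T..T}"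
    using integrable_integral[OF integrable_continuous_interval[OF assms(2)]] by simp
  then have "(f has_contour_integral (\<i> * integral {-T..T} (\<lambda>t. f (Complex c t)))) (linepath (Complex c (- T)) (Complex c T))"
    by (subst has_contour_integral_linepath_same_Re_iff[where c = c and a = "- T" and b = T]) (use assms in auto)
  then show ?thesis by (simp add: vertical_integral_def contour_integral_unique)
qed

lemma closed_segment_same_Im_bounds:
  assumes "z \<in> closed_segment (Complex c T) (Complex d T)" "c \<le> d"
  shows "\<exists>\<sigma>\<in>{c..d}. z = Complex \<sigma> T"
proof -
  obtain u where u: "0 \<le> u" "u \<le> 1" "z = (1 - u) *\<^sub>R Complex c T + u *\<^sub>R Complex d T"
    using assms(1) by (auto simp: closed_segment_def)
  have "z = Complex (c + u * (d - c)) T"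
    using u(3) by (simp add: complex_eq_iff algebra_simps)
  moreover have "c + u * (d - c) \<in> {c..d}"
    using u assms(2) mult_right_mono[of u 1 "d - c"] by auto
  ultimately show ?thesis by blast
qed

text \<open>Up to its horizontal edges the rectangle is the difference of two vertical segments. Its
  integral is kept as a term so that it can be evaluated later, by residues when poles are crossed
  and by Cauchy's theorem when there are none.\<close>

lemma vertical_integral_shift_bound:
  assumes cd: "c < d" and T: "T > 0"
    and cont: "continuous_on (path_image (rectpath (Complex c (- T)) (Complex d T))) f"
    and bound: "\<And>\<sigma>. c \<le> \<sigma> \<Longrightarrow> \<sigma> \<le> d \<Longrightarrow> norm (f (Complex \<sigma> T)) \<le> \<eta> \<and> norm (f (Complex \<sigma> (- T))) \<le> \<eta>"
  shows "norm (vertical_integral c T f - vertical_integral d T f +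
    contour_integral (rectpath (Complex c (- T)) (Complex d T)) f) \<le> 2 * (d - c) * \<eta>"
proof -
  let ?A = "Complex c (- T)" and ?B = "Complex d (- T)" and ?D = "Complex d T" and ?E = "Complex c T"
  have rp: "rectpath ?A ?D = linepath ?A ?B +++ linepath ?B ?D +++ linepath ?D ?E +++ linepath ?E ?A"
    by (simp add: rectpath_def Let_def)
  have img: "path_image (rectpath ?A ?D) = closed_segment ?A ?B \<union> closed_segment ?B ?D \<union> closed_segment ?D ?E \<union> closed_segment ?E ?A"
    unfolding rp by (simp add: path_image_join Un_assoc)
  have int: "f contour_integrable_on linepath ?A ?B" "f contour_integrable_on linepath ?B ?D"
    "f contour_integrable_on linepath ?D ?E" "f contour_integrable_on linepath ?E ?A"
    by (intro contour_integrable_continuous_linepath continuous_on_subset[OF cont]; force simp: img)+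
  have sum: "contour_integral (rectpath ?A ?D) f = contour_integral (linepath ?A ?B) f + (contour_integral (linepath ?B ?D) f +
      (contour_integral (linepath ?D ?E) f + contour_integral (linepath ?E ?A) f))"
    unfolding rp using int by (simp add: contour_integrable_join)
  have rev: "contour_integral (linepath ?E ?A) f = - contour_integral (linepath ?A ?E) f"
    using contour_integral_reverse_linepath[of ?E ?A f] cont by (simp add: img continuous_on_subset)
  have eta: "\<eta> \<ge> 0" using bound[of c] cd order_trans[OF norm_ge_zero] by auto
  have 1: "norm (contour_integral (linepath ?A ?B) f) \<le> \<eta> * norm (?B - ?A)"
  proof (rule contour_integral_bound_linepath[OF int(1) eta])
    fix z assume "z \<in> closed_segment ?A ?B"
    then obtain \<sigma> where "\<sigma> \<in> {c..d}" "z = Complex \<sigma> (- T)" using closed_segment_same_Im_bounds[of z c "- T" d] cd by auto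
    then show "norm (f z) \<le> \<eta>" using bound by auto
  qed
  have 2: "norm (contour_integral (linepath ?D ?E) f) \<le> \<eta> * norm (?E - ?D)"
  proof (rule contour_integral_bound_linepath[OF int(3) eta])
    fix z assume "z \<in> closed_segment ?D ?E"
    then have "z \<in> closed_segment ?E ?D" by (simp add: closed_segment_commute)
    then obtain \<sigma> where "\<sigma> \<in> {c..d}" "z = Complex \<sigma> T" using closed_segment_same_Im_bounds[of z c T d] cd by auto
    then show "norm (f z) \<le> \<eta>" using bound by auto
  qed
  have d: "norm (?B - ?A) = d - c" "norm (?E - ?D) = d - c"
    using cd by (simp_all add: cmod_def)
  have "vertical_integral c T f - vertical_integral d T f + contour_integral (rectpath ?A ?D) f =
      contour_integral (linepath ?A ?B) f + contour_integral (linepath ?D ?E) f"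
    unfolding vertical_integral_def sum rev by simp
  also have "norm \<dots> \<le> \<eta> * (d - c) + \<eta> * (d - c)"
    by (rule order_trans[OF norm_triangle_ineq]) (use 1 2 d in simp)
  finally show ?thesis by (simp add: mult_ac)
qed

text \<open>The poles of Gamma have residues (-1)^k / k!; the extra sign comes from the variable a -
  s running backwards. The poles are one unit apart, so the ball of radius 1 contains no
  other.\<close>

lemma Gamma_reflected_residue:
  fixes a :: real
  assumes "h holomorphic_on UNIV"
  shows "residue (\<lambda>s. Gamma (of_real a - s) * h s) (of_real a + of_nat k) = - ((- 1) ^ k / fact k * h (of_real a + of_nat k))"
proof -
  let ?p = "complex_of_real a + of_nat k"
  have hc: "continuous_on UNIV h" by (rule holomorphic_on_imp_continuous_on[OF assms])
  show ?thesis
  proof (rule residue_simple'[of "ball ?p 1"])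
    show "(\<lambda>s. Gamma (of_real a - s) * h s) holomorphic_on ball ?p 1 - {?p}"
    proof (intro holomorphic_intros holomorphic_on_subset[OF assms])
      fix s assume s: "s \<in> ball ?p 1 - {?p}"
      show "of_real a - s \<notin> \<int>\<^sub>\<le>\<^sub>0"
      proof
        assume "of_real a - s \<in> \<int>\<^sub>\<le>\<^sub>0"
        then obtain n :: nat where "of_real a - s = - of_nat n" by (elim nonpos_Ints_cases')
        then have s': "s = of_real a + of_nat n" by (simp add: algebra_simps)
        then have "norm (of_nat k - of_nat n :: complex) < 1" "n \<noteq> k"
          using s by (auto simp: dist_norm)
        then have "norm (of_int (int k - int n) :: complex) < 1" by simp
        then have "\<bar>int k - int n\<bar> < 1" by (simp only: norm_of_int)
        then show False using \<open>n \<noteq> k\<close> by simp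
      qed
    qed auto
    have lim: "filterlim (\<lambda>s. of_real a - s) (at (- of_nat k)) (at ?p)"
      unfolding filterlim_at
      by (auto intro!: tendsto_eq_intros simp: eventually_at_filter algebra_simps)
    have "((\<lambda>s. Gamma (of_real a - s) * (of_real a - s + of_nat k)) \<longlongrightarrow> (- 1) ^ k / fact k) (at ?p)"
      by (rule filterlim_compose[OF Gamma_residues lim])
    moreover have "(h \<longlongrightarrow> h ?p) (at ?p)"
      using hc by (simp add: continuous_on_eq_continuous_at isCont_def)
    ultimately have "((\<lambda>s. - (Gamma (of_real a - s) * (of_real a - s + of_nat k) * h s)) \<longlongrightarrow> - ((- 1) ^ k / fact k * h ?p)) (at ?p)"
      by (intro tendsto_intros)
    then show "((\<lambda>w. Gamma (of_real a - w) * h w * (w - ?p)) \<longlongrightarrow> - ((- 1) ^ k / fact k * h ?p)) (at ?p)"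
      by (simp add: algebra_simps)
  qed auto
qed

lemma Gamma_reflected_holomorphic:
  fixes a :: real
  assumes "h holomorphic_on UNIV" "\<And>n. of_real a + of_nat n \<notin> A"
  shows "(\<lambda>s. Gamma (of_real a - s) * h s) holomorphic_on A"
proof (intro holomorphic_intros holomorphic_on_subset[OF assms(1)])
  fix s assume "s \<in> A"
  show "of_real a - s \<notin> \<int>\<^sub>\<le>\<^sub>0"
  proof
    assume "of_real a - s \<in> \<int>\<^sub>\<le>\<^sub>0"
    then obtain n :: nat where "of_real a - s = - of_nat n" by (elim nonpos_Ints_cases')
    then have "s = of_real a + of_nat n" by (simp add: algebra_simps)
    then show False using assms(2) \<open>s \<in> A\<close> by blast
  qed
qed auto

text \<open>The residue theorem is applied with finitely many exceptional points, so the domain is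
  the half plane \<open>S\<close> that ends just before pole number n + 1. The right edge a + n +
  1/2 stays at distance 1/2 from the neighbouring poles.\<close>

lemma contour_integral_rectpath_Gamma_reflected:
  fixes a c T :: real and n :: nat
  assumes h: "h holomorphic_on UNIV" and "c < a" "T > 0"
  defines "d \<equiv> a + real n + 1/2"
  shows "contour_integral (rectpath (Complex c (- T)) (Complex d T)) (\<lambda>s. Gamma (of_real a - s) * h s) =
    - (2 * of_real pi * \<i> * (\<Sum>k\<le>n. (- 1) ^ k / fact k * h (of_real a + of_nat k)))"
proof -
  define f where "f = (\<lambda>s. Gamma (of_real a - s) * h s)"
  define S where "S = {s. Re s < a + real n + 1}"
  define pole where "pole = (\<lambda>k::nat. complex_of_real a + of_nat k)"
  define pts where "pts = pole ` {..n}"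
  have inj: "inj_on pole {..n}" by (auto simp: inj_on_def pole_def)
  have cd: "c \<le> d" using assms by (simp add: d_def)
  have pts_box: "z \<in> box (Complex c (- T)) (Complex d T)" if "z \<in> pts" for z
    using that assms by (auto simp: pts_def pole_def in_box_complex_iff)
  have "contour_integral (rectpath (Complex c (- T)) (Complex d T)) f =
      2 * pi * \<i> * (\<Sum>p\<in>pts. winding_number (rectpath (Complex c (- T)) (Complex d T)) p * residue f p)"
  proof (rule Residue_theorem[where S = S])
    show "open S" unfolding S_def by (rule open_halfspace_Re_lt)
    show "connected S" unfolding S_def by (intro convex_connected convex_halfspace_Re_lt)
    show "finite pts" by (simp add: pts_def)
    show "f holomorphic_on S - pts"
      unfolding f_def
    proof (rule Gamma_reflected_holomorphic[OF h])
      fix k :: nat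
      show "of_real a + of_nat k \<notin> S - pts"
        by (cases "k \<le> n") (auto simp: S_def pts_def pole_def)
    qed
    show "path_image (rectpath (Complex c (- T)) (Complex d T)) \<subseteq> S - pts"
    proof
      fix z assume z: "z \<in> path_image (rectpath (Complex c (- T)) (Complex d T))"
      have "z \<in> cbox (Complex c (- T)) (Complex d T) - box (Complex c (- T)) (Complex d T)"
        using z cd \<open>T > 0\<close> by (subst (asm) path_image_rectpath_cbox_minus_box) auto
      then show "z \<in> S - pts" using pts_box by (auto simp: S_def in_cbox_complex_iff d_def)
    qed
    show "\<forall>z. z \<notin> S \<longrightarrow> winding_number (rectpath (Complex c (- T)) (Complex d T)) z = 0"
      using cd \<open>T > 0\<close> by (auto intro!: winding_number_rectpath_outside simp: S_def in_cbox_complex_iff d_def)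
  qed auto
  also have "(\<Sum>p\<in>pts. winding_number (rectpath (Complex c (- T)) (Complex d T)) p * residue f p) = (\<Sum>p\<in>pts. residue f p)"
    using pts_box by (intro sum.cong refl) (simp add: winding_number_rectpath)
  also have "\<dots> = (\<Sum>k\<le>n. residue f (pole k))"
    unfolding pts_def by (rule sum.reindex[OF inj, unfolded o_def])
  also have "\<dots> = - (\<Sum>k\<le>n. (- 1) ^ k / fact k * h (of_real a + of_nat k))"
    unfolding sum_negf[symmetric] f_def pole_def by (intro sum.cong refl Gamma_reflected_residue h)
  finally show ?thesis by (simp add: f_def)
qed

text \<open>The recursion leads from Re = -n - 1/2 to Re = 1/2 through factors of modulus sqrt((i +
  1/2)^2 + t^2) for i = 0, ..., n. The first two keep their dependence on \<open>t\<close> and give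
  1/4 + t^2, which makes the right edge integrable; each later one is at least i, and these build up
  n!.\<close>

lemma norm_Gamma_negative_half_le:
  assumes "n \<ge> 1"
  shows "norm (Gamma (Complex (- real n - 1/2) t)) \<le> norm (Gamma (Complex (1/2) t)) / (fact n * (1/4 + t\<^sup>2))"
proof -
  define z where "z = Complex (- real n - 1/2) t"
  have z: "z \<notin> \<int>\<^sub>\<le>\<^sub>0"
  proof
    assume "z \<in> \<int>\<^sub>\<le>\<^sub>0"
    then obtain k :: nat where "z = - of_nat k" by (elim nonpos_Ints_cases')
    then have "2 * real n + 1 = 2 * real k" by (simp add: z_def complex_eq_iff)
    then have "2 * n + 1 = 2 * k" by linarith
    then show False by presburger
  qed
  have zn: "z + of_nat (n + 1) = Complex (1/2) t" by (simp add: z_def complex_eq_iff)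
  have "Gamma (Complex (1/2) t) = pochhammer z (n + 1) * Gamma z"
    using pochhammer_Gamma[OF z, of "n + 1"] z unfolding zn by (simp add: Gamma_eq_zero_iff)
  then have G: "norm (Gamma (Complex (1/2) t)) = norm (pochhammer z (n + 1)) * norm (Gamma z)"
    by (simp add: norm_mult)
  have "pochhammer z (n + 1) = (\<Prod>i<n+1. z + of_nat i)"
    by (simp add: pochhammer_prod atLeast0LessThan)
  also have "\<dots> = (\<Prod>i<n+1. z + of_nat (n - i))"
    by (subst prod.nat_diff_reindex[symmetric]) simp
  finally have "norm (pochhammer z (n + 1)) = (\<Prod>i<n+1. norm (z + of_nat (n - i)))"
    by (simp only: prod_norm)
  also have "\<dots> = (\<Prod>i<n+1. sqrt ((real i + 1/2)\<^sup>2 + t\<^sup>2))"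
  proof (rule prod.cong[OF refl])
    fix i assume "i \<in> {..<n+1}"
    then have "Re (z + of_nat (n - i)) = - (real i + 1/2)" "Im (z + of_nat (n - i)) = t"
      by (auto simp: z_def)
    then show "norm (z + of_nat (n - i)) = sqrt ((real i + 1/2)\<^sup>2 + t\<^sup>2)"
      by (simp only: cmod_def power2_minus)
  qed
  also have "\<dots> \<ge> fact n * (1/4 + t\<^sup>2)"
    using assms
  proof (induction n rule: dec_induct)
    case base
    have "1/4 + t\<^sup>2 = sqrt (1/4 + t\<^sup>2) * sqrt (1/4 + t\<^sup>2)" by simp
    also have "\<dots> \<le> sqrt ((0 + 1/2)\<^sup>2 + t\<^sup>2) * sqrt ((1 + 1/2)\<^sup>2 + t\<^sup>2)"
      by (intro mult_mono) (auto simp: power2_eq_square)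
    finally show ?case by (simp add: lessThan_Suc mult.commute)
  next
    case (step n)
    have "real (Suc n) \<le> sqrt ((real (Suc n) + 1/2)\<^sup>2 + t\<^sup>2)"
    proof (rule real_le_rsqrt)
      have "(real (Suc n))\<^sup>2 \<le> (real (Suc n) + 1/2)\<^sup>2" by (intro power_mono) auto
      then show "(real (Suc n))\<^sup>2 \<le> (real (Suc n) + 1/2)\<^sup>2 + t\<^sup>2" by (simp add: add_increasing2)
    qed
    then have "(fact n * (1/4 + t\<^sup>2)) * real (Suc n) \<le> (\<Prod>i<n+1. sqrt ((real i + 1/2)\<^sup>2 + t\<^sup>2)) * sqrt ((real (Suc n) + 1/2)\<^sup>2 + t\<^sup>2)"
      using step.IH by (intro mult_mono) (auto intro!: prod_nonneg mult_nonneg_nonneg add_nonneg_nonneg)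
    then show ?case by (simp add: lessThan_Suc mult_ac)
  qed
  finally have P: "fact n * (1/4 + t\<^sup>2) \<le> norm (pochhammer z (n + 1))" .
  have pos: "fact n * (1/4 + t\<^sup>2) > (0::real)" by (intro mult_pos_pos add_pos_nonneg) auto
  have "norm (Gamma z) * (fact n * (1/4 + t\<^sup>2)) \<le> norm (Gamma (Complex (1/2) t))"
    unfolding G using mult_right_mono[OF P norm_ge_zero[of "Gamma z"]] by (simp only: mult.commute)
  then show ?thesis using pos by (simp add: pos_le_divide_eq z_def)
qed

text \<open>
  The contour is closed to the right by rectangles whose right edges run midway between two poles.
  There the recursion for \<open>\<Gamma>\<close> gains a factor \<open>1 / n!\<close>, uniformly in the height \<open>T\<close>, so that letting
  \<open>T \<rightarrow> \<infinity>\<close> before \<open>n \<rightarrow> \<infinity>\<close> covers conditional convergence as well.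
\<close>

lemma vertical_integral_Gamma_residue_sum:
  fixes a c y C :: real and S :: complex
  assumes h: "h holomorphic_on UNIV" and c: "c < a" and y: "y \<ge> 0"
    and horizontal: "\<And>d \<epsilon>. \<epsilon> > 0 \<Longrightarrow> \<exists>T0. \<forall>T\<ge>T0. \<forall>\<sigma>\<in>{c..d}.
      norm (Gamma (Complex (a - \<sigma>) (- T)) * h (Complex \<sigma> T)) \<le> \<epsilon> \<and> norm (Gamma (Complex (a - \<sigma>) T) * h (Complex \<sigma> (- T))) \<le> \<epsilon>"
    and right: "\<And>n t. norm (Gamma (Complex (1/2) (- t))) * norm (h (Complex (a + real n + 1/2) t)) \<le> C * y ^ n"
    and S: "(\<lambda>k. (- 1) ^ k / fact k * h (of_real a + of_nat k)) sums S"
  shows "((\<lambda>T. vertical_integral c T (\<lambda>s. Gamma (of_real a - s) * h s)) \<longlongrightarrow> 2 * of_real pi * \<i> * S) at_top"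
proof -
  define f where "f = (\<lambda>s. Gamma (of_real a - s) * h s)"
  define d where "d = (\<lambda>n::nat. a + real n + 1/2)"
  define Sn where "Sn = (\<lambda>n. \<Sum>k\<le>n. (- 1) ^ k / fact k * h (of_real a + of_nat k))"
  have C: "C \<ge> 0" using right[of 0 0] order_trans[OF mult_nonneg_nonneg[OF norm_ge_zero norm_ge_zero] right[of 0 0]] by simp
  have f_Complex: "f (Complex u t) = Gamma (Complex (a - u) (- t)) * h (Complex u t)" for u t
  proof -
    have "of_real a - Complex u t = Complex (a - u) (- t)" by (simp add: complex_eq_iff)
    then show ?thesis by (simp add: f_def)
  qed
  have cont: "continuous_on A f" if "\<And>n. complex_of_real a + of_nat n \<notin> A" for A
    unfolding f_def by (rule holomorphic_on_imp_continuous_on[OF Gamma_reflected_holomorphic[OF h that]])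
  have nopole: "complex_of_real a + of_nat k \<noteq> Complex (d n) t" for n k t
  proof
    assume "complex_of_real a + of_nat k = Complex (d n) t"
    then have "2 * real k = 2 * real n + 1" by (simp add: d_def complex_eq_iff)
    then have "2 * k = 2 * n + 1" by linarith
    then show False by presburger
  qed
  have right_bound: "norm (vertical_integral (d n) T f) \<le> 2 * pi * (C * y ^ n / fact n)" if n: "n \<ge> 1" and T: "T > 0" for n T
  proof -
    have cl: "continuous_on {-T..T} (\<lambda>t. f (Complex (d n) t))"
      by (rule continuous_on_compose2[OF cont continuous_on_Complex_line, of "range (\<lambda>t. Complex (d n) t)"])
         (use nopole in force)+
    define B where "B = C * y ^ n / fact n"
    have "((\<lambda>t. B * (1 / (1/4 + t\<^sup>2))) has_integral B * (2 * arctan (2 * T)) - B * (2 * arctan (2 * (- T)))) {-T..T}"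
    proof (rule fundamental_theorem_of_calculus)
      fix t :: real
      have "((\<lambda>t. B * (2 * arctan (2 * t))) has_real_derivative B * (1 / (1/4 + t\<^sup>2))) (at t within {-T..T})"
      proof -
        have "((\<lambda>t. B * (2 * arctan (2 * t))) has_real_derivative B * (2 * (inverse (1 + (2 * t)\<^sup>2) * 2))) (at t within {-T..T})"
          by (auto intro!: derivative_eq_intros)
        also have "2 * (inverse (1 + (2 * t)\<^sup>2) * 2) = 1 / (1/4 + t\<^sup>2)"
          by (simp add: inverse_eq_divide power_mult_distrib) (simp add: field_simps add_nonneg_eq_0_iff)
        finally show ?thesis .
      qed
      then show "((\<lambda>t. B * (2 * arctan (2 * t))) has_vector_derivative B * (1 / (1/4 + t\<^sup>2))) (at t within {-T..T})"
        by (simp only: has_real_derivative_iff_has_vector_derivative)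
    qed (use T in simp)
    then have I: "((\<lambda>t. B * (1 / (1/4 + t\<^sup>2))) has_integral B * (4 * arctan (2 * T))) {-T..T}"
      by (simp add: arctan_minus mult_ac)
    have "norm (integral {-T..T} (\<lambda>t. f (Complex (d n) t))) \<le> integral {-T..T} (\<lambda>t. B * (1 / (1/4 + t\<^sup>2)))"
    proof (rule integral_norm_bound_integral[OF integrable_continuous_interval[OF cl] has_integral_integrable[OF I]])
      fix t :: real
      have pos: "1/4 + t\<^sup>2 > 0" by (intro add_pos_nonneg) auto
      have "norm (f (Complex (d n) t)) = norm (Gamma (Complex (- real n - 1/2) (- t))) * norm (h (Complex (d n) t))"
        unfolding f_Complex norm_mult by (simp add: d_def algebra_simps)
      also have "\<dots> \<le> norm (Gamma (Complex (1/2) (- t))) / (fact n * (1/4 + t\<^sup>2)) * norm (h (Complex (d n) t))"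
        using norm_Gamma_negative_half_le[OF n, of "- t"] by (intro mult_right_mono) auto
      also have "\<dots> = norm (Gamma (Complex (1/2) (- t))) * norm (h (Complex (d n) t)) / (fact n * (1/4 + t\<^sup>2))" by simp
      also have "\<dots> \<le> C * y ^ n / (fact n * (1/4 + t\<^sup>2))"
        using right[of t n] pos by (intro divide_right_mono) (auto simp: d_def)
      finally show "norm (f (Complex (d n) t)) \<le> B * (1 / (1/4 + t\<^sup>2))" by (simp add: B_def)
    qed
    also have "\<dots> = B * (4 * arctan (2 * T))" by (rule integral_unique[OF I])
    also have "\<dots> \<le> B * (2 * pi)"
      using arctan_ubound[of "2 * T"] C y by (intro mult_left_mono) (auto simp: B_def)
    finally show ?thesis unfolding vertical_integral_eq[OF T cl] by (simp add: norm_mult B_def mult_ac)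
  qed
  have "(\<lambda>n. 2 * pi * (C * (y ^ n / fact n))) \<longlonglongrightarrow> 2 * pi * (C * 0)"
    using summable_LIMSEQ_zero[OF summable_exp_generic[of y]] by (intro tendsto_intros) (simp add: field_simps)
  then have Bn: "(\<lambda>n. 2 * pi * (C * y ^ n / fact n)) \<longlonglongrightarrow> 0" by simp
  have "(\<lambda>n. 2 * of_real pi * \<i> * Sn n) \<longlonglongrightarrow> 2 * of_real pi * \<i> * S"
    using S unfolding sums_def_le Sn_def by (intro tendsto_intros)
  then have Sn: "(\<lambda>n. norm (2 * of_real pi * \<i> * Sn n - 2 * of_real pi * \<i> * S)) \<longlonglongrightarrow> 0"
    by (intro tendsto_norm_zero) (simp add: LIM_zero)
  show ?thesis
    unfolding f_def[symmetric]
  proof (rule tendstoI)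
    fix \<epsilon> :: real assume e: "\<epsilon> > 0"
    have "\<forall>\<^sub>F n in sequentially. 2 * pi * (C * y ^ n / fact n) < \<epsilon> / 3" "\<forall>\<^sub>F n in sequentially. norm (2 * of_real pi * \<i> * Sn n - 2 * of_real pi * \<i> * S) < \<epsilon> / 3"
      using order_tendstoD(2)[OF Bn, of "\<epsilon> / 3"] order_tendstoD(2)[OF Sn, of "\<epsilon> / 3"] e by auto
    then have "\<forall>\<^sub>F n in sequentially. n \<ge> 1 \<and> 2 * pi * (C * y ^ n / fact n) < \<epsilon> / 3 \<and> norm (2 * of_real pi * \<i> * Sn n - 2 * of_real pi * \<i> * S) < \<epsilon> / 3"
      using eventually_ge_at_top[of 1] by eventually_elim auto
    then obtain n where n: "n \<ge> 1" "2 * pi * (C * y ^ n / fact n) < \<epsilon> / 3" "norm (2 * of_real pi * \<i> * Sn n - 2 * of_real pi * \<i> * S) < \<epsilon> / 3"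
      using eventually_happens by force
    have cd: "c < d n" using c by (simp add: d_def)
    define \<eta> where "\<eta> = \<epsilon> / (6 * (d n - c))"
    have \<eta>: "\<eta> > 0" using e cd by (simp add: \<eta>_def)
    obtain T0 where T0: "\<And>T \<sigma>. T \<ge> T0 \<Longrightarrow> \<sigma> \<in> {c..d n} \<Longrightarrow>
      norm (Gamma (Complex (a - \<sigma>) (- T)) * h (Complex \<sigma> T)) \<le> \<eta> \<and> norm (Gamma (Complex (a - \<sigma>) T) * h (Complex \<sigma> (- T))) \<le> \<eta>"
      using horizontal[OF \<eta>, of "d n"] by blast
    have "dist (vertical_integral c T f) (2 * of_real pi * \<i> * S) < \<epsilon>" if T: "T \<ge> max T0 1" for T
    proof -
      let ?R = "rectpath (Complex c (- T)) (Complex (d n) T)"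
      have "T > 0" using T by simp
      have "norm (vertical_integral c T f - vertical_integral (d n) T f + contour_integral ?R f) \<le> 2 * (d n - c) * \<eta>"
      proof (rule vertical_integral_shift_bound[OF cd \<open>T > 0\<close>])
        show "continuous_on (path_image ?R) f"
        proof (rule cont)
          fix k
          show "complex_of_real a + of_nat k \<notin> path_image ?R"
          proof
            assume "complex_of_real a + of_nat k \<in> path_image ?R"
            moreover have "complex_of_real a + of_nat k = Complex (a + real k) 0" by (simp add: complex_eq_iff)
            ultimately have "Complex (a + real k) 0 \<in> path_image ?R" by simp
            then have "a + real k = d n"
              using cd \<open>T > 0\<close> c by (auto simp: path_image_rectpath)
            then have "2 * real k = 2 * real n + 1" by (simp add: d_def)
            then have "2 * k = 2 * n + 1" by linarith
            then show False by presburger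
          qed
        qed
        show "norm (f (Complex \<sigma> T)) \<le> \<eta> \<and> norm (f (Complex \<sigma> (- T))) \<le> \<eta>" if "c \<le> \<sigma>" "\<sigma> \<le> d n" for \<sigma>
          using T0[of T \<sigma>] T that by (simp add: f_Complex)
      qed
      also have "contour_integral ?R f = - (2 * of_real pi * \<i> * Sn n)"
        unfolding f_def d_def Sn_def by (rule contour_integral_rectpath_Gamma_reflected[OF h c \<open>T > 0\<close>])
      also have "2 * (d n - c) * \<eta> = \<epsilon> / 3"
      proof -
        have "2 * D * (\<epsilon> / (6 * D)) = \<epsilon> / 3" if "D > 0" for D using that by (simp add: field_simps)
        then show ?thesis using cd by (simp only: \<eta>_def diff_gt_0_iff_gt)
      qed
      finally have 1: "norm (vertical_integral c T f - vertical_integral (d n) T f - 2 * of_real pi * \<i> * Sn n) \<le> \<epsilon> / 3" by simp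
      have 2: "norm (vertical_integral (d n) T f) < \<epsilon> / 3"
        using right_bound[OF n(1) \<open>T > 0\<close>] n(2) by simp
      have "vertical_integral c T f - 2 * of_real pi * \<i> * S = (vertical_integral c T f - vertical_integral (d n) T f - 2 * of_real pi * \<i> * Sn n)
          + vertical_integral (d n) T f + (2 * of_real pi * \<i> * Sn n - 2 * of_real pi * \<i> * S)" by simp
      also have "norm \<dots> \<le> norm (vertical_integral c T f - vertical_integral (d n) T f - 2 * of_real pi * \<i> * Sn n)
          + norm (vertical_integral (d n) T f) + norm (2 * of_real pi * \<i> * Sn n - 2 * of_real pi * \<i> * S)"
        by (intro norm_triangle_le add_mono order_refl norm_triangle_ineq)
      finally show ?thesis using 1 2 n(3) by (simp add: dist_norm)
    qed
    then show "\<forall>\<^sub>F T in at_top. dist (vertical_integral c T f) (2 * of_real pi * \<i> * S) < \<epsilon>"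
      unfolding eventually_at_top_linorder by blast
  qed
qed

section \<open>Rapidly decreasing densities and Mellin inversion\<close>

lemma integrable_inverse_one_plus_square: "integrable lborel (\<lambda>x::real. 1 / (1 + x\<^sup>2))"
proof -
  have "set_integrable lborel (einterval (- \<infinity>) \<infinity>) (\<lambda>x::real. 1 / (1 + x\<^sup>2))"
  proof (rule interval_integral_FTC_nonneg(1))
    show "((arctan \<circ> real_of_ereal) \<longlongrightarrow> - (pi / 2)) (at_right (- \<infinity>))"
      "((arctan \<circ> real_of_ereal) \<longlongrightarrow> pi / 2) (at_left \<infinity>)"
      by (simp_all add: ereal_tendsto_simps tendsto_arctan_at_bot tendsto_arctan_at_top)
  qed (auto intro!: derivative_eq_intros continuous_intros simp: inverse_eq_divide add_nonneg_eq_0_iff)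
  then show ?thesis by (simp add: set_integrable_def)
qed

definition rapidly_decreasing :: "(real \<Rightarrow> complex) \<Rightarrow> bool" where
  "rapidly_decreasing f \<longleftrightarrow> continuous_on UNIV f \<and> (\<forall>n. \<exists>C. \<forall>t. norm (f t) * (1 + \<bar>t\<bar>) ^ n \<le> C)"

lemma rapidly_decreasingI:
  assumes cont: "continuous_on UNIV f"
    and decay: "\<And>n. \<exists>C T0. \<forall>t. \<bar>t\<bar> \<ge> T0 \<longrightarrow> norm (f t) * \<bar>t\<bar> ^ n \<le> C"
  shows "rapidly_decreasing f"
  unfolding rapidly_decreasing_def
proof (intro conjI allI cont)
  fix n :: nat
  obtain C T0 where C: "\<And>t. \<bar>t\<bar> \<ge> T0 \<Longrightarrow> norm (f t) * \<bar>t\<bar> ^ n \<le> C" using decay[of n] by blast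
  define T where "T = max T0 1"
  have "compact ((\<lambda>t. norm (f t) * (1 + \<bar>t\<bar>) ^ n) ` {-T..T})"
    by (intro compact_continuous_image continuous_intros continuous_on_subset[OF cont]) auto
  then have "bounded ((\<lambda>t. norm (f t) * (1 + \<bar>t\<bar>) ^ n) ` {-T..T})" by (rule compact_imp_bounded)
  then obtain B where B: "\<And>t. t \<in> {-T..T} \<Longrightarrow> norm (norm (f t) * (1 + \<bar>t\<bar>) ^ n) \<le> B"
    unfolding bounded_iff by blast
  have "norm (f t) * (1 + \<bar>t\<bar>) ^ n \<le> max B (2 ^ n * C)" for t
  proof (cases "\<bar>t\<bar> \<le> T")
    case True
    then have "t \<in> {-T..T}" by auto
    from B[OF this] show ?thesis by (simp add: le_max_iff_disj)
  next
    case False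
    then have t: "\<bar>t\<bar> \<ge> 1" "\<bar>t\<bar> \<ge> T0" by (auto simp: T_def)
    have "norm (f t) * (1 + \<bar>t\<bar>) ^ n \<le> norm (f t) * (2 * \<bar>t\<bar>) ^ n"
      using t by (intro mult_left_mono power_mono) auto
    also have "\<dots> = 2 ^ n * (norm (f t) * \<bar>t\<bar> ^ n)" by (simp add: power_mult_distrib)
    also have "\<dots> \<le> 2 ^ n * C" using C[OF t(2)] by (intro mult_left_mono) auto
    finally show ?thesis by (simp add: le_max_iff_disj)
  qed
  then show "\<exists>C. \<forall>t. norm (f t) * (1 + \<bar>t\<bar>) ^ n \<le> C" by blast
qed

lemma rapidly_decreasing_integrable:
  assumes "rapidly_decreasing f"
  shows "integrable lborel (\<lambda>t. (1 + \<bar>t\<bar>) ^ n * norm (f t))"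
proof -
  have cont: "continuous_on UNIV f" using assms by (simp add: rapidly_decreasing_def)
  obtain C where C: "\<And>t. norm (f t) * (1 + \<bar>t\<bar>) ^ (n + 2) \<le> C"
    using assms unfolding rapidly_decreasing_def by blast
  show ?thesis
  proof (rule Bochner_Integration.integrable_bound)
    show "integrable lborel (\<lambda>t. C * (1 / (1 + t\<^sup>2)))"
      by (intro integrable_mult_right integrable_inverse_one_plus_square)
    show "(\<lambda>t. (1 + \<bar>t\<bar>) ^ n * norm (f t)) \<in> borel_measurable lborel"
      using borel_measurable_continuous_onI[OF cont] by measurable
    show "AE t in lborel. norm ((1 + \<bar>t\<bar>) ^ n * norm (f t)) \<le> norm (C * (1 / (1 + t\<^sup>2)))"
    proof (rule AE_I2)
      fix t :: real
      have pos: "1 + t\<^sup>2 > 0" by (intro add_pos_nonneg) auto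
      have "1 + t\<^sup>2 \<le> (1 + \<bar>t\<bar>)\<^sup>2" by (simp add: power2_sum)
      then have "norm (f t) * (1 + \<bar>t\<bar>) ^ n * (1 + t\<^sup>2) \<le> norm (f t) * (1 + \<bar>t\<bar>) ^ n * (1 + \<bar>t\<bar>)\<^sup>2"
        by (intro mult_left_mono) auto
      also have "\<dots> = norm (f t) * (1 + \<bar>t\<bar>) ^ (n + 2)" by (simp add: power_add power2_eq_square)
      also have "\<dots> \<le> C" by (rule C)
      finally have "(1 + \<bar>t\<bar>) ^ n * norm (f t) \<le> C / (1 + t\<^sup>2)"
        using pos by (simp add: pos_le_divide_eq mult_ac)
      also have "\<dots> \<le> \<bar>C\<bar> / (1 + t\<^sup>2)" using pos by (intro divide_right_mono) auto
      finally show "norm ((1 + \<bar>t\<bar>) ^ n * norm (f t)) \<le> norm (C * (1 / (1 + t\<^sup>2)))"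
        by (simp add: abs_mult)
    qed
  qed
qed

text \<open>On a vertical line exp(Re s * r) is a constant, so polynomial moments in the height are
  all that \<open>gpow_ok\<close> asks for.\<close>

lemma rapidly_decreasing_gpow_ok:
  assumes "rapidly_decreasing f"
  shows "gpow_ok lborel (Complex c) f"
  unfolding gpow_ok_def
proof (intro conjI allI)
  have cont: "continuous_on UNIV f" using assms by (simp add: rapidly_decreasing_def)
  note [measurable] = borel_measurable_continuous_onI[OF cont]
  show c [measurable]: "Complex c \<in> borel_measurable lborel"
    using borel_measurable_continuous_onI[OF continuous_on_Complex_line[of UNIV c]] by simp
  show "f \<in> borel_measurable lborel" by measurable
  fix n :: nat and r :: real
  show "integrable lborel (\<lambda>t. (1 + norm (Complex c t)) ^ n * exp (Re (Complex c t) * r) * norm (f t))"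
  proof (rule Bochner_Integration.integrable_bound)
    show "integrable lborel (\<lambda>t. ((1 + \<bar>c\<bar>) ^ n * exp (c * r)) * ((1 + \<bar>t\<bar>) ^ n * norm (f t)))"
      by (intro integrable_mult_right rapidly_decreasing_integrable assms)
    show "AE t in lborel. norm ((1 + norm (Complex c t)) ^ n * exp (Re (Complex c t) * r) * norm (f t)) \<le>
      norm (((1 + \<bar>c\<bar>) ^ n * exp (c * r)) * ((1 + \<bar>t\<bar>) ^ n * norm (f t)))"
    proof (rule AE_I2)
      fix t :: real
      have "1 + norm (Complex c t) \<le> (1 + \<bar>c\<bar>) * (1 + \<bar>t\<bar>)"
      proof -
        have "0 \<le> \<bar>c\<bar> * \<bar>t\<bar>" by simp
        then have "\<bar>c\<bar> + \<bar>t\<bar> + 1 \<le> (1 + \<bar>c\<bar>) * (1 + \<bar>t\<bar>)" by (simp add: algebra_simps)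
        then show ?thesis using cmod_le[of "Complex c t"] by simp
      qed
      then have "(1 + norm (Complex c t)) ^ n \<le> (1 + \<bar>c\<bar>) ^ n * (1 + \<bar>t\<bar>) ^ n"
        by (simp only: power_mult_distrib[symmetric]) (intro power_mono, auto)
      then have "(1 + norm (Complex c t)) ^ n * (exp (c * r) * norm (f t)) \<le> ((1 + \<bar>c\<bar>) ^ n * (1 + \<bar>t\<bar>) ^ n) * (exp (c * r) * norm (f t))"
        by (intro mult_right_mono) auto
      then show "norm ((1 + norm (Complex c t)) ^ n * exp (Re (Complex c t) * r) * norm (f t)) \<le>
        norm (((1 + \<bar>c\<bar>) ^ n * exp (c * r)) * ((1 + \<bar>t\<bar>) ^ n * norm (f t)))"
        by (simp add: abs_mult mult_ac)
    qed
  qed measurable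
qed

lemma tendsto_vertical_integral:
  assumes int: "integrable lborel (\<lambda>t. f (Complex c t))" and cont: "continuous_on UNIV (\<lambda>t. f (Complex c t))"
  shows "((\<lambda>T. vertical_integral c T f) \<longlongrightarrow> \<i> * (\<integral>t. f (Complex c t) \<partial>lborel)) at_top"
proof -
  define g where "g = (\<lambda>t. f (Complex c t))"
  note [measurable] = borel_measurable_integrable[OF int[folded g_def]]
  have "((\<lambda>T. \<integral>t. indicator {-T..T} t *\<^sub>R g t \<partial>lborel) \<longlongrightarrow> (\<integral>t. g t \<partial>lborel)) at_top"
  proof (rule integral_dominated_convergence_at_top[where w = "\<lambda>t. norm (g t)"])
    show "\<forall>\<^sub>F T in at_top. AE t in lborel. norm (indicator {-T..T} t *\<^sub>R g t) \<le> norm (g t)"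
      by (intro always_eventually allI AE_I2) (auto simp: indicator_def)
    show "AE t in lborel. ((\<lambda>T. indicator {-T..T} t *\<^sub>R g t) \<longlongrightarrow> g t) at_top"
    proof (rule AE_I2)
      fix t :: real
      have "\<forall>\<^sub>F T in at_top. indicator {-T..T} t *\<^sub>R g t = g t"
        using eventually_ge_at_top[of "\<bar>t\<bar>"] by eventually_elim (auto simp: indicator_def)
      then show "((\<lambda>T. indicator {-T..T} t *\<^sub>R g t) \<longlongrightarrow> g t) at_top" by (rule tendsto_eventually)
    qed
  qed (use int in \<open>auto simp: g_def\<close>)
  then have "((\<lambda>T. \<i> * (\<integral>t. indicator {-T..T} t *\<^sub>R g t \<partial>lborel)) \<longlongrightarrow> \<i> * (\<integral>t. g t \<partial>lborel)) at_top"
    by (intro tendsto_intros)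
  then show ?thesis
    unfolding g_def[symmetric]
  proof (rule Lim_transform_eventually)
    show "\<forall>\<^sub>F T in at_top. \<i> * (\<integral>t. indicator {-T..T} t *\<^sub>R g t \<partial>lborel) = vertical_integral c T f"
      using eventually_gt_at_top[of 0]
    proof eventually_elim
      case (elim T)
      have cl: "continuous_on {-T..T} (\<lambda>t. f (Complex c t))" by (rule continuous_on_subset[OF cont]) simp
      have "set_integrable lborel {-T..T} g"
        unfolding set_integrable_def g_def by (rule integrable_mult_indicator[OF _ int]) simp
      then have "(\<integral>t. indicator {-T..T} t *\<^sub>R g t \<partial>lborel) = integral {-T..T} g"
        using set_borel_integral_eq_integral(2)[of "{-T..T}" g] by (simp add: set_lebesgue_integral_def)
      then show ?case using vertical_integral_eq[OF elim cl] by (simp add: g_def)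
    qed
  qed
qed

text \<open>A single factor of the product supplies the whole decay; the others are merely bounded
  on the strip away from the real axis.\<close>

lemma norm_Gamma_prod_vertical_decay:
  fixes a :: "nat \<Rightarrow> real" and c d :: real
  assumes "finite J" "J \<noteq> {}"
  shows "\<exists>C. C \<ge> 0 \<and> (\<forall>\<sigma> t. c \<le> \<sigma> \<longrightarrow> \<sigma> \<le> d \<longrightarrow> \<bar>t\<bar> \<ge> 1 \<longrightarrow>
    norm (\<Prod>j\<in>J. Gamma (Complex (a j - \<sigma>) (- t))) * \<bar>t\<bar> ^ n \<le> C)"
  using assms
proof (induction J arbitrary: n rule: finite_ne_induct)
  case (singleton j)
  obtain C where C: "C \<ge> 0" "\<And>u t. a j - d \<le> u \<Longrightarrow> u \<le> a j - c \<Longrightarrow> \<bar>t\<bar> \<ge> 1 \<Longrightarrow> norm (Gamma (Complex u t)) * \<bar>t\<bar> ^ n \<le> C"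
    by (rule norm_Gamma_vertical_decay[of "a j - d" "a j - c" n]) blast
  have "norm (Gamma (Complex (a j - \<sigma>) (- t))) * \<bar>t\<bar> ^ n \<le> C" if "c \<le> \<sigma>" "\<sigma> \<le> d" "\<bar>t\<bar> \<ge> 1" for \<sigma> t
    using C(2)[of "a j - \<sigma>" "- t"] that by simp
  then show ?case using C(1) by auto
next
  case (insert j J)
  obtain C where C: "C \<ge> 0" "\<And>u t. a j - d \<le> u \<Longrightarrow> u \<le> a j - c \<Longrightarrow> \<bar>t\<bar> \<ge> 1 \<Longrightarrow> norm (Gamma (Complex u t)) * \<bar>t\<bar> ^ 0 \<le> C"
    by (rule norm_Gamma_vertical_decay[of "a j - d" "a j - c" 0]) blast
  obtain C' where C': "C' \<ge> 0" "\<And>\<sigma> t. c \<le> \<sigma> \<Longrightarrow> \<sigma> \<le> d \<Longrightarrow> \<bar>t\<bar> \<ge> 1 \<Longrightarrow>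
    norm (\<Prod>j\<in>J. Gamma (Complex (a j - \<sigma>) (- t))) * \<bar>t\<bar> ^ n \<le> C'"
    using insert.IH[of n] by blast
  have "norm (\<Prod>j\<in>insert j J. Gamma (Complex (a j - \<sigma>) (- t))) * \<bar>t\<bar> ^ n \<le> C * C'" if "c \<le> \<sigma>" "\<sigma> \<le> d" "\<bar>t\<bar> \<ge> 1" for \<sigma> t
  proof -
    have "norm (\<Prod>j\<in>insert j J. Gamma (Complex (a j - \<sigma>) (- t))) * \<bar>t\<bar> ^ n =
        norm (Gamma (Complex (a j - \<sigma>) (- t))) * (norm (\<Prod>j\<in>J. Gamma (Complex (a j - \<sigma>) (- t))) * \<bar>t\<bar> ^ n)"
      using insert by (simp add: norm_mult)
    also have "\<dots> \<le> C * C'"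
      using C(2)[of "a j - \<sigma>" "- t"] C'(2)[of \<sigma> t] C that by (intro mult_mono) auto
    finally show ?thesis .
  qed
  then show ?case using C(1) C'(1) by (intro exI[of _ "C * C'"]) auto
qed

text \<open>The growth of 1/Gamma(1+s) is offset by the one factor with index \<open>i\<close>, up
  to a power |t|^K, and the remaining factors outweigh that power. This is where at least two Gamma
  factors, that is \<open>M >= 2\<close>, are indispensable.\<close>

lemma norm_rGamma_Gamma_prod_vertical_decay:
  fixes a :: "nat \<Rightarrow> real" and c d :: real
  assumes "finite J" "J \<noteq> {}" "i \<notin> J"
  shows "\<exists>C T0. T0 \<ge> 1 \<and> (\<forall>\<sigma> t. c \<le> \<sigma> \<longrightarrow> \<sigma> \<le> d \<longrightarrow> \<bar>t\<bar> \<ge> T0 \<longrightarrow>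
    norm (rGamma (Complex (1 + \<sigma>) t) * (\<Prod>j\<in>insert i J. Gamma (Complex (a j - \<sigma>) (- t)))) * \<bar>t\<bar> ^ n \<le> C)"
proof -
  obtain C K T0 where R: "C \<ge> 0" "T0 \<ge> 1" "\<And>u v t. a i - d \<le> u \<Longrightarrow> u \<le> a i - c \<Longrightarrow> 1 + c \<le> v \<Longrightarrow> v \<le> 1 + d \<Longrightarrow> \<bar>t\<bar> \<ge> T0 \<Longrightarrow>
    norm (Gamma (Complex u t)) \<le> C * \<bar>t\<bar> ^ K * norm (Gamma (Complex v t))"
    by (rule norm_Gamma_vertical_ratio[of "a i - d" "a i - c" "1 + c" "1 + d"]) blast
  obtain C' where C': "C' \<ge> 0" "\<And>\<sigma> t. c \<le> \<sigma> \<Longrightarrow> \<sigma> \<le> d \<Longrightarrow> \<bar>t\<bar> \<ge> 1 \<Longrightarrow>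
    norm (\<Prod>j\<in>J. Gamma (Complex (a j - \<sigma>) (- t))) * \<bar>t\<bar> ^ (K + n) \<le> C'"
    using norm_Gamma_prod_vertical_decay[OF assms(1,2), of c d a "K + n"] by blast
  have "norm (rGamma (Complex (1 + \<sigma>) t) * (\<Prod>j\<in>insert i J. Gamma (Complex (a j - \<sigma>) (- t)))) * \<bar>t\<bar> ^ n \<le> C * C'"
    if "c \<le> \<sigma>" "\<sigma> \<le> d" "\<bar>t\<bar> \<ge> T0" for \<sigma> t
  proof -
    have "Complex (1 + \<sigma>) t \<notin> \<int>\<^sub>\<le>\<^sub>0" using R(2) that by (intro not_nonpos_Int_of_Im) auto
    then have G: "norm (Gamma (Complex (1 + \<sigma>) t)) > 0" by (simp add: Gamma_eq_zero_iff)
    have "norm (Gamma (Complex (a i - \<sigma>) (- t))) \<le> C * \<bar>t\<bar> ^ K * norm (Gamma (Complex (1 + \<sigma>) t))"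
      using R(3)[of "a i - \<sigma>" "1 + \<sigma>" t] that by (simp add: norm_Gamma_Complex_minus)
    then have 1: "norm (rGamma (Complex (1 + \<sigma>) t)) * norm (Gamma (Complex (a i - \<sigma>) (- t))) \<le> C * \<bar>t\<bar> ^ K"
      using G by (simp only: rGamma_inverse_Gamma norm_inverse) (simp add: field_simps)
    have "norm (rGamma (Complex (1 + \<sigma>) t) * (\<Prod>j\<in>insert i J. Gamma (Complex (a j - \<sigma>) (- t)))) * \<bar>t\<bar> ^ n =
        (norm (rGamma (Complex (1 + \<sigma>) t)) * norm (Gamma (Complex (a i - \<sigma>) (- t)))) * (norm (\<Prod>j\<in>J. Gamma (Complex (a j - \<sigma>) (- t))) * \<bar>t\<bar> ^ n)"
      using assms by (simp add: norm_mult)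
    also have "\<dots> \<le> (C * \<bar>t\<bar> ^ K) * (norm (\<Prod>j\<in>J. Gamma (Complex (a j - \<sigma>) (- t))) * \<bar>t\<bar> ^ n)"
      by (intro mult_right_mono 1) auto
    also have "\<dots> = C * (norm (\<Prod>j\<in>J. Gamma (Complex (a j - \<sigma>) (- t))) * \<bar>t\<bar> ^ (K + n))"
      by (simp add: power_add)
    also have "\<dots> \<le> C * C'" using C'(2)[of \<sigma> t] R that by (intro mult_left_mono) auto
    finally show ?thesis .
  qed
  then show ?thesis using R(2) by blast
qed

section \<open>Gamma products on a line, and Mellin inversion of Gamma\<close>

definition Gamma_line :: "nat set \<Rightarrow> (nat \<Rightarrow> real) \<Rightarrow> real \<Rightarrow> real \<Rightarrow> complex" where
  "Gamma_line J a c t = (\<Prod>j\<in>J. Gamma (Complex (a j - c) (- t)))"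

lemma continuous_on_Gamma_line:
  assumes "\<And>j. j \<in> J \<Longrightarrow> c < a j"
  shows "continuous_on UNIV (Gamma_line J a c)"
proof -
  have "continuous_on UNIV (\<lambda>t. Gamma (Complex (a j - c) (- t)))" if "j \<in> J" for j
  proof (rule continuous_on_compose2[OF continuous_on_Gamma])
    show "continuous_on UNIV (\<lambda>t. Complex (a j - c) (- t))"
      unfolding Complex_eq by (intro continuous_intros)
    show "{z. Re z > 0} \<inter> \<int>\<^sub>\<le>\<^sub>0 = {}" using not_nonpos_Int_of_Re_pos by auto
  qed (use assms[OF that] in auto)
  then show ?thesis unfolding Gamma_line_def by (intro continuous_intros) auto
qed

lemma rapidly_decreasing_Gamma_line:
  assumes "finite J" "J \<noteq> {}" "\<And>j. j \<in> J \<Longrightarrow> c < a j"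
  shows "rapidly_decreasing (Gamma_line J a c)"
proof (rule rapidly_decreasingI)
  show "continuous_on UNIV (Gamma_line J a c)" by (rule continuous_on_Gamma_line) (rule assms)
  show "\<exists>C T0. \<forall>t. \<bar>t\<bar> \<ge> T0 \<longrightarrow> norm (Gamma_line J a c t) * \<bar>t\<bar> ^ n \<le> C" for n
    using norm_Gamma_prod_vertical_decay[OF assms(1,2), of c c a n] unfolding Gamma_line_def by blast
qed

lemma rapidly_decreasing_rGamma_Gamma_line:
  assumes "finite J" "card J \<ge> 2" "\<And>j. j \<in> J \<Longrightarrow> c < a j"
  shows "rapidly_decreasing (\<lambda>t. rGamma (Complex (1 + c) t) * Gamma_line J a c t)"
proof (rule rapidly_decreasingI)
  have "continuous_on UNIV (\<lambda>t. rGamma (Complex (1 + c) t))"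
    by (rule continuous_on_compose2[OF continuous_on_rGamma continuous_on_Complex_line]) auto
  then show "continuous_on UNIV (\<lambda>t. rGamma (Complex (1 + c) t) * Gamma_line J a c t)"
    by (intro continuous_intros continuous_on_Gamma_line assms)
  obtain i where i: "i \<in> J" using assms(2) by fastforce
  have J: "J = insert i (J - {i})" using i by auto
  have "card (J - {i}) \<ge> 1" using assms i by simp
  then have ne: "J - {i} \<noteq> {}" by (metis card.empty not_one_le_zero)
  show "\<exists>C T0. \<forall>t. \<bar>t\<bar> \<ge> T0 \<longrightarrow> norm (rGamma (Complex (1 + c) t) * Gamma_line J a c t) * \<bar>t\<bar> ^ n \<le> C" for n
    using norm_rGamma_Gamma_prod_vertical_decay[OF _ ne, of i c c a n] assms(1) J unfolding Gamma_line_def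
    by (metis Diff_iff finite_Diff order_refl singletonI)
qed

text \<open>The left-hand terms are the residues of Gamma(a - s) y^s with reversed sign, so this
  evaluates the closed contour.\<close>

lemma exp_mult_ln_sums_power:
  fixes a y :: real
  assumes "y > 0"
  shows "(\<lambda>k. (- 1) ^ k / fact k * exp ((of_real a + of_nat k) * of_real (ln y))) sums complex_of_real (y powr a * exp (- y))"
proof -
  have e: "(- 1) ^ k / fact k * exp ((of_real a + of_nat k) * of_real (ln y)) =
      complex_of_real (y powr a * ((- y) ^ k /\<^sub>R fact k))" for k
  proof -
    have "exp ((complex_of_real a + of_nat k) * of_real (ln y)) = of_real (exp ((a + real k) * ln y))"
      by (simp add: exp_of_real[symmetric])
    also have "exp ((a + real k) * ln y) = y powr a * y ^ k"
      using assms by (simp add: powr_def ring_distribs exp_add exp_of_nat_mult)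
    finally show ?thesis by (simp add: power_minus[of y] field_simps)
  qed
  have "(\<lambda>k. y powr a * ((- y) ^ k /\<^sub>R fact k)) sums (y powr a * exp (- y))"
    by (intro sums_mult exp_converges)
  then show ?thesis unfolding e by (rule sums_of_real)
qed

lemma norm_exp_mult_ln_le:
  assumes "c \<le> \<sigma>" "\<sigma> \<le> d"
  shows "norm (exp (Complex \<sigma> t * of_real (ln y))) \<le> exp (max \<bar>c\<bar> \<bar>d\<bar> * \<bar>ln y\<bar>)"
proof -
  have "\<sigma> * ln y \<le> \<bar>\<sigma>\<bar> * \<bar>ln y\<bar>" using abs_ge_self[of "\<sigma> * ln y"] by (simp add: abs_mult)
  also have "\<dots> \<le> max \<bar>c\<bar> \<bar>d\<bar> * \<bar>ln y\<bar>" using assms by (intro mult_right_mono) auto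
  finally show ?thesis by simp
qed

lemma exp_half_line:
  assumes "y > 0"
  shows "norm (exp (Complex (a + real n + 1/2) t * of_real (ln y))) = exp ((a + 1/2) * ln y) * y ^ n"
  using assms by (simp add: ring_distribs exp_add exp_of_nat_mult)

text \<open>The limit of the truncated vertical integral is computed twice: as the absolutely
  convergent integral over the line, and as the residue sum obtained by closing to the right.
  Uniqueness of limits gives the inversion formula pointwise, with no regularity theory for Mellin
  transforms.\<close>

lemma Gamma_Mellin_inversion:
  fixes a c y :: real
  assumes c: "c < a" and y: "y > 0"
  shows "gpow lborel (Complex c) (\<lambda>t. Gamma (Complex (a - c) (- t))) y = of_real (2 * pi * (y powr a * exp (- y)))"
proof -
  define h where "h = (\<lambda>s. exp (s * complex_of_real (ln y)))"
  define f where "f = (\<lambda>s. Gamma (of_real a - s) * h s)"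
  have f_line: "f (Complex c t) = Gamma (Complex (a - c) (- t)) * exp (Complex c t * of_real (ln y))" for t
  proof -
    have "of_real a - Complex c t = Complex (a - c) (- t)" by (simp add: complex_eq_iff)
    then show ?thesis by (simp add: f_def h_def)
  qed
  have rd: "rapidly_decreasing (\<lambda>t. Gamma (Complex (a - c) (- t)))"
    using rapidly_decreasing_Gamma_line[of "{0}" c "\<lambda>_. a"] c by (simp add: Gamma_line_def[abs_def])
  have int: "integrable lborel (\<lambda>t. f (Complex c t))"
    unfolding f_line by (rule gpow_ok_integrable[OF rapidly_decreasing_gpow_ok[OF rd]])
  have cont: "continuous_on UNIV (\<lambda>t. f (Complex c t))"
    unfolding f_line using rd
    by (intro continuous_intros) (auto simp: rapidly_decreasing_def)
  have 1: "((\<lambda>T. vertical_integral c T f) \<longlongrightarrow> \<i> * (\<integral>t. f (Complex c t) \<partial>lborel)) at_top"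
    by (rule tendsto_vertical_integral[OF int cont])
  have 2: "((\<lambda>T. vertical_integral c T f) \<longlongrightarrow> 2 * of_real pi * \<i> * of_real (y powr a * exp (- y))) at_top"
    unfolding f_def
  proof (rule vertical_integral_Gamma_residue_sum[where y = y and C = "norm (Gamma (1/2 :: real)) * exp ((a + 1/2) * ln y)"])
    show "h holomorphic_on UNIV" unfolding h_def by (intro holomorphic_intros)
    show "(\<lambda>k. (- 1) ^ k / fact k * h (of_real a + of_nat k)) sums complex_of_real (y powr a * exp (- y))"
      unfolding h_def by (rule exp_mult_ln_sums_power[OF y])
    show "norm (Gamma (Complex (1/2) (- t))) * norm (h (Complex (a + real n + 1/2) t)) \<le>
        norm (Gamma (1/2 :: real)) * exp ((a + 1/2) * ln y) * y ^ n" for n t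
      unfolding h_def exp_half_line[OF y] mult.assoc
      using norm_Gamma_le_Gamma_Re[of "Complex (1/2) (- t)"] y by (intro mult_right_mono) auto
    fix d \<epsilon> :: real assume e: "\<epsilon> > 0"
    define B where "B = exp (max \<bar>c\<bar> \<bar>d\<bar> * \<bar>ln y\<bar>)"
    obtain C where C: "C \<ge> 0" "\<And>u t. a - d \<le> u \<Longrightarrow> u \<le> a - c \<Longrightarrow> \<bar>t\<bar> \<ge> 1 \<Longrightarrow> norm (Gamma (Complex u t)) * \<bar>t\<bar> ^ 1 \<le> C"
      by (rule norm_Gamma_vertical_decay[of "a - d" "a - c" 1]) blast
    have bound: "norm (Gamma (Complex (a - \<sigma>) (- t)) * h (Complex \<sigma> t)) \<le> \<epsilon>"
      if t: "\<bar>t\<bar> \<ge> max 1 (C * B / \<epsilon>)" and \<sigma>: "\<sigma> \<in> {c..d}" for \<sigma> t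
    proof -
      have t1: "\<bar>t\<bar> \<ge> 1" using t by simp
      have "norm (Gamma (Complex (a - \<sigma>) (- t))) \<le> C / \<bar>t\<bar>"
        using C(2)[of "a - \<sigma>" "- t"] \<sigma> t1 by (simp add: pos_le_divide_eq)
      then have "norm (Gamma (Complex (a - \<sigma>) (- t)) * h (Complex \<sigma> t)) \<le> C / \<bar>t\<bar> * B"
        unfolding norm_mult h_def B_def using \<sigma> C t1 by (intro mult_mono norm_exp_mult_ln_le) auto
      also have "\<dots> \<le> \<epsilon>" using t t1 e by (simp add: field_simps)
      finally show ?thesis .
    qed
    show "\<exists>T0. \<forall>T\<ge>T0. \<forall>\<sigma>\<in>{c..d}. norm (Gamma (Complex (a - \<sigma>) (- T)) * h (Complex \<sigma> T)) \<le> \<epsilon> \<and>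
        norm (Gamma (Complex (a - \<sigma>) T) * h (Complex \<sigma> (- T))) \<le> \<epsilon>"
    proof (intro exI[of _ "max 1 (C * B / \<epsilon>)"] allI impI ballI conjI)
      fix T \<sigma> :: real assume T: "T \<ge> max 1 (C * B / \<epsilon>)" and \<sigma>: "\<sigma> \<in> {c..d}"
      show "norm (Gamma (Complex (a - \<sigma>) (- T)) * h (Complex \<sigma> T)) \<le> \<epsilon>" using bound[of T \<sigma>] T \<sigma> by simp
      show "norm (Gamma (Complex (a - \<sigma>) T) * h (Complex \<sigma> (- T))) \<le> \<epsilon>" using bound[of "- T" \<sigma>] T \<sigma> by simp
    qed
  qed (use c y in auto)
  have "\<i> * (\<integral>t. f (Complex c t) \<partial>lborel) = 2 * of_real pi * \<i> * of_real (y powr a * exp (- y))"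
    by (rule tendsto_unique[OF _ 1 2]) simp
  then have "(\<integral>t. f (Complex c t) \<partial>lborel) = 2 * of_real pi * of_real (y powr a * exp (- y))"
    by (simp add: mult_ac)
  then show ?thesis unfolding gpow_def f_line[symmetric] by simp
qed

section \<open>The Meijer G-function\<close>

text \<open>Every factor after the first is at least 1; the minimum also covers the empty
  product.\<close>

lemma pochhammer_real_ge:
  fixes x :: real
  assumes "x > 0"
  shows "min 1 x \<le> pochhammer x n"
proof (cases n)
  case (Suc m)
  have "1 \<le> pochhammer (x + 1) m"
    unfolding pochhammer_prod using assms by (intro prod_ge_1) auto
  then have "x * 1 \<le> x * pochhammer (x + 1) m" using assms by (intro mult_left_mono) auto
  then show ?thesis unfolding Suc pochhammer_rec by simp
qed simp

text \<open>The number a + n + 3/2 is the real part of 1 + s on the right edge Re s = a + n + 1/2.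
  The bound must depend neither on n nor on t. Comparison of Gamma quotients along horizontals
  reduces it to real arguments, and the factor 1/2 is the lower bound for the Pochhammer symbol at a
  + 3/2 > 1/2.\<close>

lemma norm_Gamma_ratio_half_bound:
  assumes a: "a > -1"
  shows "norm (Gamma (Complex (1/2) (- t))) * norm (rGamma (Complex (a + real n + 3/2) t)) \<le>
    Gamma (1/2) / (Gamma (a + 3/2) * (1/2))"
proof -
  define b where "b = a + real n + 3/2"
  have b: "b \<ge> 1/2" "b > 0" using a by (auto simp: b_def)
  have "Complex b t \<notin> \<int>\<^sub>\<le>\<^sub>0" using b by (intro not_nonpos_Int_of_Re_pos) auto
  then have G: "norm (Gamma (Complex b t)) > 0" by (simp add: Gamma_eq_zero_iff)
  have Gb: "Gamma b > 0" using b by simp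
  have "norm (Gamma (Complex (1/2) (- t))) * Gamma b \<le> norm (Gamma (Complex b t)) * Gamma (1/2)"
    using norm_Gamma_ratio_le_real[of "1/2" b "- t"] b by (simp add: norm_Gamma_Complex_minus)
  then have "norm (Gamma (Complex (1/2) (- t))) * norm (rGamma (Complex b t)) \<le> Gamma (1/2) / Gamma b"
    using G Gb by (simp only: rGamma_inverse_Gamma norm_inverse) (simp add: field_simps)
  also have "\<dots> \<le> Gamma (1/2) / (Gamma (a + 3/2) * (1/2))"
  proof (rule divide_left_mono)
    have a3: "a + 3/2 > 0" using a by simp
    have "Gamma b = Gamma (a + 3/2) * pochhammer (a + 3/2) n"
      using pochhammer_Gamma[OF not_nonpos_Int_of_pos[OF a3], of n] a3
      by (simp add: b_def Gamma_eq_zero_iff not_nonpos_Int_of_pos add_ac)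
    moreover have "1/2 \<le> pochhammer (a + 3/2) n"
      using pochhammer_real_ge[OF a3, of n] a by (simp add: min_def split: if_splits)
    ultimately show "Gamma (a + 3/2) * (1/2) \<le> Gamma b"
      using a3 by (simp add: mult_left_mono del: times_divide_eq_right mult_1_right)
    show "0 < Gamma b * (Gamma (a + 3/2) * (1/2))" using Gb a3 by simp
  qed simp
  finally show ?thesis by (simp add: b_def)
qed

text \<open>
  The condition \<open>c > (a - 1) / 2\<close> says \<open>1 + \<sigma> > a - \<sigma>\<close> for \<open>\<sigma> \<ge> c\<close>, so the quotient
  \<open>\<Gamma>(a - s) / \<Gamma>(1 + s)\<close> tends to zero along horizontal edges.
\<close>

lemma vertical_integral_Bessel:
  fixes a c y :: real
  assumes a: "a > -1" and c: "c < a" "c > (a - 1) / 2" and y: "y > 0"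
    and S: "(\<lambda>k. (- 1) ^ k / fact k * (rGamma (1 + (of_real a + of_nat k)) * exp ((of_real a + of_nat k) * of_real (ln y)))) sums S"
  shows "((\<lambda>T. vertical_integral c T (\<lambda>s. Gamma (of_real a - s) * (rGamma (1 + s) * exp (s * of_real (ln y))))) \<longlongrightarrow> 2 * of_real pi * \<i> * S) at_top"
proof (rule vertical_integral_Gamma_residue_sum[where y = y and C = "Gamma (1/2) / (Gamma (a + 3/2) * (1/2)) * exp ((a + 1/2) * ln y)"])
  define h where "h = (\<lambda>s. rGamma (1 + s) * exp (s * complex_of_real (ln y)))"
  have h_Complex: "h (Complex \<sigma> t) = rGamma (Complex (1 + \<sigma>) t) * exp (Complex \<sigma> t * of_real (ln y))" for \<sigma> t
  proof -
    have "1 + Complex \<sigma> t = Complex (1 + \<sigma>) t" by (simp add: complex_eq_iff)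
    then show ?thesis by (simp add: h_def)
  qed
  show "(\<lambda>s. rGamma (1 + s) * exp (s * complex_of_real (ln y))) holomorphic_on UNIV" by (intro holomorphic_intros)
  show "norm (Gamma (Complex (1/2) (- t))) * norm (rGamma (1 + Complex (a + real n + 1/2) t) * exp (Complex (a + real n + 1/2) t * of_real (ln y))) \<le>
      Gamma (1/2) / (Gamma (a + 3/2) * (1/2)) * exp ((a + 1/2) * ln y) * y ^ n" for n t
  proof -
    have e: "1 + Complex (a + real n + 1/2) t = Complex (a + real n + 3/2) t" by (simp add: complex_eq_iff)
    have "norm (Gamma (Complex (1/2) (- t))) * norm (rGamma (Complex (a + real n + 3/2) t)) * (exp ((a + 1/2) * ln y) * y ^ n) \<le>
        Gamma (1/2) / (Gamma (a + 3/2) * (1/2)) * (exp ((a + 1/2) * ln y) * y ^ n)"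
      using norm_Gamma_ratio_half_bound[OF a, of t n] y by (intro mult_right_mono) auto
    then show ?thesis unfolding e norm_mult[of "rGamma _"] exp_half_line[OF y] by (simp only: mult.assoc)
  qed
  fix d \<epsilon> :: real assume e: "\<epsilon> > 0"
  define B where "B = exp (max \<bar>c\<bar> \<bar>d\<bar> * \<bar>ln y\<bar>)"
  define \<delta> where "\<delta> = 1 + 2 * c - a"
  have \<delta>: "\<delta> > 0" using c by (simp add: \<delta>_def field_simps)
  \<comment> \<open>Makes exp(-L \<delta>) <= \<epsilon> / B. The growth lemma allows any rate L at
    the cost of a larger height, so a horizontal gap \<delta> between the two Gamma arguments,
    however small, forces the quotient below any given bound.\<close>
  define L where "L = \<bar>ln (B / \<epsilon>)\<bar> / \<delta>"
  have B: "B > 0" by (simp add: B_def)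
  have L: "L \<ge> 0" using \<delta> by (simp add: L_def)
  obtain T0 where T0: "T0 \<ge> 1" "\<And>\<sigma> \<tau> t. a - d \<le> \<sigma> \<Longrightarrow> \<sigma> \<le> \<tau> \<Longrightarrow> \<bar>t\<bar> \<ge> T0 \<Longrightarrow>
    norm (Gamma (Complex \<sigma> t)) * exp (L * (\<tau> - \<sigma>)) \<le> norm (Gamma (Complex \<tau> t))"
    by (rule norm_Gamma_vertical_growth[of "a - d" L]) blast
  have bound: "norm (Gamma (Complex (a - \<sigma>) (- t)) * h (Complex \<sigma> t)) \<le> \<epsilon>"
    if t: "\<bar>t\<bar> \<ge> T0" and \<sigma>: "\<sigma> \<in> {c..d}" for \<sigma> t
  proof -
    have ord: "1 + \<sigma> - (a - \<sigma>) \<ge> \<delta>" using \<sigma> by (simp add: \<delta>_def)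
    have "Complex (1 + \<sigma>) t \<notin> \<int>\<^sub>\<le>\<^sub>0" using T0(1) t by (intro not_nonpos_Int_of_Im) auto
    then have G: "norm (Gamma (Complex (1 + \<sigma>) t)) > 0" by (simp add: Gamma_eq_zero_iff)
    have "norm (Gamma (Complex (a - \<sigma>) (- t))) * exp (L * \<delta>) \<le> norm (Gamma (Complex (a - \<sigma>) (- t))) * exp (L * (1 + \<sigma> - (a - \<sigma>)))"
      using ord L by (intro mult_left_mono) (auto intro!: mult_left_mono)
    also have "\<dots> \<le> norm (Gamma (Complex (1 + \<sigma>) (- t)))"
      using T0(2)[of "a - \<sigma>" "1 + \<sigma>" "- t"] t \<sigma> ord \<delta> by simp
    finally have "norm (Gamma (Complex (a - \<sigma>) (- t))) * norm (rGamma (Complex (1 + \<sigma>) t)) \<le> exp (- (L * \<delta>))"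
      using G by (simp only: rGamma_inverse_Gamma norm_inverse norm_Gamma_Complex_minus exp_minus) (simp add: field_simps)
    also have "\<dots> \<le> exp (- ln (B / \<epsilon>))" using \<delta> by (simp add: L_def)
    also have "\<dots> = \<epsilon> / B" using B e by (simp add: exp_minus)
    finally have 1: "norm (Gamma (Complex (a - \<sigma>) (- t))) * norm (rGamma (Complex (1 + \<sigma>) t)) \<le> \<epsilon> / B" .
    have "norm (Gamma (Complex (a - \<sigma>) (- t)) * h (Complex \<sigma> t)) =
        norm (Gamma (Complex (a - \<sigma>) (- t))) * norm (rGamma (Complex (1 + \<sigma>) t)) * norm (exp (Complex \<sigma> t * of_real (ln y)))"
      by (simp only: h_Complex norm_mult mult.assoc)
    also have "\<dots> \<le> \<epsilon> / B * B"
      unfolding B_def using 1 \<sigma> e B by (intro mult_mono norm_exp_mult_ln_le) (auto simp: B_def)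
    also have "\<dots> = \<epsilon>" using B by simp
    finally show ?thesis .
  qed
  show "\<exists>T0. \<forall>T\<ge>T0. \<forall>\<sigma>\<in>{c..d}. norm (Gamma (Complex (a - \<sigma>) (- T)) * (rGamma (1 + Complex \<sigma> T) * exp (Complex \<sigma> T * complex_of_real (ln y)))) \<le> \<epsilon> \<and>
      norm (Gamma (Complex (a - \<sigma>) T) * (rGamma (1 + Complex \<sigma> (- T)) * exp (Complex \<sigma> (- T) * complex_of_real (ln y)))) \<le> \<epsilon>"
  proof (intro exI[of _ T0] allI impI ballI conjI)
    fix T \<sigma> :: real assume T: "T \<ge> T0" and \<sigma>: "\<sigma> \<in> {c..d}"
    show "norm (Gamma (Complex (a - \<sigma>) (- T)) * (rGamma (1 + Complex \<sigma> T) * exp (Complex \<sigma> T * complex_of_real (ln y)))) \<le> \<epsilon>"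
      using bound[of T \<sigma>] T \<sigma> T0(1) by (simp add: h_def)
    show "norm (Gamma (Complex (a - \<sigma>) T) * (rGamma (1 + Complex \<sigma> (- T)) * exp (Complex \<sigma> (- T) * complex_of_real (ln y)))) \<le> \<epsilon>"
      using bound[of "- T" \<sigma>] T \<sigma> T0(1) by (simp add: h_def)
  qed
qed (use c y S in auto)

text \<open>Writing 1/Gamma(1+s) as the entire function \<open>rGamma\<close> and the power as an
  exponential gives the form used with the holomorphy and residue lemmas.\<close>

lemma hard_edge_G_eq_Lim:
  assumes "y > 0"
  shows "hard_edge_G M a c y = Re (1 / (2 * of_real pi * \<i>) *
    Lim at_top (\<lambda>T. vertical_integral c T (\<lambda>s. rGamma (1 + s) * (\<Prod>j=1..M. Gamma (of_real (a j) - s)) * exp (s * of_real (ln y)))))"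
  using assms by (simp add: hard_edge_G_def vertical_integral_def rGamma_inverse_Gamma inverse_eq_divide powr_def Ln_of_real)

lemma hard_edge_G_one:
  assumes "a 1 > -1" "meijer_contour 1 a c" and y: "y > 0"
    and S: "(\<lambda>k. (- 1) ^ k / fact k * (rGamma (1 + (of_real (a 1) + of_nat k)) * exp ((of_real (a 1) + of_nat k) * of_real (ln y)))) sums S"
  shows "hard_edge_G 1 a c y = Re S"
proof -
  have c: "c < a 1" "c > (a 1 - 1) / 2" using assms(2) by (auto simp: meijer_contour_def)
  have "((\<lambda>T. vertical_integral c T (\<lambda>s. rGamma (1 + s) * (\<Prod>j=1..1. Gamma (of_real (a j) - s)) * exp (s * of_real (ln y)))) \<longlongrightarrow> 2 * of_real pi * \<i> * S) at_top"
    using vertical_integral_Bessel[OF assms(1) c y S] by (simp add: mult_ac)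
  then have "Lim at_top (\<lambda>T. vertical_integral c T (\<lambda>s. rGamma (1 + s) * (\<Prod>j=1..1. Gamma (of_real (a j) - s)) * exp (s * of_real (ln y)))) = 2 * of_real pi * \<i> * S"
    by (intro tendsto_Lim) auto
  then show ?thesis unfolding hard_edge_G_eq_Lim[OF y] by simp
qed

lemma Meijer_integrand_line:
  "rGamma (1 + Complex c t) * (\<Prod>j\<in>J. Gamma (of_real (a j) - Complex c t)) * exp (Complex c t * of_real (ln y)) =
    rGamma (Complex (1 + c) t) * Gamma_line J a c t * exp (Complex c t * of_real (ln y))"
proof -
  have "1 + Complex c t = Complex (1 + c) t" "of_real (a j) - Complex c t = Complex (a j - c) (- t)" for j
    by (simp_all add: complex_eq_iff)
  then show ?thesis by (simp add: Gamma_line_def)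
qed

text \<open>The abscissa \<open>c\<close> of the definition may be anywhere left of all
  \<open>a j\<close>, possibly below -1, while the representation needs a line with Re s > -1. Both
  lines lie left of every pole, so Cauchy's theorem on a growing rectangle moves one to the other;
  the horizontal edges vanish by the decay available for \<open>M >= 2\<close>.\<close>

lemma hard_edge_G_eq_line_integral:
  assumes M: "M \<ge> 2" and c: "\<And>j. j \<in> {1..M} \<Longrightarrow> c < a j" and c': "\<And>j. j \<in> {1..M} \<Longrightarrow> c' < a j" and y: "y > 0"
  shows "hard_edge_G M a c y = Re (gpow lborel (Complex c') (\<lambda>t. of_real (1 / (2 * pi)) * (rGamma (Complex (1 + c') t) * Gamma_line {1..M} a c' t)) y)"
proof -
  define f where "f = (\<lambda>s. rGamma (1 + s :: complex) * (\<Prod>j=1..M. Gamma (of_real (a j) - s)) * exp (s * of_real (ln y)))"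
  define I where "I = (\<lambda>u. \<integral>t. f (Complex u t) \<partial>lborel)"
  have lim: "((\<lambda>T. vertical_integral u T f) \<longlongrightarrow> \<i> * I u) at_top" if u: "\<And>j. j \<in> {1..M} \<Longrightarrow> u < a j" for u
  proof -
    have rd: "rapidly_decreasing (\<lambda>t. rGamma (Complex (1 + u) t) * Gamma_line {1..M} a u t)"
      by (rule rapidly_decreasing_rGamma_Gamma_line) (use M u in auto)
    show ?thesis
      unfolding I_def
    proof (rule tendsto_vertical_integral)
      show "integrable lborel (\<lambda>t. f (Complex u t))"
        unfolding f_def Meijer_integrand_line by (rule gpow_ok_integrable[OF rapidly_decreasing_gpow_ok[OF rd]])
      show "continuous_on UNIV (\<lambda>t. f (Complex u t))"
        unfolding f_def Meijer_integrand_line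
      proof (rule continuous_on_mult)
        show "continuous_on UNIV (\<lambda>t. rGamma (Complex (1 + u) t) * Gamma_line {1..M} a u t)"
          using rd unfolding rapidly_decreasing_def by blast
      qed (intro continuous_intros)
    qed
  qed
  have shift: "I u = I v" if uv: "u < v" and u: "\<And>j. j \<in> {1..M} \<Longrightarrow> u < a j" and v: "\<And>j. j \<in> {1..M} \<Longrightarrow> v < a j" for u v
  proof -
    define B where "B = exp (max \<bar>u\<bar> \<bar>v\<bar> * \<bar>ln y\<bar>)"
    have Mi: "{1..M} = insert 1 {2..M}" using M by auto
    obtain C T0 where C: "T0 \<ge> 1" "\<And>\<sigma> t. u \<le> \<sigma> \<Longrightarrow> \<sigma> \<le> v \<Longrightarrow> \<bar>t\<bar> \<ge> T0 \<Longrightarrow>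
        norm (rGamma (Complex (1 + \<sigma>) t) * (\<Prod>j\<in>insert 1 {2..M}. Gamma (Complex (a j - \<sigma>) (- t)))) * \<bar>t\<bar> ^ 1 \<le> C"
      using norm_rGamma_Gamma_prod_vertical_decay[of "{2..M}" 1 u v a 1] M by auto
    have C0: "C \<ge> 0"
      by (rule order_trans[OF _ C(2)[of u T0]]) (use uv C(1) in auto)
    have fb: "norm (f (Complex \<sigma> t)) \<le> C * B / \<bar>t\<bar>" if "u \<le> \<sigma>" "\<sigma> \<le> v" "\<bar>t\<bar> \<ge> T0" for \<sigma> t
    proof -
      have t: "\<bar>t\<bar> > 0" using that C(1) by linarith
      have "norm (rGamma (Complex (1 + \<sigma>) t) * Gamma_line {1..M} a \<sigma> t) \<le> C / \<bar>t\<bar>"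
        using C(2)[OF that] t unfolding Gamma_line_def Mi by (simp only: pos_le_divide_eq power_one_right)
      then have "norm (f (Complex \<sigma> t)) \<le> C / \<bar>t\<bar> * B"
        unfolding f_def Meijer_integrand_line norm_mult[of "_ * _" "exp _"] B_def using that C0
        by (intro mult_mono norm_exp_mult_ln_le) auto
      then show ?thesis by simp
    qed
    have hol: "f holomorphic_on {s. Re s < Min (a ` {1..M})}"
      unfolding f_def
    proof (intro holomorphic_intros)
      fix s j assume s: "s \<in> {s. Re s < Min (a ` {1..M})}" and j: "j \<in> {1..M}"
      have "Re s < a j" using s j M by auto
      then show "of_real (a j) - s \<notin> \<int>\<^sub>\<le>\<^sub>0" by (intro not_nonpos_Int_of_Re_pos) simp
    qed
    have vm: "v < Min (a ` {1..M})" using v M by (subst Min_gr_iff) auto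
    have "((\<lambda>T. vertical_integral u T f - vertical_integral v T f) \<longlongrightarrow> 0) at_top"
    proof (rule Lim_null_comparison)
      show "((\<lambda>T. 2 * (v - u) * (C * B / T)) \<longlongrightarrow> 0) at_top"
        by (intro tendsto_mult_right_zero real_tendsto_divide_at_top[OF tendsto_const] filterlim_ident)
      show "\<forall>\<^sub>F T in at_top. norm (vertical_integral u T f - vertical_integral v T f) \<le> 2 * (v - u) * (C * B / T)"
        using eventually_ge_at_top[of T0]
      proof eventually_elim
        case (elim T)
        let ?R = "rectpath (Complex u (- T)) (Complex v T)"
        have T: "T > 0" using elim C(1) by simp
        have sub: "path_image ?R \<subseteq> {s. Re s < Min (a ` {1..M})}"
          using path_image_rectpath_subset_cbox[of "Complex u (- T)" "Complex v T"] uv T vm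
          by (auto simp: in_cbox_complex_iff)
        have "(f has_contour_integral 0) ?R"
          by (rule Cauchy_theorem_convex_simple[OF hol convex_halfspace_Re_lt _ sub]) auto
        then have R0: "contour_integral ?R f = 0" by (rule contour_integral_unique)
        have "norm (vertical_integral u T f - vertical_integral v T f + contour_integral ?R f) \<le> 2 * (v - u) * (C * B / T)"
        proof (rule vertical_integral_shift_bound[OF uv T])
          show "continuous_on (path_image ?R) f"
            by (rule continuous_on_subset[OF holomorphic_on_imp_continuous_on[OF hol] sub])
          show "norm (f (Complex \<sigma> T)) \<le> C * B / T \<and> norm (f (Complex \<sigma> (- T))) \<le> C * B / T" if "u \<le> \<sigma>" "\<sigma> \<le> v" for \<sigma>
            using fb[OF that, of T] fb[OF that, of "- T"] elim T by simp
        qed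
        then show ?case by (simp add: R0)
      qed
    qed
    moreover have "((\<lambda>T. vertical_integral u T f - vertical_integral v T f) \<longlongrightarrow> \<i> * I u - \<i> * I v) at_top"
      by (intro tendsto_diff lim u v)
    ultimately have "\<i> * I u - \<i> * I v = 0" using tendsto_unique[OF trivial_limit_at_top_linorder] by blast
    then show ?thesis by simp
  qed
  have Icc: "I c = I c'"
    using shift[of c c'] shift[of c' c] c c' by (cases c c' rule: linorder_cases) auto
  have "Lim at_top (\<lambda>T. vertical_integral c T f) = \<i> * I c"
    by (intro tendsto_Lim lim c) auto
  then have "hard_edge_G M a c y = Re (1 / (2 * of_real pi * \<i>) * (\<i> * I c'))"
    unfolding hard_edge_G_eq_Lim[OF y] f_def[symmetric] Icc by simp
  also have "1 / (2 * of_real pi * \<i>) * (\<i> * I c') = of_real (1 / (2 * pi)) * I c'"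
    by simp
  also have "\<dots> = gpow lborel (Complex c') (\<lambda>t. of_real (1 / (2 * pi)) * (rGamma (Complex (1 + c') t) * Gamma_line {1..M} a c' t)) y"
    unfolding I_def f_def Meijer_integrand_line gpow_def mult.assoc[of "of_real _"] by (rule integral_mult_right_zero[symmetric])
  finally show ?thesis .
qed

section \<open>The product weight\<close>

lemma product_weight_Suc:
  "m \<ge> 1 \<Longrightarrow> product_weight (Suc m) a = mult_conv (product_weight m a) (laguerre_weight (a (Suc m)))"
  by (cases m) auto

lemma laguerre_weight_measurable [measurable]: "laguerre_weight b \<in> borel_measurable borel"
  unfolding laguerre_weight_def[abs_def] by measurable

lemma laguerre_weight_nonneg: "b > -1 \<Longrightarrow> laguerre_weight b x \<ge> 0"
  by (simp add: laguerre_weight_def Gamma_real_nonneg)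

lemma mult_conv_measurable:
  assumes [measurable]: "f \<in> borel_measurable borel" "g \<in> borel_measurable borel"
  shows "mult_conv f g \<in> borel_measurable borel"
proof -
  have "(\<lambda>x. \<integral>u. indicator {0<..} u *\<^sub>R (f (x / u) * g u / u) \<partial>lborel) \<in> borel_measurable borel"
    by (rule sigma_finite_measure.borel_measurable_lebesgue_integral[OF lborel.sigma_finite_measure_axioms]) measurable
  then show ?thesis by (simp add: mult_conv_def[abs_def] set_lebesgue_integral_def)
qed

lemma product_weight_measurable: "product_weight m a \<in> borel_measurable borel"
proof (induction m)
  case (Suc m)
  then show ?case
    by (cases "m = 0") (auto simp: product_weight_Suc intro!: mult_conv_measurable)
qed simp

lemma mult_conv_nonneg:
  assumes "\<And>x. f x \<ge> 0" "\<And>x. g x \<ge> 0"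
  shows "mult_conv f g x \<ge> 0"
  unfolding mult_conv_def set_lebesgue_integral_def
  by (rule integral_nonneg_AE) (auto intro!: AE_I2 simp: indicator_def assms)

lemma product_weight_nonneg:
  assumes "\<forall>j\<in>{1..m}. a j > -1"
  shows "product_weight m a x \<ge> 0"
  using assms
proof (induction m arbitrary: x)
  case (Suc m)
  then show ?case
    by (cases "m = 0") (auto simp: product_weight_Suc intro!: mult_conv_nonneg laguerre_weight_nonneg)
qed simp

lemma Gamma_integral_lborel:
  fixes z :: complex
  assumes z: "Re z > 0"
  shows "integrable lborel (\<lambda>u. indicator {0<..} u *\<^sub>R (exp ((z - 1) * of_real (ln u)) * of_real (exp (- u))))"
    and "(\<integral>u. indicator {0<..} u *\<^sub>R (exp ((z - 1) * of_real (ln u)) * of_real (exp (- u))) \<partial>lborel) = Gamma z"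
proof -
  define g where "g = (\<lambda>u. exp ((z - 1) * of_real (ln u)) * complex_of_real (exp (- u)))"
  have g: "complex_of_real u powr (z - 1) / of_real (exp u) = g u" if "u \<in> {0<..}" for u
    using that by (simp add: g_def powr_def Ln_of_real exp_minus divide_inverse)
  have meas: "g \<in> borel_measurable borel" unfolding g_def by measurable
  have abs: "g absolutely_integrable_on {0<..}"
    using absolutely_integrable_Gamma_integral'[OF z] g by (rule set_integrable_cong[THEN iffD1, OF refl refl, rotated]) auto
  then have "set_integrable lborel {0<..} g"
    unfolding set_integrable_def using meas
    by (subst (asm) integrable_completion) auto
  then show 1: "integrable lborel (\<lambda>u. indicator {0<..} u *\<^sub>R (exp ((z - 1) * of_real (ln u)) * of_real (exp (- u))))"
    by (simp add: set_integrable_def g_def)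
  have "(g has_integral Gamma z) {0<..}"
    using Gamma_integral_complex'[OF z] g by (rule has_integral_eq[rotated])
  then have "integral {0<..} g = Gamma z" by (rule integral_unique)
  moreover have "set_lebesgue_integral lborel {0<..} g = integral {0<..} g"
    by (rule set_borel_integral_eq_integral(2)) fact
  ultimately show "(\<integral>u. indicator {0<..} u *\<^sub>R (exp ((z - 1) * of_real (ln u)) * of_real (exp (- u))) \<partial>lborel) = Gamma z"
    by (simp add: set_lebesgue_integral_def g_def)
qed

lemma Gamma_integral_lborel_real:
  fixes z :: real
  assumes z: "z > 0"
  shows "integrable lborel (\<lambda>u. indicator {0<..} u *\<^sub>R (u powr (z - 1) * exp (- u)))"
    and "(\<integral>u. indicator {0<..} u *\<^sub>R (u powr (z - 1) * exp (- u)) \<partial>lborel) = Gamma z"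
proof -
  have e: "(\<lambda>u. indicator {0<..} u *\<^sub>R (exp ((of_real z - 1) * of_real (ln u)) * of_real (exp (- u)))) =
      (\<lambda>u. complex_of_real (indicator {0<..} u *\<^sub>R (u powr (z - 1) * exp (- u))))"
    by (auto simp: indicator_def powr_def exp_of_real[symmetric])
  have z': "Re (of_real z) > 0" using z by simp
  note G = Gamma_integral_lborel[OF z', unfolded e Gamma_complex_of_real]
  show "integrable lborel (\<lambda>u. indicator {0<..} u *\<^sub>R (u powr (z - 1) * exp (- u)))"
    using G(1) by (simp only: complex_of_real_integrable_eq)
  show "(\<integral>u. indicator {0<..} u *\<^sub>R (u powr (z - 1) * exp (- u)) \<partial>lborel) = Gamma z"
    using G(2) by (simp only: integral_complex_of_real of_real_eq_iff)
qed

text \<open>One convolution is undone per step. The line integral for m factors is inserted at y/u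
  and the integrals are exchanged; the integral over \<open>u\<close> is then Euler's integral for
  Gamma(b - s), the new factor on the same line. The identity holds at every y > 0 and not just
  almost everywhere, as required because the weight is differentiated.\<close>

lemma product_weight_Mellin_Barnes:
  fixes a :: "nat \<Rightarrow> real" and c :: real
  assumes "m \<ge> 1" and "\<And>j. j \<in> {1..m} \<Longrightarrow> c < a j" and "\<And>j. j \<in> {1..m} \<Longrightarrow> a j > -1" and "y > 0"
  shows "gpow lborel (Complex c) (Gamma_line {1..m} a c) y = of_real (2 * pi * (\<Prod>j=1..m. Gamma (a j + 1)) * product_weight m a y)"
  using assms
proof (induction m arbitrary: y rule: dec_induct)
  case base
  have "Gamma_line {1..1} a c = (\<lambda>t. Gamma (Complex (a 1 - c) (- t)))" by (auto simp: Gamma_line_def)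
  moreover have "Gamma (a 1 + 1) \<noteq> 0" using base.prems by (simp add: Gamma_eq_zero_iff not_nonpos_Int_of_pos)
  ultimately show ?case
    using Gamma_Mellin_inversion[of c "a 1" y] base.prems by (simp add: laguerre_weight_def)
next
  case (step m)
  define b where "b = a (Suc m)"
  define P where "P = 2 * pi * (\<Prod>j=1..m. Gamma (a j + 1))"
  define \<kappa> where "\<kappa> = Gamma_line {1..m} a c"
  have b: "c < b" "b > -1" using step.prems by (auto simp: b_def)
  have Gb: "Gamma (b + 1) \<noteq> 0" using b by (simp add: Gamma_eq_zero_iff not_nonpos_Int_of_pos)
  have IH: "gpow lborel (Complex c) \<kappa> v = of_real (P * product_weight m a v)" if "v > 0" for v
    unfolding \<kappa>_def P_def using step.prems step.hyps that by (intro step.IH) auto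
  have rd: "rapidly_decreasing \<kappa>"
    unfolding \<kappa>_def using step.prems step.hyps by (intro rapidly_decreasing_Gamma_line) auto
  have ok: "gpow_ok lborel (Complex c) \<kappa>" by (rule rapidly_decreasing_gpow_ok[OF rd])
  have m1 [measurable]: "\<kappa> \<in> borel_measurable borel" "Complex c \<in> borel_measurable borel"
    using gpow_ok_measurable[OF ok] by simp_all
  \<comment> \<open>The joint integrand, regrouped from (y/u)^s u^(b-1) e^(-u) so that y^s stands
    apart from the Gamma integrand u^(b-s-1) e^(-u). Its modulus is a product of a function of
    \<open>u\<close> and a function of \<open>t\<close>, integrable because c < b.\<close>
  define K where "K = (\<lambda>u t. indicator {0<..} u *\<^sub>R ((\<kappa> t * exp (Complex c t * of_real (ln y))) *
      (exp ((of_real b - Complex c t - 1) * of_real (ln u)) * of_real (exp (- u)))))"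
  have K_int: "integrable (lborel \<Otimes>\<^sub>M lborel) (case_prod K)"
  proof (rule Bochner_Integration.integrable_bound)
    show "case_prod K \<in> borel_measurable (lborel \<Otimes>\<^sub>M lborel)"
      unfolding K_def by measurable
    have "integrable lborel (\<lambda>u. indicator {0<..} u *\<^sub>R (u powr (b - c - 1) * exp (- u)))"
      using b by (intro Gamma_integral_lborel_real) simp
    from lborel_pair.integrable_product_mult[OF this integrable_norm[OF gpow_ok_integrable[OF ok, of "ln y"]]]
    show "integrable (lborel \<Otimes>\<^sub>M lborel) (\<lambda>(u, t). indicator {0<..} u *\<^sub>R (u powr (b - c - 1) * exp (- u)) *
        norm (\<kappa> t * exp (Complex c t * of_real (ln y))))" .
    show "AE z in lborel \<Otimes>\<^sub>M lborel. norm (case_prod K z) \<le> norm (case z of (u, t) \<Rightarrow>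
        indicator {0<..} u *\<^sub>R (u powr (b - c - 1) * exp (- u)) * norm (\<kappa> t * exp (Complex c t * of_real (ln y))))"
    proof (rule AE_I2)
      fix z :: "real \<times> real"
      obtain u t where z: "z = (u, t)" by (cases z)
      show "norm (case_prod K z) \<le> norm (case z of (u, t) \<Rightarrow>
          indicator {0<..} u *\<^sub>R (u powr (b - c - 1) * exp (- u)) * norm (\<kappa> t * exp (Complex c t * of_real (ln y))))"
        by (auto simp: z K_def norm_mult abs_mult powr_def indicator_def)
    qed
  qed
  have inner: "(\<integral>t. K u t \<partial>lborel) = of_real (P * Gamma (b + 1)) * of_real (indicator {0<..} u *\<^sub>R (product_weight m a (y / u) * laguerre_weight b u / u))" for u
  proof (cases "u > 0")
    case True
    have "K u t = (\<kappa> t * exp (Complex c t * of_real (ln (y / u)))) * of_real (u powr b * exp (- u) / u)" for t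
    proof -
      have "exp ((of_real b - Complex c t - 1) * of_real (ln u)) = exp (- Complex c t * of_real (ln u)) * exp (of_real ((b - 1) * ln u))"
        by (simp add: exp_add[symmetric] algebra_simps)
      also have "exp (complex_of_real ((b - 1) * ln u)) = of_real (u powr b / u)"
      proof -
        have "exp ((b - 1) * ln u) = u powr b / u" using True by (simp add: powr_def left_diff_distrib exp_diff)
        then show ?thesis by (simp only: exp_of_real)
      qed
      finally have 1: "exp ((of_real b - Complex c t - 1) * of_real (ln u)) = exp (- Complex c t * of_real (ln u)) * of_real (u powr b / u)" .
      have "exp (Complex c t * of_real (ln (y / u))) = exp (Complex c t * of_real (ln y)) * exp (- Complex c t * of_real (ln u))"
        using True \<open>y > 0\<close> by (simp add: ln_div exp_add[symmetric] algebra_simps)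
      then show ?thesis using True unfolding K_def 1 by simp
    qed
    then have "(\<integral>t. K u t \<partial>lborel) = gpow lborel (Complex c) \<kappa> (y / u) * of_real (u powr b * exp (- u) / u)"
      by (simp only: gpow_def integral_mult_left_zero)
    also have "gpow lborel (Complex c) \<kappa> (y / u) = of_real (P * product_weight m a (y / u))"
      using True \<open>y > 0\<close> by (intro IH) simp
    finally show ?thesis using True Gb by (simp add: laguerre_weight_def)
  qed (simp add: K_def)
  have "of_real (P * Gamma (b + 1) * product_weight (Suc m) a y) =
      of_real (P * Gamma (b + 1)) * complex_of_real (\<integral>u. indicator {0<..} u *\<^sub>R (product_weight m a (y / u) * laguerre_weight b u / u) \<partial>lborel)"
    using step.hyps by (simp add: product_weight_Suc mult_conv_def set_lebesgue_integral_def b_def)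
  also have "\<dots> = (\<integral>u. (\<integral>t. K u t \<partial>lborel) \<partial>lborel)"
    unfolding inner integral_mult_right_zero integral_complex_of_real ..
  also have "\<dots> = (\<integral>t. (\<integral>u. K u t \<partial>lborel) \<partial>lborel)"
    by (rule lborel_pair.Fubini_integral[OF K_int, symmetric])
  also have "\<dots> = gpow lborel (Complex c) (Gamma_line {1..Suc m} a c) y"
    unfolding gpow_def
  proof (rule Bochner_Integration.integral_cong[OF refl])
    fix t
    have "(\<integral>u. K u t \<partial>lborel) = (\<kappa> t * exp (Complex c t * of_real (ln y))) *
       (\<integral>u. indicator {0<..} u *\<^sub>R (exp ((of_real b - Complex c t - 1) * of_real (ln u)) * of_real (exp (- u))) \<partial>lborel)"
      unfolding K_def by (simp only: mult_scaleR_right[symmetric] integral_mult_right_zero)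
    also have "(\<integral>u. indicator {0<..} u *\<^sub>R (exp ((of_real b - Complex c t - 1) * of_real (ln u)) * of_real (exp (- u))) \<partial>lborel) = Gamma (of_real b - Complex c t)"
      using b by (intro Gamma_integral_lborel) simp
    also have "of_real b - Complex c t = Complex (b - c) (- t)" by (simp add: complex_eq_iff)
    finally show "(\<integral>u. K u t \<partial>lborel) = Gamma_line {1..Suc m} a c t * exp (Complex c t * of_real (ln y))"
      by (simp add: \<kappa>_def Gamma_line_def b_def mult_ac)
  qed
  finally show ?case by (simp add: P_def b_def mult_ac)
qed

section \<open>Mellin moments of the product weight\<close>

lemma integral_scale_Ioi:
  fixes f :: "real \<Rightarrow> real"
  assumes u: "u > 0"
  shows "(\<integral>x. indicator {0<..} x *\<^sub>R f (x / u) \<partial>lborel) = u * (\<integral>x. indicator {0<..} x *\<^sub>R f x \<partial>lborel)"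
    and "integrable lborel (\<lambda>x. indicator {0<..} x *\<^sub>R f x) \<Longrightarrow> integrable lborel (\<lambda>x. indicator {0<..} x *\<^sub>R f (x / u))"
proof -
  have e: "(\<lambda>x. indicator {0<..} x *\<^sub>R f (x / u)) = (\<lambda>x. (\<lambda>x. indicator {0<..} x *\<^sub>R f x) (0 + (1 / u) * x))"
    using u by (auto simp: indicator_def zero_less_divide_iff)
  have "(\<integral>x. indicator {0<..} x *\<^sub>R f x \<partial>lborel) = \<bar>1 / u\<bar> *\<^sub>R (\<integral>x. (\<lambda>x. indicator {0<..} x *\<^sub>R f x) (0 + (1 / u) * x) \<partial>lborel)"
    by (rule lborel_integral_real_affine) (use u in simp)
  then show "(\<integral>x. indicator {0<..} x *\<^sub>R f (x / u) \<partial>lborel) = u * (\<integral>x. indicator {0<..} x *\<^sub>R f x \<partial>lborel)"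
    unfolding e using u by (simp add: field_simps)
  show "integrable lborel (\<lambda>x. indicator {0<..} x *\<^sub>R f x) \<Longrightarrow> integrable lborel (\<lambda>x. indicator {0<..} x *\<^sub>R f (x / u))"
    unfolding e by (rule lborel_integrable_real_affine) (use u in auto)
qed

lemma mellin_laguerre_weight:
  assumes b: "b > -1" and r: "r > 0" "b + r > 0"
  shows "integrable lborel (\<lambda>y. indicator {0<..} y *\<^sub>R (y powr (r - 1) * laguerre_weight b y))"
    and "mellin (laguerre_weight b) r = Gamma (b + r) / Gamma (b + 1)"
proof -
  have e: "(\<lambda>y. indicator {0<..} y *\<^sub>R (y powr (r - 1) * laguerre_weight b y)) =
      (\<lambda>y. (indicator {0<..} y *\<^sub>R (y powr (b + r - 1) * exp (- y))) / Gamma (b + 1))"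
    by (auto simp: laguerre_weight_def indicator_def powr_add[symmetric] algebra_simps)
  show "integrable lborel (\<lambda>y. indicator {0<..} y *\<^sub>R (y powr (r - 1) * laguerre_weight b y))"
    unfolding e by (intro integrable_divide Gamma_integral_lborel_real r)
  show "mellin (laguerre_weight b) r = Gamma (b + r) / Gamma (b + 1)"
    unfolding mellin_def set_lebesgue_integral_def e integral_divide_zero Gamma_integral_lborel_real(2)[OF r(2)] ..
qed

text \<open>For fixed \<open>u\<close> a rescaling of \<open>x\<close> separates the two factors.
  Nonnegativity makes the modulus of the joint integrand the integrand itself, so the iterated
  integral that gives the value also proves the integrability that Fubini demands.\<close>

lemma mellin_mult_conv:
  assumes [measurable]: "f \<in> borel_measurable borel" "g \<in> borel_measurable borel"
    and f: "integrable lborel (\<lambda>y. indicator {0<..} y *\<^sub>R (y powr (r - 1) * f y))"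
    and g: "integrable lborel (\<lambda>y. indicator {0<..} y *\<^sub>R (y powr (r - 1) * g y))"
    and nonneg: "\<And>x. f x \<ge> 0" "\<And>x. g x \<ge> 0"
  shows "integrable lborel (\<lambda>y. indicator {0<..} y *\<^sub>R (y powr (r - 1) * mult_conv f g y))"
    and "mellin (mult_conv f g) r = mellin f r * mellin g r"
proof -
  define K where "K = (\<lambda>u x. indicator {0<..} u *\<^sub>R (indicator {0<..} x *\<^sub>R (x powr (r - 1) * (f (x / u) * g u / u))))"
  have K: "K u x = indicator {0<..} u *\<^sub>R (u powr (r - 1) * g u / u) * (indicator {0<..} x *\<^sub>R ((x / u) powr (r - 1) * f (x / u)))" for u x
  proof (cases "u > 0 \<and> x > 0")
    case True
    then have "(x / u) powr (r - 1) = x powr (r - 1) / u powr (r - 1)" by (simp add: powr_divide)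
    then show ?thesis using True by (simp add: K_def)
  qed (auto simp: K_def)
  have inner: "(\<integral>x. K u x \<partial>lborel) = (indicator {0<..} u *\<^sub>R (u powr (r - 1) * g u)) * mellin f r" for u
  proof (cases "u > 0")
    case True
    show ?thesis
      unfolding K integral_mult_right_zero integral_scale_Ioi(1)[OF True, of "\<lambda>x. x powr (r - 1) * f x"]
      using True by (simp add: mellin_def set_lebesgue_integral_def)
  qed (simp add: K_def)
  have K_nonneg: "K u x \<ge> 0" for u x
    using nonneg by (auto simp: K_def indicator_def)
  have K_int: "integrable (lborel \<Otimes>\<^sub>M lborel) (case_prod K)"
  proof (rule lborel_pair.Fubini_integrable)
    show "case_prod K \<in> borel_measurable (lborel \<Otimes>\<^sub>M lborel)" unfolding K_def by measurable
    show "integrable lborel (\<lambda>u. \<integral>x. norm (case_prod K (u, x)) \<partial>lborel)"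
    proof -
      have "(\<integral>x. norm (case_prod K (u, x)) \<partial>lborel) = (indicator {0<..} u *\<^sub>R (u powr (r - 1) * g u)) * mellin f r" for u
        using K_nonneg inner[of u] by simp
      then show ?thesis by (simp only: integrable_mult_left[OF g])
    qed
    show "AE u in lborel. integrable lborel (\<lambda>x. case_prod K (u, x))"
    proof (rule AE_I2)
      fix u :: real
      show "integrable lborel (\<lambda>x. case_prod K (u, x))"
      proof (cases "u > 0")
        case True
        show ?thesis
          unfolding split K by (intro integrable_mult_right integral_scale_Ioi(2)[OF True] f)
      qed (simp add: K_def)
    qed
  qed
  have conv: "indicator {0<..} x *\<^sub>R (x powr (r - 1) * mult_conv f g x) = (\<integral>u. K u x \<partial>lborel)" for x
  proof (cases "x > 0")
    case True
    have "K u x = x powr (r - 1) * (indicator {0<..} u *\<^sub>R (f (x / u) * g u / u))" for u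
      using True by (simp add: K_def)
    then have "(\<integral>u. K u x \<partial>lborel) = x powr (r - 1) * (\<integral>u. indicator {0<..} u *\<^sub>R (f (x / u) * g u / u) \<partial>lborel)"
      by (simp only: integral_mult_right_zero)
    then show ?thesis using True by (simp add: mult_conv_def set_lebesgue_integral_def)
  qed (simp add: K_def)
  show "integrable lborel (\<lambda>y. indicator {0<..} y *\<^sub>R (y powr (r - 1) * mult_conv f g y))"
    unfolding conv by (rule lborel_pair.integrable_snd[OF K_int])
  have "mellin (mult_conv f g) r = (\<integral>x. (\<integral>u. K u x \<partial>lborel) \<partial>lborel)"
    unfolding mellin_def set_lebesgue_integral_def conv ..
  also have "\<dots> = (\<integral>u. (\<integral>x. K u x \<partial>lborel) \<partial>lborel)"
    by (rule lborel_pair.Fubini_integral[OF K_int])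
  also have "\<dots> = mellin g r * mellin f r"
    unfolding inner integral_mult_left_zero by (simp add: mellin_def set_lebesgue_integral_def)
  finally show "mellin (mult_conv f g) r = mellin f r * mellin g r" by (simp add: mult.commute)
qed

text \<open>Integrability is carried through the induction because it is a hypothesis of the next
  convolution step. At integer arguments the Gamma quotients become Pochhammer symbols, the form in
  which they appear in the coefficients of \<open>F\<close>.\<close>

lemma mellin_product_weight_aux:
  assumes "m \<ge> 1" "\<forall>j\<in>{1..m}. a j > -1"
  shows "integrable lborel (\<lambda>y. indicator {0<..} y *\<^sub>R (y powr (real n + 1 - 1) * product_weight m a y)) \<and>
    mellin (product_weight m a) (real n + 1) = (\<Prod>j=1..m. pochhammer (a j + 1) n)"
  using assms
proof (induction m rule: dec_induct)
  case base
  then have a1: "a 1 > -1" by simp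
  have "Gamma (a 1 + (real n + 1)) / Gamma (a 1 + 1) = pochhammer (a 1 + 1) n"
    using a1 by (subst pochhammer_Gamma) (auto simp: not_nonpos_Int_of_pos add_ac)
  then show ?case using mellin_laguerre_weight[OF a1, of "real n + 1"] a1 by simp
next
  case (step m)
  have b: "a (Suc m) > -1" using step.prems by simp
  have "Gamma (a (Suc m) + (real n + 1)) / Gamma (a (Suc m) + 1) = pochhammer (a (Suc m) + 1) n"
    using b by (subst pochhammer_Gamma) (auto simp: not_nonpos_Int_of_pos add_ac)
  then have L: "integrable lborel (\<lambda>y. indicator {0<..} y *\<^sub>R (y powr (real n + 1 - 1) * laguerre_weight (a (Suc m)) y))"
    "mellin (laguerre_weight (a (Suc m))) (real n + 1) = pochhammer (a (Suc m) + 1) n"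
    using mellin_laguerre_weight[OF b, of "real n + 1"] b by auto
  have IH: "integrable lborel (\<lambda>y. indicator {0<..} y *\<^sub>R (y powr (real n + 1 - 1) * product_weight m a y))"
    "mellin (product_weight m a) (real n + 1) = (\<Prod>j=1..m. pochhammer (a j + 1) n)"
    using step.IH step.prems by auto
  have nn: "product_weight m a x \<ge> 0" "laguerre_weight (a (Suc m)) x \<ge> 0" for x
    using step.prems b by (auto intro!: product_weight_nonneg laguerre_weight_nonneg)
  note * = mellin_mult_conv[OF product_weight_measurable laguerre_weight_measurable IH(1) L(1) nn]
  show ?case using * step.hyps IH(2) L(2) by (simp add: product_weight_Suc mult.commute del: add_diff_cancel_right')
qed

lemma mellin_product_weight:
  assumes "m \<ge> 1" "\<forall>j\<in>{1..m}. a j > -1"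
  shows "mellin (product_weight m a) (real n + 1) = (\<Prod>j=1..m. pochhammer (a j + 1) n)"
  using mellin_product_weight_aux[OF assms] by blast

section \<open>The two representations and the theorem\<close>

lemma power_le_fact_mult_exp:
  fixes z :: real
  assumes "z \<ge> 0"
  shows "z ^ n \<le> fact n * exp z"
proof -
  have s: "(\<lambda>k. z ^ k /\<^sub>R fact k) sums exp z" by (rule exp_converges)
  have "(\<Sum>k\<in>{n}. z ^ k /\<^sub>R fact k) \<le> (\<Sum>k. z ^ k /\<^sub>R fact k)"
    by (rule sum_le_suminf) (use assms s in \<open>auto simp: sums_iff\<close>)
  also have "\<dots> = exp z" using s by (simp add: sums_iff)
  finally show ?thesis by (simp add: field_simps)
qed

text \<open>From (1+j)^n <= n! exp(1+j) the polynomial is absorbed into the base, leaving the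
  exponential series at exp(1 + r).\<close>

lemma summable_power_exp_over_fact: "summable (\<lambda>j. (1 + real j) ^ n * exp (real j * r) * (B / fact j))"
proof (rule summable_comparison_test')
  show "summable (\<lambda>j. fact n * exp 1 * \<bar>B\<bar> * (exp (1 + r) ^ j /\<^sub>R fact j))"
    by (intro summable_mult summable_exp_generic)
  fix j :: nat
  have "(1 + real j) ^ n \<le> fact n * exp (1 + real j)" by (intro power_le_fact_mult_exp) simp
  then have "(1 + real j) ^ n * (exp (real j * r) * (\<bar>B\<bar> / fact j)) \<le> fact n * exp (1 + real j) * (exp (real j * r) * (\<bar>B\<bar> / fact j))"
    by (intro mult_right_mono) auto
  also have "exp (1 + r) ^ j = exp (real j) * exp (real j * r)"
    by (simp add: exp_of_nat_mult[symmetric] exp_add[symmetric] algebra_simps)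
  then have "fact n * exp (1 + real j) * (exp (real j * r) * (\<bar>B\<bar> / fact j)) = fact n * exp 1 * \<bar>B\<bar> * (exp (1 + r) ^ j /\<^sub>R fact j)"
    by (simp add: exp_add field_simps)
  finally show "norm ((1 + real j) ^ n * exp (real j * r) * (B / fact j)) \<le> fact n * exp 1 * \<bar>B\<bar> * (exp (1 + r) ^ j /\<^sub>R fact j)"
    by (simp add: abs_mult mult.assoc)
qed

section \<open>Coefficients of F and the normalising constant\<close>

definition F_coeff :: "nat \<Rightarrow> (nat \<Rightarrow> real) \<Rightarrow> nat \<Rightarrow> real" where
  "F_coeff M a j = (- 1) ^ j / (fact j * (\<Prod>l=1..M. pochhammer (a l + 1) j))"

lemma F_coeff_summable:
  assumes a: "\<forall>l\<in>{1..M}. a l > -1"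
  shows "summable (\<lambda>j. (1 + real j) ^ n * exp (real j * r) * \<bar>F_coeff M a j\<bar>)"
proof (rule summable_comparison_test')
  define D where "D = (\<Prod>l=1..M. min 1 (a l + 1))"
  have pos: "a l + 1 > 0" if "l \<in> {1..M}" for l using a[rule_format, OF that] by simp
  have D: "D > 0" unfolding D_def using pos by (intro prod_pos) auto
  show "summable (\<lambda>j. (1 + real j) ^ n * exp (real j * r) * ((1 / D) / fact j))"
    by (rule summable_power_exp_over_fact)
  fix j :: nat
  have "D \<le> (\<Prod>l=1..M. pochhammer (a l + 1) j)"
    unfolding D_def using pos by (intro prod_mono conjI pochhammer_real_ge) (auto simp: min_def less_imp_le)
  then have "\<bar>F_coeff M a j\<bar> \<le> 1 / (fact j * D)"
    unfolding F_coeff_def abs_divide using D by (intro frac_le) (auto simp: power_abs abs_mult)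
  then have "(1 + real j) ^ n * exp (real j * r) * \<bar>F_coeff M a j\<bar> \<le> (1 + real j) ^ n * exp (real j * r) * ((1 / D) / fact j)"
    by (intro mult_left_mono) (auto simp: field_simps)
  then show "norm ((1 + real j) ^ n * exp (real j * r) * \<bar>F_coeff M a j\<bar>) \<le> (1 + real j) ^ n * exp (real j * r) * ((1 / D) / fact j)"
    by (simp add: abs_mult)
qed

lemma hard_edge_F_eq_suminf: "hard_edge_F M a u = (\<Sum>j. F_coeff M a j * u ^ j)"
  unfolding hard_edge_F_def F_coeff_def by (simp add: power_minus[of u])

lemma prod_pochhammer_pos:
  assumes "\<forall>l\<in>{1..M}. a l > -1"
  shows "(\<Prod>l=1..M. pochhammer (a l + 1) j) > (0::real)"
proof (intro prod_pos pochhammer_pos)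
  show "a l + 1 > 0" if "l \<in> {1..M}" for l using assms[rule_format, OF that] by simp
qed

lemma gamma_norm_pos:
  assumes "\<forall>l\<in>{1..M}. a l > -1"
  shows "gamma_norm M a > 0"
  unfolding gamma_norm_def
proof (intro prod_pos Gamma_real_pos)
  show "a l + 1 > 0" if "l \<in> {1..M}" for l using assms[rule_format, OF that] by simp
qed

section \<open>The case M = 1: residue series of Bessel type\<close>

definition Bessel_density :: "real \<Rightarrow> nat \<Rightarrow> complex" where
  "Bessel_density b k = (- 1) ^ k / fact k * rGamma (1 + (of_real b + of_nat k))"

text \<open>Here Re s = b + k is unbounded, so the weight Gamma(2 + Re s) grows factorially. It is
  cancelled by the 1/Gamma(1 + b + k) in the density up to the linear factor 1 + b + k, and the
  remaining 1/k! beats every polynomial and exponential. The constant \<open>D\<close> bounds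
  1/Gamma(1 + b + k) uniformly in k.\<close>

lemma hard_edge_density_Bessel:
  assumes b: "b > -1"
  shows "hard_edge_density (count_space UNIV) (\<lambda>k::nat. of_real b + of_nat k) (Bessel_density b) b"
proof (intro hard_edge_density.intro hard_edge_density_axioms.intro)
  show "sigma_finite_measure (count_space (UNIV :: nat set))"
    by (rule sigma_finite_measure_count_space)
  fix n :: nat and r :: real
  define D where "D = 1 / (Gamma (1 + b) * min 1 (1 + b))"
  have b1: "1 + b > 0" using b by simp
  have D: "D > 0" unfolding D_def using b by simp
  define B where "B = (1 + \<bar>b\<bar>) ^ n * (D + 1 + \<bar>b\<bar>) * exp (b * r)"
  have "summable (\<lambda>k. (1 + norm (complex_of_real b + of_nat k)) ^ n * exp (Re (complex_of_real b + of_nat k) * r) *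
      ((1 + Gamma (2 + Re (complex_of_real b + of_nat k))) * norm (Bessel_density b k)))"
  proof (rule summable_comparison_test')
    show "summable (\<lambda>k. (1 + real k) ^ (n + 1) * exp (real k * r) * (B / fact k))"
      by (rule summable_power_exp_over_fact)
    fix k :: nat
    define G where "G = Gamma (1 + b + real k)"
    have pos: "1 + b + real k > 0" using b by simp
    have G: "G > 0" unfolding G_def using pos by simp
    have "1 + (complex_of_real b + of_nat k) = of_real (1 + b + real k)" by simp
    then have "rGamma (1 + (complex_of_real b + of_nat k)) = of_real (inverse G)"
      by (simp only: rGamma_complex_of_real G_def rGamma_inverse_Gamma[of "1 + b + real k"])
    then have N: "norm (Bessel_density b k) = 1 / (fact k * G)"
      using G by (simp add: Bessel_density_def norm_mult norm_divide norm_power norm_inverse divide_inverse)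
    have "1 + Gamma (2 + (b + real k)) = 1 + (1 + b + real k) * G"
      using Gamma_plus1[OF not_nonpos_Int_of_pos[OF pos]] by (simp add: G_def add_ac)
    then have "(1 + Gamma (2 + (b + real k))) * norm (Bessel_density b k) = (1 / G + (1 + b + real k)) / fact k"
      using G unfolding N by (simp add: field_simps)
    also have "\<dots> \<le> ((D + 1 + \<bar>b\<bar>) * (1 + real k)) / fact k"
    proof (intro divide_right_mono)
      have "G = Gamma (1 + b) * pochhammer (1 + b) k"
        using pochhammer_Gamma[OF not_nonpos_Int_of_pos[OF b1], of k] b1
        by (simp add: G_def Gamma_eq_zero_iff not_nonpos_Int_of_pos)
      then have "Gamma (1 + b) * min 1 (1 + b) \<le> G"
        using pochhammer_real_ge[OF b1, of k] b1 by (simp add: mult_left_mono Gamma_real_nonneg)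
      then have "1 / G \<le> D"
        unfolding D_def using G b by (intro divide_left_mono mult_pos_pos) auto
      moreover have "D * 1 \<le> D * (1 + real k)" using D by (intro mult_left_mono) auto
      moreover have "1 + b + real k \<le> (1 + \<bar>b\<bar>) * (1 + real k)"
      proof -
        have "0 \<le> \<bar>b\<bar> * real k" by simp
        then have "1 + b + real k \<le> 1 + \<bar>b\<bar> + real k + \<bar>b\<bar> * real k" using abs_ge_self[of b] by linarith
        then show ?thesis by (simp add: algebra_simps)
      qed
      ultimately show "1 / G + (1 + b + real k) \<le> (D + 1 + \<bar>b\<bar>) * (1 + real k)"
        by (simp only: distrib_right add.assoc)
    qed simp
    finally have 1: "(1 + Gamma (2 + (b + real k))) * norm (Bessel_density b k) \<le> ((D + 1 + \<bar>b\<bar>) * (1 + real k)) / fact k" .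
    have "norm (complex_of_real b + of_nat k) \<le> \<bar>b\<bar> + real k"
      using norm_triangle_ineq[of "complex_of_real b" "of_nat k"] by simp
    moreover have "0 \<le> \<bar>b\<bar> * real k" by simp
    ultimately have "1 + norm (complex_of_real b + of_nat k) \<le> 1 + \<bar>b\<bar> + real k + \<bar>b\<bar> * real k" by linarith
    also have "\<dots> = (1 + \<bar>b\<bar>) * (1 + real k)" by (simp add: algebra_simps)
    finally have "1 + norm (complex_of_real b + of_nat k) \<le> (1 + \<bar>b\<bar>) * (1 + real k)" .
    then have 2: "(1 + norm (complex_of_real b + of_nat k)) ^ n \<le> (1 + \<bar>b\<bar>) ^ n * (1 + real k) ^ n"
      by (simp only: power_mult_distrib[symmetric]) (intro power_mono, auto)
    have n0: "0 \<le> 1 + Gamma (2 + (b + real k))" using b by (intro add_nonneg_nonneg Gamma_real_nonneg) auto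
    then have nn: "0 \<le> (1 + Gamma (2 + (b + real k))) * norm (Bessel_density b k)" by simp
    have "(1 + norm (complex_of_real b + of_nat k)) ^ n * exp ((b + real k) * r) * ((1 + Gamma (2 + (b + real k))) * norm (Bessel_density b k)) \<le>
        ((1 + \<bar>b\<bar>) ^ n * (1 + real k) ^ n) * exp ((b + real k) * r) * (((D + 1 + \<bar>b\<bar>) * (1 + real k)) / fact k)"
      using D by (intro mult_mono 1 2 nn order_refl) auto
    also have "\<dots> = (1 + real k) ^ (n + 1) * exp (real k * r) * (B / fact k)"
    proof -
      have "exp ((b + real k) * r) = exp (b * r) * exp (real k * r)" by (simp only: distrib_right exp_add)
      then show ?thesis
        by (simp only: B_def power_add power_one_right times_divide_eq_right times_divide_eq_left mult_ac)
    qed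
    finally show "norm ((1 + norm (complex_of_real b + of_nat k)) ^ n * exp (Re (complex_of_real b + of_nat k) * r) *
      ((1 + Gamma (2 + Re (complex_of_real b + of_nat k))) * norm (Bessel_density b k))) \<le> (1 + real k) ^ (n + 1) * exp (real k * r) * (B / fact k)"
      using n0 by (simp add: abs_mult)
  qed
  moreover have "norm ((1 + norm (complex_of_real b + of_nat k)) ^ n * exp (Re (complex_of_real b + of_nat k) * r) *
      ((1 + Gamma (2 + Re (complex_of_real b + of_nat k))) * norm (Bessel_density b k))) =
      (1 + norm (complex_of_real b + of_nat k)) ^ n * exp (Re (complex_of_real b + of_nat k) * r) *
      ((1 + Gamma (2 + Re (complex_of_real b + of_nat k))) * norm (Bessel_density b k))" for k
  proof -
    have "0 \<le> 1 + Gamma (2 + (b + real k))" using b by (intro add_nonneg_nonneg Gamma_real_nonneg) auto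
    then show ?thesis by (simp add: abs_mult)
  qed
  ultimately show "integrable (count_space UNIV) (\<lambda>k. (1 + norm (complex_of_real b + of_nat k)) ^ n * exp (Re (complex_of_real b + of_nat k) * r) *
      ((1 + Gamma (2 + Re (complex_of_real b + of_nat k))) * norm (Bessel_density b k)))"
    by (simp only: integrable_count_space_nat_iff)
qed (use b in auto)

lemma hard_edge_representation_Laguerre:
  assumes a: "a 1 > -1" and c: "meijer_contour 1 a c"
  shows "hard_edge_representation (count_space UNIV) (\<lambda>k::nat. of_real (a 1) + of_nat k) (Bessel_density (a 1)) (a 1)
    (gamma_norm 1 a) (F_coeff 1 a) (product_weight 1 a) (hard_edge_F 1 a) (hard_edge_G 1 a c)"
proof -
  define b where "b = a 1"
  have b: "b > -1" using a by (simp add: b_def)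
  interpret hard_edge_density "count_space UNIV" "\<lambda>k::nat. of_real b + of_nat k" "Bessel_density b" b
    by (rule hard_edge_density_Bessel[OF b])
  have al: "\<forall>l\<in>{1..1}. a l > -1" using a by simp
  have mel: "mellin (product_weight 1 a) (real j + 1) = (\<Prod>l=1..1. pochhammer (a l + 1) j)" for j
    by (rule mellin_product_weight) (use al in auto)
  show ?thesis
    unfolding b_def[symmetric]
  proof (intro hard_edge_representation.intro hard_edge_representation_axioms.intro)
    show "hard_edge_density (count_space UNIV) (\<lambda>k::nat. of_real b + of_nat k) (Bessel_density b) b" ..
    show "summable (\<lambda>j. (1 + real j) ^ n * exp (real j * r) * \<bar>F_coeff 1 a j\<bar>)" for n r
      by (rule F_coeff_summable[OF al])
    show "hard_edge_F 1 a u = (\<Sum>j. F_coeff 1 a j * u ^ j)" for u by (rule hard_edge_F_eq_suminf)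
    show "mellin (product_weight 1 a) (real j + 1) \<noteq> 0" for j
      unfolding mel by (rule less_imp_neq[OF prod_pochhammer_pos[OF al], symmetric])
    show "F_coeff 1 a j = (- 1) ^ j / (fact j * mellin (product_weight 1 a) (real j + 1))" for j
      unfolding mel F_coeff_def ..
    fix u :: real assume u: "u > 0"
    show "hard_edge_G 1 a c u = Re (gpow (count_space UNIV) (\<lambda>k::nat. of_real b + of_nat k) (Bessel_density b) u)"
    proof (rule hard_edge_G_one[OF a c u])
      show "(\<lambda>k. (- 1) ^ k / fact k * (rGamma (1 + (of_real (a 1) + of_nat k)) * exp ((of_real (a 1) + of_nat k) * of_real (ln u)))) sums
          gpow (count_space UNIV) (\<lambda>k::nat. of_real b + of_nat k) (Bessel_density b) u"
        using sums_integral_count_space_nat[OF gpow_ok_integrable[OF gpow_ok_\<psi>, of "ln u"]]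
        by (simp add: gpow_def Bessel_density_def b_def mult.assoc)
    qed
    \<comment> \<open>Multiplication by Gamma(1+s) removes the \<open>rGamma\<close> and leaves the
      coefficients of the series of u^b e^(-u), which is the Laguerre weight up to
      normalisation.\<close>
    have e: "Bessel_density b k * Gamma (1 + (of_real b + of_nat k)) = (- 1) ^ k / fact k" for k
    proof -
      have "1 + (complex_of_real b + of_nat k) \<notin> \<int>\<^sub>\<le>\<^sub>0" using b by (intro not_nonpos_Int_of_Re_pos) simp
      then show ?thesis by (simp add: Bessel_density_def rGamma_inverse_Gamma Gamma_eq_zero_iff)
    qed
    have "(\<lambda>k. (- 1) ^ k / fact k * exp ((of_real b + of_nat k) * of_real (ln u))) sums
        gpow (count_space UNIV) (\<lambda>k::nat. of_real b + of_nat k) (\<lambda>k. Bessel_density b k * Gamma (1 + (of_real b + of_nat k))) u"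
      using sums_integral_count_space_nat[OF gpow_ok_integrable[OF gpow_ok_\<psi>_Gamma, of "ln u"]]
      unfolding gpow_def e .
    then have "gpow (count_space UNIV) (\<lambda>k::nat. of_real b + of_nat k) (\<lambda>k. Bessel_density b k * Gamma (1 + (of_real b + of_nat k))) u =
        complex_of_real (u powr b * exp (- u))"
      using exp_mult_ln_sums_power[OF u, of b] sums_unique2 by blast
    then show "product_weight 1 a u = 1 / gamma_norm 1 a *
        Re (gpow (count_space UNIV) (\<lambda>k::nat. of_real b + of_nat k) (\<lambda>k. Bessel_density b k * Gamma (1 + (of_real b + of_nat k))) u)"
      using u by (simp add: laguerre_weight_def gamma_norm_def b_def)
  qed
qed

section \<open>The case M >= 2: absolutely convergent line integral\<close>

definition Meijer_density :: "nat \<Rightarrow> (nat \<Rightarrow> real) \<Rightarrow> real \<Rightarrow> real \<Rightarrow> complex" where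
  "Meijer_density M a c t = of_real (1 / (2 * pi)) * (rGamma (Complex (1 + c) t) * Gamma_line {1..M} a c t)"

text \<open>The real part of \<open>s\<close> is constant on the line, so the Gamma weight is a
  constant factor and rapid decrease suffices. The 1/(2 pi) in the density is 1/(2 pi i) times the i
  from ds = i dt.\<close>

lemma hard_edge_density_Meijer:
  assumes M: "M \<ge> 2" and c: "c > -1" "\<And>j. j \<in> {1..M} \<Longrightarrow> c < a j"
  shows "hard_edge_density lborel (Complex c) (Meijer_density M a c) c"
proof (intro hard_edge_density.intro hard_edge_density_axioms.intro)
  have "rapidly_decreasing (\<lambda>t. rGamma (Complex (1 + c) t) * Gamma_line {1..M} a c t)"
    by (rule rapidly_decreasing_rGamma_Gamma_line) (use M c in auto)
  from gpow_ok_cmult[OF rapidly_decreasing_gpow_ok[OF this], where c = "of_real (1 / (2 * pi))"]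
  have ok: "gpow_ok lborel (Complex c) (Meijer_density M a c)"
    by (simp only: Meijer_density_def[abs_def] mult.commute)
  show "Complex c \<in> borel_measurable lborel" "Meijer_density M a c \<in> borel_measurable lborel"
    by (rule gpow_ok_measurable[OF ok])+
  fix n :: nat and r :: real
  have "integrable lborel (\<lambda>t. (1 + Gamma (2 + c)) * ((1 + norm (Complex c t)) ^ n * exp (Re (Complex c t) * r) * norm (Meijer_density M a c t)))"
    using ok unfolding gpow_ok_def by (intro integrable_mult_right) blast
  then show "integrable lborel (\<lambda>t. (1 + norm (Complex c t)) ^ n * exp (Re (Complex c t) * r) * ((1 + Gamma (2 + Re (Complex c t))) * norm (Meijer_density M a c t)))"
    by (simp add: mult_ac)
qed (use c in \<open>auto intro: lborel.sigma_finite_measure_axioms\<close>)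

lemma hard_edge_representation_Meijer:
  assumes M: "M \<ge> 2" and a: "\<forall>j\<in>{1..M}. a j > -1" and c: "meijer_contour M a c"
    and c': "c' > -1" "\<And>j. j \<in> {1..M} \<Longrightarrow> c' < a j"
  shows "hard_edge_representation lborel (Complex c') (Meijer_density M a c') c'
    (gamma_norm M a) (F_coeff M a) (product_weight M a) (hard_edge_F M a) (hard_edge_G M a c)"
proof -
  have mel: "mellin (product_weight M a) (real j + 1) = (\<Prod>l=1..M. pochhammer (a l + 1) j)" for j
    by (rule mellin_product_weight) (use M a in auto)
  show ?thesis
  proof (intro hard_edge_representation.intro hard_edge_representation_axioms.intro)
    show "hard_edge_density lborel (Complex c') (Meijer_density M a c') c'"
      by (rule hard_edge_density_Meijer[OF M c'])
    show "summable (\<lambda>j. (1 + real j) ^ n * exp (real j * r) * \<bar>F_coeff M a j\<bar>)" for n r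
      by (rule F_coeff_summable[OF a])
    show "hard_edge_F M a u = (\<Sum>j. F_coeff M a j * u ^ j)" for u by (rule hard_edge_F_eq_suminf)
    show "mellin (product_weight M a) (real j + 1) \<noteq> 0" for j
      unfolding mel by (rule less_imp_neq[OF prod_pochhammer_pos[OF a], symmetric])
    show "F_coeff M a j = (- 1) ^ j / (fact j * mellin (product_weight M a) (real j + 1))" for j
      unfolding mel F_coeff_def ..
    fix u :: real assume u: "u > 0"
    show "hard_edge_G M a c u = Re (gpow lborel (Complex c') (Meijer_density M a c') u)"
      unfolding Meijer_density_def[abs_def]
      by (rule hard_edge_G_eq_line_integral[OF M _ c'(2) u]) (use c in \<open>auto simp: meijer_contour_def\<close>)
    have e: "Meijer_density M a c' t * Gamma (1 + Complex c' t) = Gamma_line {1..M} a c' t * of_real (1 / (2 * pi))" for t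
    proof -
      have "1 + Complex c' t = Complex (1 + c') t" by (simp add: complex_eq_iff)
      moreover have "Complex (1 + c') t \<notin> \<int>\<^sub>\<le>\<^sub>0" using c' by (intro not_nonpos_Int_of_Re_pos) simp
      ultimately show ?thesis by (simp add: Meijer_density_def rGamma_inverse_Gamma Gamma_eq_zero_iff)
    qed
    have g: "gamma_norm M a > 0" by (rule gamma_norm_pos[OF a])
    have "gpow lborel (Complex c') (Gamma_line {1..M} a c') u = of_real (2 * pi * gamma_norm M a * product_weight M a u)"
      unfolding gamma_norm_def by (rule product_weight_Mellin_Barnes) (use M a c' u in auto)
    then have "gpow lborel (Complex c') (\<lambda>t. Meijer_density M a c' t * Gamma (1 + Complex c' t)) u = of_real (gamma_norm M a * product_weight M a u)"
      unfolding e gpow_cmult by (simp add: field_simps)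
    then show "product_weight M a u = 1 / gamma_norm M a * Re (gpow lborel (Complex c') (\<lambda>t. Meijer_density M a c' t * Gamma (1 + Complex c' t)) u)"
      using g by simp
  qed
qed

theorem proposition3p2:
  fixes M :: nat and a :: "nat \<Rightarrow> real" and c x y :: real
  assumes "M \<ge> 1"
    and "\<forall>j\<in>{1..M}. a j > -1"
    and "meijer_contour M a c"
    and "x > 0" and "y > 0"
  shows "(\<lambda>N::nat. 1 / real N * laguerre_kernel M a N (x / real N) (y / real N)
            - 1 / gamma_norm M a
              * hard_edge_expansion (hard_edge_F M a) (hard_edge_G M a c) x y N)
           \<in> O(\<lambda>N. 1 / real N ^ 2)
       \<and> (\<lambda>N::nat. 1 / real N * laguerre_kernel M a N (x / real N) (y / real N)
            - 1 / gamma_norm M a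
              * simpler_expansion (hard_edge_F M a) (hard_edge_G M a c) x y N)
           \<in> O(\<lambda>N. 1 / real N ^ 2)"
proof -
  have g: "gamma_norm M a \<noteq> 0" using gamma_norm_pos[OF assms(2)] by simp
  show ?thesis
  proof (cases "M = 1")
    case True
    interpret hard_edge_representation "count_space UNIV" "\<lambda>k::nat. of_real (a 1) + of_nat k" "Bessel_density (a 1)" "a 1"
      "gamma_norm M a" "F_coeff M a" "product_weight M a" "hard_edge_F M a" "hard_edge_G M a c"
      unfolding True by (rule hard_edge_representation_Laguerre) (use assms True in auto)
    show ?thesis unfolding laguerre_kernel_def using hard_edge_expansions[OF assms(4,5) g] by blast
  next
    case False
    then have M: "M \<ge> 2" using assms(1) by simp
    \<comment> \<open>The line used below is (m - 1)/2, the midpoint of -1 and the smallest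
      parameter; it lies strictly between them because all parameters exceed -1.\<close>
    define m where "m = Min (a ` {1..M})"
    have m: "m > -1" unfolding m_def using M assms(2) by (subst Min_gr_iff) auto
    have mj: "m \<le> a j" if "j \<in> {1..M}" for j unfolding m_def using that by (intro Min_le) auto
    interpret hard_edge_representation lborel "Complex ((m - 1) / 2)" "Meijer_density M a ((m - 1) / 2)" "(m - 1) / 2"
      "gamma_norm M a" "F_coeff M a" "product_weight M a" "hard_edge_F M a" "hard_edge_G M a c"
    proof (rule hard_edge_representation_Meijer[OF M assms(2,3)])
      show "(m - 1) / 2 > -1" using m by simp
      show "(m - 1) / 2 < a j" if "j \<in> {1..M}" for j using mj[OF that] m by simp
    qed
    show ?thesis unfolding laguerre_kernel_def using hard_edge_expansions[OF assms(4,5) g] by blast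
  qed
qed

end
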